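(* Let $E$ be an arbitrary graph and $K$ a field. Let $P$ be a proper ideal of $L_K(E)$ with $P\cap E^0=H$. Then $P$ is a prime ideal of $L_K(E)$ if and only if $P$ satisfies one of the following conditions: (i) $P=\langle H,\{v^H:v\in B_H\}\rangle$ (where $B_H$ may be empty) and $E^0\setminus H$ satisfies the MT-3 condition; (ii) $P=\langle H,\{v^H:v\in B_H\setminus\{u\}\}\rangle$ for some $u\in B_H$ (hence $B_H$ is non-empty) and $E^0\setminus H=M(u)$; (iii) $P=\langle H,\{v^H:v\in B_H\},f(c)\rangle$ where $c$ is a cycle without K in $E$ based at a vertex $v$, $E^0\setminus H=M(v)$ and $f(x)$ is an irreducible polynomial in $K[x,x^{-1}]$.
   Context: A graph $E=(E^0,E^1,r,s)$ consists of a set $E^0$ of vertices, a set $E^1$ of edges and maps $r,s:E^1\to E^0$ (range and source); no cardinality restrictions are imposed. A vertex $v$ is a sink if $s^{-1}(v)=\emptyset$, regular if $0<|s^{-1}(v)|<\infty$, an infinite emitter if $|s^{-1}(v)|=\infty$. The Leavitt path algebra $L_K(E)$ is the (not necessarily unital) $K$-algebra generated by pairwise orthogonal idempotents $v\in E^0$ and elements $e,e^*$ ($e\in E^1$) subject to: $s(e)e=e=er(e)$; $r(e)e^*=e^*=e^*s(e)$; $e^*e=r(e)$ and $e^*f=0$ for edges $e\ne f$; $v=\sum_{s(e)=v}ee^*$ for every regular vertex $v$. Ideals are two-sided; $\langle\cdot\rangle$ denotes the ideal generated by the listed elements and sets. A proper ideal $P$ is prime if, for ideals $A,B$, $AB\subseteq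 P$ implies $A\subseteq P$ or $B\subseteq P$. A path is a finite sequence of edges $e_1\cdots e_n$ with $r(e_i)=s(e_{i+1})$ (vertices are paths of length $0$); $(e_1\cdots e_n)^*=e_n^*\cdots e_1^*$. Write $u\ge v$ if there is a path from $u$ to $v$. A cycle based at $v$ is a path $e_1\cdots e_n$ ($n\ge1$) with $s(e_1)=r(e_n)=v$ and $s(e_i)\ne s(e_j)$ for $i\neq j$. A cycle without K is a cycle $c$ such that no vertex on $c$ is the base of another distinct cycle, where cycles are distinct if they have different edge sets (i.e. are not rotations of one another). For a cycle $c$ based at $v$ and $f(x)=\sum a_ix^i\in K[x,x^{-1}]$, $f(c)=\sum a_ic^i$ with $c^0=v$ and $c^{-i}=(c^* )^i$. $M(v)=\{w\in E^0:w\ge v\}$. A set $X\subseteq E^0$ satisfies MT-3 if for all $u,v\in X$ there is $w\in X$ with $u\ge w$ and $v\ge w$. The set $H=P\cap E^0$ is hereditary (if $u\in H$ and $u\ge v$ then $v\in H$) and saturated (if $v$ is regular and $r(s^{-1}(v))\subseteq H$ then $v\in H$). $B_H$ is the set of breaking vertices of $H$: infinite emitters $w\in E^0\setminus H$ for which the number of edges $e$ with $s(e)=w$ and $r(e)\notin H$ is finite and at least $1$. For $v\in B_H$, $v^H=v-\sum_{s(e)=v,\,r(e)\notin H}ee^*$. *)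

theory Defs
  imports
    "Graph_Theory.Arc_Walk"
    "HOL-Algebra.QuotRing"
    "HOL-Algebra.Ideal_Product"
    "HOL-Library.Poly_Mapping"
    "HOL-Computational_Algebra.Factorial_Ring"
begin

section \<open>Two-sided ideals in rings without unit\<close>

text \<open>
  The locales \<open>ring\<close>, \<open>ideal\<close> and \<open>primeideal\<close> of HOL-Algebra presuppose a unit, respectively a
  commutative ring. The notions below do not refer to the \<open>one\<close> field of the record.
\<close>

definition two_sided_ideal :: "'a set \<Rightarrow> ('a, 'b) ring_scheme \<Rightarrow> bool" where
  "two_sided_ideal I R \<longleftrightarrow>
     additive_subgroup I R \<and>
     (\<forall>a\<in>I. \<forall>x\<in>carrier R. x \<otimes>\<^bsub>R\<^esub> a \<in> I \<and> a \<otimes>\<^bsub>R\<^esub> x \<in> I)"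

definition ideal_generated :: "('a, 'b) ring_scheme \<Rightarrow> 'a set \<Rightarrow> 'a set" where
  "ideal_generated R S = \<Inter>{I. two_sided_ideal I R \<and> S \<subseteq> I}"

definition prime_two_sided_ideal :: "'a set \<Rightarrow> ('a, 'b) ring_scheme \<Rightarrow> bool" where
  "prime_two_sided_ideal P R \<longleftrightarrow>
     two_sided_ideal P R \<and> P \<noteq> carrier R \<and>
     (\<forall>A B. two_sided_ideal A R \<longrightarrow> two_sided_ideal B R \<longrightarrow>
        ideal_prod R A B \<subseteq> P \<longrightarrow> A \<subseteq> P \<or> B \<subseteq> P)"


section \<open>Graphs\<close>

text \<open>
  A graph is a \<^const>\<open>wf_digraph\<close> (no finiteness is imposed); \<open>tail\<close> is the source map \<open>s\<close>
  and \<open>head\<close> is the range map \<open>r\<close>. Paths are arc walks.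
\<close>

definition regular_vertex :: "('v, 'e) pre_digraph \<Rightarrow> 'v \<Rightarrow> bool" where
  "regular_vertex E v \<longleftrightarrow> v \<in> verts E \<and> finite (out_arcs E v) \<and> out_arcs E v \<noteq> {}"

definition connects :: "('v, 'e) pre_digraph \<Rightarrow> 'v \<Rightarrow> 'v \<Rightarrow> bool" where
  "connects E u v \<longleftrightarrow> (\<exists>p. pre_digraph.awalk E u p v)"

definition cycle_based_at :: "('v, 'e) pre_digraph \<Rightarrow> 'v \<Rightarrow> 'e list \<Rightarrow> bool" where
  "cycle_based_at E v c \<longleftrightarrow>
     pre_digraph.awalk E v c v \<and> c \<noteq> [] \<and> distinct (map (tail E) c)"

definition cycle_without_K :: "('v, 'e) pre_digraph \<Rightarrow> 'v \<Rightarrow> 'e list \<Rightarrow> bool" where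
  "cycle_without_K E v c \<longleftrightarrow>
     cycle_based_at E v c \<and>
     (\<forall>u \<in> set (map (tail E) c). \<forall>c'. cycle_based_at E u c' \<longrightarrow> set c' = set c)"

definition M :: "('v, 'e) pre_digraph \<Rightarrow> 'v \<Rightarrow> 'v set" where
  "M E v = {w \<in> verts E. connects E w v}"

definition MT3 :: "('v, 'e) pre_digraph \<Rightarrow> 'v set \<Rightarrow> bool" where
  "MT3 E X \<longleftrightarrow> (\<forall>u\<in>X. \<forall>v\<in>X. \<exists>w\<in>X. connects E u w \<and> connects E v w)"

definition arcs_avoiding :: "('v, 'e) pre_digraph \<Rightarrow> 'v set \<Rightarrow> 'v \<Rightarrow> 'e set" where
  "arcs_avoiding E H w = {e \<in> out_arcs E w. head E e \<notin> H}"

definition breaking_vertices :: "('v, 'e) pre_digraph \<Rightarrow> 'v set \<Rightarrow> 'v set" where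
  "breaking_vertices E H =
     {w \<in> verts E - H. infinite (out_arcs E w) \<and>
        finite (arcs_avoiding E H w) \<and> arcs_avoiding E H w \<noteq> {}}"


section \<open>The free algebra on vertices, edges and ghost edges\<close>

text \<open>
  Lists form a monoid under concatenation, so \<open>'g list \<Rightarrow>\<^sub>0 'k\<close> with its convolution product
  is the free unital associative algebra over \<open>'k\<close> on the set of generators \<open>'g\<close>.
\<close>

instantiation list :: (type) monoid_add
begin
definition zero_list :: "'a list" where "zero_list = []"
definition plus_list :: "'a list \<Rightarrow> 'a list \<Rightarrow> 'a list" where "plus_list = (@)"
instance by standard (simp_all add: zero_list_def plus_list_def)
end

datatype ('v, 'e) gen = Vert 'v | Edge 'e | Ghost 'e

type_synonym ('v, 'e, 'k) falg = "('v, 'e) gen list \<Rightarrow>\<^sub>0 'k"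

definition generators :: "('v, 'e) pre_digraph \<Rightarrow> ('v, 'e) gen set" where
  "generators E = Vert ` verts E \<union> Edge ` arcs E \<union> Ghost ` arcs E"

definition scal :: "'k::field \<Rightarrow> ('v, 'e, 'k) falg" where
  "scal a = Poly_Mapping.single [] a"

definition vtx :: "'v \<Rightarrow> ('v, 'e, 'k::field) falg" where
  "vtx v = Poly_Mapping.single [Vert v] 1"

definition edge :: "'e \<Rightarrow> ('v, 'e, 'k::field) falg" where
  "edge e = Poly_Mapping.single [Edge e] 1"

definition ghost :: "'e \<Rightarrow> ('v, 'e, 'k::field) falg" where
  "ghost e = Poly_Mapping.single [Ghost e] 1"

text \<open>
  The free non-unital algebra consists of the elements supported on non-empty words in the
  generators. The \<open>one\<close> field of the record is a dummy outside the carrier.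
\<close>

definition free_algebra :: "('v, 'e) pre_digraph \<Rightarrow> ('v, 'e, 'k::field) falg ring" where
  "free_algebra E =
     \<lparr>carrier = {p. \<forall>w\<in>Poly_Mapping.keys p. w \<noteq> [] \<and> set w \<subseteq> generators E},
      monoid.mult = (*), one = 1, zero = 0, add = (+)\<rparr>"


section \<open>Leavitt path algebras\<close>

text \<open>The differences of the two sides of the defining relations:\<close>

inductive_set leavitt_relations :: "('v, 'e) pre_digraph \<Rightarrow> ('v, 'e, 'k::field) falg set"
  for E where
    vertex_idem: "v \<in> verts E \<Longrightarrow> vtx v * vtx v - vtx v \<in> leavitt_relations E"
  | vertex_orth: "\<lbrakk>v \<in> verts E; w \<in> verts E; v \<noteq> w\<rbrakk> \<Longrightarrow> vtx v * vtx w \<in> leavitt_relations E"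
  | source_edge: "e \<in> arcs E \<Longrightarrow> vtx (tail E e) * edge e - edge e \<in> leavitt_relations E"
  | edge_range: "e \<in> arcs E \<Longrightarrow> edge e * vtx (head E e) - edge e \<in> leavitt_relations E"
  | range_ghost: "e \<in> arcs E \<Longrightarrow> vtx (head E e) * ghost e - ghost e \<in> leavitt_relations E"
  | ghost_source: "e \<in> arcs E \<Longrightarrow> ghost e * vtx (tail E e) - ghost e \<in> leavitt_relations E"
  | CK1_eq: "e \<in> arcs E \<Longrightarrow> ghost e * edge e - vtx (head E e) \<in> leavitt_relations E"
  | CK1_neq: "\<lbrakk>e \<in> arcs E; f \<in> arcs E; e \<noteq> f\<rbrakk> \<Longrightarrow> ghost e * edge f \<in> leavitt_relations E"
  | CK2: "regular_vertex E v \<Longrightarrow>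
      vtx v - (\<Sum>e\<in>out_arcs E v. edge e * ghost e) \<in> leavitt_relations E"

text \<open>
  \<open>L\<^sub>K(E)\<close> is presented as an algebra over the field, so the ideal of relations has to be closed
  under scalars as well. For ideals of \<open>L\<^sub>K(E)\<close> itself this is automatic, because \<open>L\<^sub>K(E)\<close> has
  local units; there \<^const>\<open>two_sided_ideal\<close> is used.
\<close>

definition leavitt_relation_ideal :: "('v, 'e) pre_digraph \<Rightarrow> ('v, 'e, 'k::field) falg set" where
  "leavitt_relation_ideal E =
     \<Inter>{I. two_sided_ideal I (free_algebra E) \<and> (\<forall>a. \<forall>x\<in>I. scal a * x \<in> I) \<and>
           leavitt_relations E \<subseteq> I}"

text \<open>
  The field is recorded in the type only. As in \<^const>\<open>free_algebra\<close>, the \<open>one\<close> field of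
  the record is a dummy.
\<close>

definition leavitt_path_algebra ::
    "('v, 'e) pre_digraph \<Rightarrow> ('v, 'e, 'k::field) falg set ring" where
  "leavitt_path_algebra E = free_algebra E Quot leavitt_relation_ideal E"

text \<open>The element of \<open>L\<^sub>K(E)\<close> represented by an element of the free algebra:\<close>

definition lclass ::
    "('v, 'e) pre_digraph \<Rightarrow> ('v, 'e, 'k::field) falg \<Rightarrow> ('v, 'e, 'k) falg set" where
  "lclass E x = leavitt_relation_ideal E +>\<^bsub>free_algebra E\<^esub> x"

definition lvertex :: "('v, 'e) pre_digraph \<Rightarrow> 'v \<Rightarrow> ('v, 'e, 'k::field) falg set" where
  "lvertex E v = lclass E (vtx v)"

text \<open>The element \<open>v\<^sup>H\<close>:\<close>

definition breaking_elt ::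
    "('v, 'e) pre_digraph \<Rightarrow> 'v set \<Rightarrow> 'v \<Rightarrow> ('v, 'e, 'k::field) falg set" where
  "breaking_elt E H v =
     lclass E (vtx v - (\<Sum>e\<in>arcs_avoiding E H v. edge e * ghost e))"

definition cycle_power :: "'v \<Rightarrow> 'e list \<Rightarrow> int \<Rightarrow> ('v, 'e, 'k::field) falg" where
  "cycle_power v c i =
     (if i = 0 then vtx v
      else if i > 0 then prod_list (map edge c) ^ nat i
      else prod_list (map ghost (rev c)) ^ nat (- i))"

text \<open>
  \<open>int \<Rightarrow>\<^sub>0 'k\<close> with the convolution product is the ring of Laurent polynomials; the following
  is \<open>f(c)\<close> for a cycle \<open>c\<close> based at \<open>v\<close>.
\<close>

definition laurent_at_cycle ::
    "('v, 'e) pre_digraph \<Rightarrow> 'v \<Rightarrow> 'e list \<Rightarrow> (int \<Rightarrow>\<^sub>0 'k::field) \<Rightarrow> ('v, 'e, 'k) falg set" where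
  "laurent_at_cycle E v c f =
     lclass E (\<Sum>i\<in>Poly_Mapping.keys f. scal (Poly_Mapping.lookup f i) * cycle_power v c i)"

end

theory Submission
  imports Defs
begin

text \<open>
  Let \<open>P\<close> be an ideal and \<open>I\<close> an ideal contained in it that contains the same vertices
  and the same elements \<open>v\<^sup>H\<close>. Stripping ghost arcs off an element of \<open>P\<close> from the right leaves
  a combination of paths in \<open>P\<close>; stripping off a shortest path leaves a vertex plus closed paths;
  and conjugating by a path through an exit removes closed paths. Since no new vertex and no new
  \<open>v\<^sup>H\<close> may arise, \<open>P\<close> lies, modulo \<open>I\<close>, in the span of the \<open>\<alpha>\<beta>\<^sup>*\<close> with \<open>\<alpha>\<close> and \<open>\<beta>\<close> ending
  on cycles without exits in the quotient graph. If there is no such cycle, then \<open>P = I\<close>. If all of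
  the quotient graph connects to one such cycle \<open>c\<close>, then the span is a ring of matrices over
  \<open>K[c, c\<^sup>*]\<close>, so \<open>P\<close> is controlled by an ideal of the principal ideal domain \<open>K[x, x\<^sup>-\<^sup>1]\<close>. Primeness
  supplies the connectedness. No structure theory of quotients is needed; the grading of the algebra
  enters only to see that an ideal generated by vertices and \<open>v\<^sup>H\<close>'s contains no nonzero \<open>f(c)\<close>.

  All computations take place in the free unital algebra, a type-class ring: the ideals of
  \<open>L\<^sub>K(E)\<close> correspond to the ideals of this ring that consist of elements without constant term and
  contain the relations as well as all generators that do not belong to the graph.
\<close>

section \<open>Laurent polynomials\<close>

text \<open>The reduction to exitless cycles serves both directions. To prove an ideal prime, it is
  applied with that ideal as \<open>I\<close> and with strictly larger ideals in the role of
  \<open>A\<close>. To analyse a prime ideal, \<open>I\<close> is the ideal generated by the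
  vertices and the \<open>v^H\<close> that the prime contains, and the prime itself takes the role
  of \<open>A\<close>. The obstacle is that CK2 holds only at regular vertices. At an infinite
  emitter ghost arcs cannot be removed by writing v as a sum of all ee^*. Instead one multiplies by
  v minus the ee^* of finitely many arcs, and the vertices where CK2 fails modulo \<open>I\<close>
  fall into three kinds, each with its own way of producing a forbidden vertex or
  \<open>v^H\<close>. A second obstacle is that ideals of L_K(E) are closed under ring operations by
  definition, but not under scalars. Closure under scalars comes from local units: ax = x(au)
  whenever xu = x.\<close>

lemma poly_mapping_sum_single:
  "f = (\<Sum>k\<in>Poly_Mapping.keys f. Poly_Mapping.single k (Poly_Mapping.lookup f k))"
proof (rule poly_mapping_eqI)
  fix j
  show "Poly_Mapping.lookup f j =
    Poly_Mapping.lookup (\<Sum>k\<in>Poly_Mapping.keys f. Poly_Mapping.single k (Poly_Mapping.lookup f k)) j"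
    by (simp add: lookup_sum lookup_single when_def in_keys_iff sum.delta)
qed

lemma poly_mapping_additive_induct [case_names zero single add]:
  fixes f :: "'a \<Rightarrow>\<^sub>0 'b::comm_monoid_add"
  assumes "Q 0" "\<And>k a. Q (Poly_Mapping.single k a)" "\<And>f g. Q f \<Longrightarrow> Q g \<Longrightarrow> Q (f + g)"
  shows "Q f"
proof -
  have "Q (\<Sum>k\<in>S. Poly_Mapping.single k (c k))" if "finite S" for S c
    using that by (induct rule: finite_induct) (auto intro: assms)
  then show ?thesis
    by (subst poly_mapping_sum_single) simp
qed

lemma lookup_single_times_int:
  fixes f :: "int \<Rightarrow>\<^sub>0 'k::comm_ring_1"
  shows "Poly_Mapping.lookup (Poly_Mapping.single i a * f) j = a * Poly_Mapping.lookup f (j - i)"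
  by (induct f rule: poly_mapping_additive_induct)
     (auto simp: mult_single lookup_single when_def lookup_add distrib_left)

definition laurent_ideal :: "(int \<Rightarrow>\<^sub>0 'k::field) set \<Rightarrow> bool" where
  "laurent_ideal A \<longleftrightarrow> 0 \<in> A \<and> (\<forall>f\<in>A. \<forall>g\<in>A. f + g \<in> A) \<and> (\<forall>f\<in>A. \<forall>g. g * f \<in> A)"

lemma laurent_ideal_diff:
  assumes "laurent_ideal A" "f \<in> A" "g \<in> A"
  shows "f - g \<in> A"
proof -
  have "(-1) * g \<in> A" using assms unfolding laurent_ideal_def by blast
  then have "f + (-1) * g \<in> A" using assms unfolding laurent_ideal_def by blast
  then show ?thesis by simp
qed

text \<open>Division with remainder, with the degree replaced by the width of the support: monomials
  are units that shift the support without changing its width, so a nonzero element of least width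
  divides the whole ideal.\<close>

lemma laurent_ideal_principal:
  fixes A :: "(int \<Rightarrow>\<^sub>0 'k::field) set"
  assumes A: "laurent_ideal A" and ne: "\<exists>f\<in>A. f \<noteq> 0"
  obtains d where "d \<in> A" "d \<noteq> 0" "\<And>g. g \<in> A \<Longrightarrow> d dvd g"
proof -
  define W where "W n g \<longleftrightarrow> (\<exists>m. Poly_Mapping.keys g \<subseteq> {m..<m + int n})" for n and g :: "int \<Rightarrow>\<^sub>0 'k"
  have W: "\<exists>n. W n g" for g
  proof -
    define a b where "a = Min (Poly_Mapping.keys g)" and "b = Max (Poly_Mapping.keys g)"
    have "a \<le> x" "x \<le> b" if "x \<in> Poly_Mapping.keys g" for x
      using that unfolding a_def b_def by simp_all
    then have "Poly_Mapping.keys g \<subseteq> {a..<a + int (nat (b + 1 - a))}" by fastforce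
    then show ?thesis unfolding W_def by blast
  qed
  define n where "n = (LEAST n. \<exists>f\<in>A. f \<noteq> 0 \<and> W n f)"
  have "\<exists>n. \<exists>f\<in>A. f \<noteq> 0 \<and> W n f" using ne W by blast
  then have "\<exists>f\<in>A. f \<noteq> 0 \<and> W n f" unfolding n_def by (rule LeastI_ex)
  then obtain d where d: "d \<in> A" "d \<noteq> 0" "W n d" by blast
  have min: "g = 0" if "g \<in> A" "W k g" "k < n" for g k
    using that not_less_Least[of k "\<lambda>n. \<exists>f\<in>A. f \<noteq> 0 \<and> W n f"] unfolding n_def by blast
  obtain l where l: "Poly_Mapping.keys d \<subseteq> {l..<l + int n}" using d(3) unfolding W_def by blast
  have n0: "n > 0" using l d(2) by (cases n) auto
  have top: "Poly_Mapping.lookup d (l + int n - 1) \<noteq> 0"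
  proof
    assume "Poly_Mapping.lookup d (l + int n - 1) = 0"
    then have "l + int n - 1 \<notin> Poly_Mapping.keys d" by (simp add: in_keys_iff)
    have "Poly_Mapping.keys d \<subseteq> {l..<l + int (n - 1)}"
    proof
      fix x assume x: "x \<in> Poly_Mapping.keys d"
      then have "x \<noteq> l + int n - 1" using \<open>l + int n - 1 \<notin> Poly_Mapping.keys d\<close> by blast
      moreover have "x \<ge> l" "x < l + int n" using x l by auto
      ultimately show "x \<in> {l..<l + int (n - 1)}" using n0 by auto
    qed
    then show False using min[OF d(1), of "n - 1"] d(2) n0 unfolding W_def by auto
  qed
  have "d dvd g" if "g \<in> A" "W k g" for g k
    using that
  proof (induct k arbitrary: g rule: less_induct)
    case (less k)
    show ?case
    proof (cases "k < n")
      case True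
      then show ?thesis using min[OF less(2,3)] by simp
    next
      case False
      obtain m where m: "Poly_Mapping.keys g \<subseteq> {m..<m + int k}" using less(3) unfolding W_def by blast
      \<comment> \<open>\<open>q\<close> cancels the top coefficient of \<open>g\<close>. The
        shifted window of \<open>d\<close> ends where that of \<open>g\<close> ends and, as
        \<open>n\<close> \<le> \<open>k\<close>, starts no earlier, so the window shrinks by
        one.\<close>
      define q where "q = Poly_Mapping.single (m + int k - l - int n)
        (Poly_Mapping.lookup g (m + int k - 1) / Poly_Mapping.lookup d (l + int n - 1))"
      define g' where "g' = g - q * d"
      have g'A: "g' \<in> A" unfolding g'_def using A less(2) d(1)
        by (auto intro!: laurent_ideal_diff simp: laurent_ideal_def)
      have lk: "Poly_Mapping.lookup g' j = Poly_Mapping.lookup g j -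
        (Poly_Mapping.lookup g (m + int k - 1) / Poly_Mapping.lookup d (l + int n - 1)) *
        Poly_Mapping.lookup d (j - (m + int k - l - int n))" for j
        unfolding g'_def q_def by (simp add: lookup_minus lookup_single_times_int)
      have "Poly_Mapping.keys g' \<subseteq> {m..<m + int (k - 1)}"
      proof
        fix j assume j: "j \<in> Poly_Mapping.keys g'"
        have out: "Poly_Mapping.lookup g i = 0" if "i < m \<or> i \<ge> m + int k" for i
          using m that by (force simp: in_keys_iff)
        have out': "Poly_Mapping.lookup d i = 0" if "i < l \<or> i \<ge> l + int n" for i
          using l that by (force simp: in_keys_iff)
        have "Poly_Mapping.lookup g' j \<noteq> 0" using j by (simp add: in_keys_iff)
        moreover have "Poly_Mapping.lookup g' (m + int k - 1) = 0" unfolding lk using top by (simp add: algebra_simps)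
        moreover have "Poly_Mapping.lookup g' j = 0" if "j < m" unfolding lk using that False by (simp add: out out')
        moreover have "Poly_Mapping.lookup g' j = 0" if "j \<ge> m + int k" unfolding lk using that False by (simp add: out out')
        ultimately have "j \<noteq> m + int k - 1" "\<not> j < m" "\<not> j \<ge> m + int k" by metis+
        then show "j \<in> {m..<m + int (k - 1)}" by simp
      qed
      then have "W (k - 1) g'" unfolding W_def by blast
      then have "d dvd g'" using less(1)[of "k - 1" g'] g'A False n0 by simp
      then have "d dvd g' + q * d" by (simp add: dvd_add)
      then show ?thesis by (simp add: g'_def)
    qed
  qed
  then show ?thesis using that[OF d(1,2)] W by blast
qed

text \<open>A generator \<open>d\<close> of the ideal (f, g) divides \<open>f\<close>. If
  \<open>d\<close> were not a unit, irreducibility would make it an associate of \<open>f\<close>,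
  and then \<open>f\<close> would divide \<open>g\<close>.\<close>

lemma irreducible_laurent_coprime:
  fixes f g :: "int \<Rightarrow>\<^sub>0 'k::field"
  assumes f: "irreducible f" and g: "\<not> f dvd g"
  obtains a b where "a * f + b * g = 1"
proof -
  define A where "A = {a * f + b * g |a b. True}"
  have f_in: "f \<in> A" unfolding A_def by (rule CollectI, rule exI[of _ 1], rule exI[of _ 0]) simp
  have g_in: "g \<in> A" unfolding A_def by (rule CollectI, rule exI[of _ 0], rule exI[of _ 1]) simp
  have "laurent_ideal A"
    unfolding laurent_ideal_def
  proof (intro conjI ballI allI)
    show "0 \<in> A" unfolding A_def by (rule CollectI, rule exI[of _ 0], rule exI[of _ 0]) simp
  next
    fix x y assume "x \<in> A" "y \<in> A"
    then obtain a b a' b' where "x = a * f + b * g" "y = a' * f + b' * g" unfolding A_def by blast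
    then have "x + y = (a + a') * f + (b + b') * g" by (simp add: algebra_simps)
    then show "x + y \<in> A" unfolding A_def by blast
  next
    fix x y assume "x \<in> A"
    then obtain a b where "x = a * f + b * g" unfolding A_def by blast
    then have "y * x = (y * a) * f + (y * b) * g" by (simp add: algebra_simps)
    then show "y * x \<in> A" unfolding A_def by blast
  qed
  moreover have "f \<noteq> 0" using f by auto
  ultimately obtain d where d: "d \<in> A" and dv: "\<And>h. h \<in> A \<Longrightarrow> d dvd h"
    using f_in by (metis laurent_ideal_principal)
  from dv[OF f_in] obtain s where s: "f = d * s" by blast
  have "d dvd 1"
  proof (rule ccontr)
    assume "\<not> (d dvd 1)"
    then have "s dvd 1" using f s unfolding irreducible_def by blast
    then obtain r where "1 = s * r" by blast
    then have "d = f * r" using s by (simp add: mult.assoc)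
    then have "f dvd d" by simp
    then show False using dv[OF g_in] g dvd_trans by blast
  qed
  then obtain r where "1 = d * r" by blast
  moreover obtain a b where "d = a * f + b * g" using d unfolding A_def by blast
  ultimately have "(r * a) * f + (r * b) * g = 1" by (simp add: algebra_simps)
  then show ?thesis using that by blast
qed

text \<open>If a generator factors, one factor lies in the ideal again and is thus a multiple of the
  generator, so the cofactor is a unit.\<close>

lemma prime_laurent_ideal_irreducible:
  fixes A :: "(int \<Rightarrow>\<^sub>0 'k::field) set"
  assumes A: "laurent_ideal A" and ne: "\<exists>f\<in>A. f \<noteq> 0" and one: "1 \<notin> A"
    and pr: "\<And>f g. f * g \<in> A \<Longrightarrow> f \<in> A \<or> g \<in> A"
  obtains d where "irreducible d" "d \<in> A" "\<And>g. g \<in> A \<Longrightarrow> d dvd g"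
proof -
  obtain d where d: "d \<in> A" "d \<noteq> 0" "\<And>g. g \<in> A \<Longrightarrow> d dvd g"
    using laurent_ideal_principal[OF A ne] by metis
  have "irreducible d"
  unfolding irreducible_def
  proof (intro conjI allI impI)
    show "d \<noteq> 0" by fact
    show "\<not> (d dvd 1)"
    proof
      assume "d dvd 1"
      then obtain r where "1 = r * d" by (metis dvdE mult.commute)
      then show False using A d(1) one unfolding laurent_ideal_def by metis
    qed
    fix a b assume ab: "d = a * b"
    have *: "y dvd 1" if dxy: "d = x * y" "x \<in> A" for x y
    proof -
      obtain z where "x = d * z" using d(3)[OF dxy(2)] by blast
      then have "d * 1 = d * (z * y)" using dxy(1) by (metis mult.assoc mult_1_right)
      then have "1 = z * y" using d(2) by (metis mult_left_cancel)
      then show ?thesis by (metis dvd_triv_right)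
    qed
    show "a dvd 1 \<or> b dvd 1"
      using pr[of a b] d(1) ab *[of a b] *[of b a] by (auto simp: mult.commute)
  qed
  then show ?thesis using that d by blast
qed

section \<open>Ideals of the Leavitt path algebra as ideals of the free unital algebra\<close>

definition ring_ideal :: "'a::ring_1 set \<Rightarrow> bool" where
  "ring_ideal I \<longleftrightarrow> 0 \<in> I \<and> (\<forall>x\<in>I. \<forall>y\<in>I. x + y \<in> I) \<and> (\<forall>x\<in>I. \<forall>r. r * x \<in> I \<and> x * r \<in> I)"

lemma ring_idealD:
  assumes "ring_ideal I"
  shows "0 \<in> I" "x \<in> I \<Longrightarrow> y \<in> I \<Longrightarrow> x + y \<in> I" "x \<in> I \<Longrightarrow> r * x \<in> I" "x \<in> I \<Longrightarrow> x * r \<in> I"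
    "x \<in> I \<Longrightarrow> - x \<in> I" "x \<in> I \<Longrightarrow> y \<in> I \<Longrightarrow> x - y \<in> I"
proof -
  show "0 \<in> I" "x \<in> I \<Longrightarrow> y \<in> I \<Longrightarrow> x + y \<in> I" "x \<in> I \<Longrightarrow> r * x \<in> I" "x \<in> I \<Longrightarrow> x * r \<in> I" for x y r
    using assms unfolding ring_ideal_def by blast+
  have m: "- x \<in> I" if "x \<in> I" for x
  proof -
    have "(- 1) * x \<in> I" using assms that unfolding ring_ideal_def by blast
    then show ?thesis by simp
  qed
  then show "x \<in> I \<Longrightarrow> - x \<in> I" .
  show "x \<in> I \<Longrightarrow> y \<in> I \<Longrightarrow> x - y \<in> I"
    using assms m[of y] unfolding ring_ideal_def by (metis add_uminus_conv_diff)
qed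

lemma ring_ideal_sum:
  assumes "ring_ideal I" "\<And>x. x \<in> S \<Longrightarrow> f x \<in> I"
  shows "sum f S \<in> I"
  using assms(2) by (induct S rule: infinite_finite_induct) (auto simp: ring_idealD[OF assms(1)])

abbreviation monom :: "'g list \<Rightarrow> 'k \<Rightarrow> 'g list \<Rightarrow>\<^sub>0 'k::field" where
  "monom \<equiv> Poly_Mapping.single"

lemma monom_mult: "monom u a * monom w b = monom (u @ w) (a * b)"
  by (simp add: mult_single plus_list_def)

lemma one_monom: "(1 :: 'g list \<Rightarrow>\<^sub>0 'k::field) = monom [] 1"
  by (metis single_one zero_list_def)

section \<open>The augmentation ideal and the restriction to the generators of the graph\<close>

definition augmentation_ideal :: "('v, 'e, 'k::field) falg set" where
  "augmentation_ideal = {x. Poly_Mapping.lookup x [] = 0}"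

text \<open>A concatenation is empty only if both words are, so the constant term is a ring
  homomorphism; the augmentation ideal is its kernel.\<close>

lemma lookup_mult_Nil:
  fixes x y :: "('v, 'e, 'k::field) falg"
  shows "Poly_Mapping.lookup (x * y) [] = Poly_Mapping.lookup x [] * Poly_Mapping.lookup y []"
proof (induct x rule: poly_mapping_additive_induct)
  case (single u a)
  show ?case
  proof (induct y rule: poly_mapping_additive_induct)
    case (single w b)
    then show ?case by (auto simp: monom_mult lookup_single when_def)
  qed (simp_all add: lookup_add distrib_left)
qed (simp_all add: lookup_add distrib_right)

lemma ring_ideal_augmentation: "ring_ideal augmentation_ideal"
  unfolding ring_ideal_def augmentation_ideal_def by (auto simp: lookup_add lookup_mult_Nil)

lemma monom_in_augmentation: "w \<noteq> [] \<Longrightarrow> monom w a \<in> augmentation_ideal"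
  unfolding augmentation_ideal_def by (simp add: lookup_single)

text \<open>The retraction that sends the generators outside the graph to zero. It mediates between
  words over the whole type of generators and words over the generators of \<open>E\<close>.\<close>

definition restr :: "('v, 'e) pre_digraph \<Rightarrow> ('v, 'e, 'k::field) falg \<Rightarrow> ('v, 'e, 'k) falg" where
  "restr E = Poly_Mapping.mapp (\<lambda>w a. if set w \<subseteq> generators E then a else 0)"

lemma lookup_restr:
  "Poly_Mapping.lookup (restr E x) w = (if set w \<subseteq> generators E then Poly_Mapping.lookup x w else 0)"
  by (simp add: restr_def lookup_mapp when_def in_keys_iff)

lemma restr_zero [simp]: "restr E 0 = 0"
  and restr_add: "restr E (x + y) = restr E x + restr E y"
  and restr_diff: "restr E (x - y) = restr E x - restr E y"
  and restr_uminus: "restr E (- x) = - restr E x"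
  by (rule poly_mapping_eqI; simp add: lookup_restr lookup_add lookup_minus)+

lemma restr_monom: "restr E (monom w a) = (if set w \<subseteq> generators E then monom w a else 0)"
  by (rule poly_mapping_eqI) (auto simp: lookup_restr lookup_single when_def)

lemma restr_mult: "restr E (x * y) = restr E x * restr E y"
proof (induct x rule: poly_mapping_additive_induct)
  case (single u a)
  show ?case
    by (induct y rule: poly_mapping_additive_induct)
       (simp_all add: monom_mult restr_monom restr_add distrib_left)
qed (simp_all add: restr_add distrib_right)

lemma restr_idem [simp]: "restr E (restr E x) = restr E x"
  by (rule poly_mapping_eqI) (simp add: lookup_restr)

lemma restr_augmentation: "x \<in> augmentation_ideal \<Longrightarrow> restr E x \<in> augmentation_ideal"
  by (simp add: augmentation_ideal_def lookup_restr)

lemma carrier_free_algebra: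
  "x \<in> carrier (free_algebra E) \<longleftrightarrow> x \<in> augmentation_ideal \<and> restr E x = x"
proof
  assume "x \<in> carrier (free_algebra E)"
  then have k: "w \<noteq> [] \<and> set w \<subseteq> generators E" if "Poly_Mapping.lookup x w \<noteq> 0" for w
    using that by (simp add: free_algebra_def in_keys_iff)
  then have "restr E x = x" by (intro poly_mapping_eqI) (auto simp: lookup_restr)
  moreover have "Poly_Mapping.lookup x [] = 0" using k by blast
  ultimately show "x \<in> augmentation_ideal \<and> restr E x = x" by (simp add: augmentation_ideal_def)
next
  assume *: "x \<in> augmentation_ideal \<and> restr E x = x"
  have "w \<noteq> [] \<and> set w \<subseteq> generators E" if "Poly_Mapping.lookup x w \<noteq> 0" for w
    using that * lookup_restr[of E x w] by (auto simp: augmentation_ideal_def split: if_splits)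
  then show "x \<in> carrier (free_algebra E)" by (simp add: free_algebra_def in_keys_iff)
qed

lemma free_algebra_sel:
  "x \<oplus>\<^bsub>free_algebra E\<^esub> y = x + y" "x \<otimes>\<^bsub>free_algebra E\<^esub> y = x * y" "\<zero>\<^bsub>free_algebra E\<^esub> = 0"
  by (simp_all add: free_algebra_def)

lemmas augmentation_closed = ring_idealD[OF ring_ideal_augmentation]

lemma free_algebra_closed:
  assumes "x \<in> carrier (free_algebra E)" "y \<in> carrier (free_algebra E)"
  shows "x + y \<in> carrier (free_algebra E)" "x - y \<in> carrier (free_algebra E)"
    "- x \<in> carrier (free_algebra E)" "x * y \<in> carrier (free_algebra E)"
    "0 \<in> carrier (free_algebra E)"
  using assms by (simp_all add: carrier_free_algebra restr_add restr_diff restr_uminus restr_mult augmentation_closed)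

lemma abelian_group_free_algebra: "abelian_group (free_algebra E)"
proof (rule abelian_groupI)
  fix x :: "('a, 'b, 'c) falg" assume "x \<in> carrier (free_algebra E)"
  then show "\<exists>y\<in>carrier (free_algebra E). y \<oplus>\<^bsub>free_algebra E\<^esub> x = \<zero>\<^bsub>free_algebra E\<^esub>"
    by (intro bexI[of _ "- x"]) (simp_all add: free_algebra_sel free_algebra_closed)
qed (auto simp: free_algebra_sel free_algebra_closed carrier_free_algebra augmentation_closed restr_add add_ac)

lemma additive_subgroup_free_algebra:
  "additive_subgroup I (free_algebra E) \<longleftrightarrow>
    I \<subseteq> carrier (free_algebra E) \<and> 0 \<in> I \<and> (\<forall>x\<in>I. \<forall>y\<in>I. x + y \<in> I) \<and> (\<forall>x\<in>I. - x \<in> I)"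
proof -
  interpret abelian_group "free_algebra E" by (rule abelian_group_free_algebra)
  have inv: "\<ominus>\<^bsub>free_algebra E\<^esub> x = - x" if "x \<in> carrier (free_algebra E)" for x
    using that by (intro minus_equality) (simp_all add: free_algebra_sel free_algebra_closed)
  then have inv: "inv\<^bsub>add_monoid (free_algebra E)\<^esub> x = - x" if "x \<in> carrier (free_algebra E)" for x
    using that by (simp add: a_inv_def)
  show ?thesis
  proof
    assume "additive_subgroup I (free_algebra E)"
    then have sub: "subgroup I (add_monoid (free_algebra E))" by (simp add: additive_subgroup_def)
    have c: "I \<subseteq> carrier (free_algebra E)" using subgroup.subset[OF sub] by simp
    moreover have "0 \<in> I" using subgroup.one_closed[OF sub] by (simp add: free_algebra_sel)
    moreover have "x + y \<in> I" if "x \<in> I" "y \<in> I" for x y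
      using subgroup.m_closed[OF sub that] by (simp add: free_algebra_sel)
    moreover have "- x \<in> I" if "x \<in> I" for x
      using subgroup.m_inv_closed[OF sub that] unfolding inv[OF subsetD[OF c that]] .
    ultimately show "I \<subseteq> carrier (free_algebra E) \<and> 0 \<in> I \<and> (\<forall>x\<in>I. \<forall>y\<in>I. x + y \<in> I) \<and> (\<forall>x\<in>I. - x \<in> I)"
      by blast
  next
    assume I: "I \<subseteq> carrier (free_algebra E) \<and> 0 \<in> I \<and> (\<forall>x\<in>I. \<forall>y\<in>I. x + y \<in> I) \<and> (\<forall>x\<in>I. - x \<in> I)"
    have "subgroup I (add_monoid (free_algebra E))"
    proof
      show "inv\<^bsub>add_monoid (free_algebra E)\<^esub> x \<in> I" if "x \<in> I" for x
        using that I by (subst inv) auto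
    qed (use I in \<open>auto simp: free_algebra_sel\<close>)
    then show "additive_subgroup I (free_algebra E)" by (simp add: additive_subgroup_def)
  qed
qed

lemma two_sided_ideal_free_algebra:
  "two_sided_ideal I (free_algebra E) \<longleftrightarrow>
    I \<subseteq> carrier (free_algebra E) \<and> 0 \<in> I \<and> (\<forall>x\<in>I. \<forall>y\<in>I. x + y \<in> I) \<and> (\<forall>x\<in>I. - x \<in> I) \<and>
    (\<forall>a\<in>I. \<forall>x\<in>carrier (free_algebra E). x * a \<in> I \<and> a * x \<in> I)"
  unfolding two_sided_ideal_def additive_subgroup_free_algebra by (auto simp: free_algebra_sel)

text \<open>Since foreign generators are killed, most calculations modulo such an ideal need no side
  conditions saying that vertices and arcs belong to the graph.\<close>

definition leavitt_ideal :: "('v, 'e) pre_digraph \<Rightarrow> ('v, 'e, 'k::field) falg set \<Rightarrow> bool" where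
  "leavitt_ideal E I \<longleftrightarrow> ring_ideal I \<and> I \<subseteq> augmentation_ideal \<and> leavitt_relations E \<subseteq> I \<and>
     (\<forall>g. g \<notin> generators E \<longrightarrow> monom [g] 1 \<in> I)"

text \<open>The words removed by \<open>restr\<close> contain a letter outside the graph and are
  multiples of that letter.\<close>

lemma diff_restr_in_leavitt_ideal:
  assumes I: "leavitt_ideal E I"
  shows "x - restr E x \<in> I"
proof -
  have id: "ring_ideal I" using I by (simp add: leavitt_ideal_def)
  note id = ring_idealD[OF id]
  show ?thesis
  proof (induct x rule: poly_mapping_additive_induct)
    case (single w a)
    show ?case
    proof (cases "set w \<subseteq> generators E")
      case False
      then obtain g where g: "g \<in> set w" "g \<notin> generators E" by blast
      then obtain u t where w: "w = u @ [g] @ t" using split_list by fastforce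
      have "monom w a = monom u a * (monom [g] 1 * monom t 1)" by (simp add: monom_mult w)
      moreover have "monom [g] 1 \<in> I" using I g(2) by (simp add: leavitt_ideal_def)
      ultimately have "monom w a \<in> I" by (simp add: id)
      then show ?thesis using False by (simp add: restr_monom)
    qed (simp add: restr_monom id)
  next
    case (add f g)
    then have "(f - restr E f) + (g - restr E g) \<in> I" by (rule id(2))
    then show ?case by (simp add: restr_add algebra_simps)
  qed (simp add: id)
qed

lemma leavitt_relations_carrier:
  assumes "wf_digraph E" "r \<in> leavitt_relations E"
  shows "r \<in> carrier (free_algebra E)"
proof -
  interpret wf_digraph E by fact
  have c: "monom w a \<in> carrier (free_algebra E)" if "w \<noteq> []" "set w \<subseteq> generators E" for w and a :: 'c
    using that by (simp add: carrier_free_algebra monom_in_augmentation restr_monom)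
  have s: "sum f S \<in> carrier (free_algebra E)" if "\<And>e. e \<in> S \<Longrightarrow> f e \<in> carrier (free_algebra E)"
    for S and f :: "'b \<Rightarrow> ('a, 'b, 'c) falg"
    using that free_algebra_closed(5)[OF c c]
    by (induct S rule: infinite_finite_induct)
       (simp_all add: carrier_free_algebra augmentation_closed restr_add)
  show ?thesis
    using assms(2)
    by (cases rule: leavitt_relations.cases)
       (auto simp: vtx_def edge_def ghost_def monom_mult generators_def regular_vertex_def
         intro!: c s free_algebra_closed)
qed

section \<open>Arithmetic of L_K(E) on representatives\<close>

context
  fixes E :: "('v, 'e) pre_digraph" and R F L
  assumes wf: "wf_digraph E"
  defines "R \<equiv> leavitt_relation_ideal E :: ('v, 'e, 'k::field) falg set"
    and "F \<equiv> free_algebra E :: ('v, 'e, 'k) falg ring"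
    and "L \<equiv> leavitt_path_algebra E :: ('v, 'e, 'k) falg set ring"
begin

lemma scal_carrier: "x \<in> carrier F \<Longrightarrow> scal a * x \<in> carrier F"
  unfolding F_def by (simp add: carrier_free_algebra augmentation_closed restr_mult restr_monom scal_def)

lemma relation_ideal:
  shows "two_sided_ideal R F" "x \<in> R \<Longrightarrow> scal a * x \<in> R" "leavitt_relations E \<subseteq> R"
    and relation_ideal_least:
      "two_sided_ideal I F \<Longrightarrow> (\<And>a x. x \<in> I \<Longrightarrow> scal a * x \<in> I) \<Longrightarrow> leavitt_relations E \<subseteq> I \<Longrightarrow> R \<subseteq> I"
proof -
  define Z where "Z = {I. two_sided_ideal I F \<and> (\<forall>a. \<forall>x\<in>I. scal a * x \<in> I) \<and> leavitt_relations E \<subseteq> I}"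
  have R: "R = \<Inter>Z" unfolding R_def Z_def F_def leavitt_relation_ideal_def ..
  \<comment> \<open>The intersection needs a member, because over an empty family it would be the
    whole type; the carrier is one.\<close>
  have "two_sided_ideal (carrier F) F"
    unfolding F_def two_sided_ideal_free_algebra by (auto simp: free_algebra_closed)
      (auto simp: carrier_free_algebra augmentation_closed)
  then have "carrier F \<in> Z" unfolding Z_def using leavitt_relations_carrier[OF wf] scal_carrier by (auto simp: F_def)
  then show "two_sided_ideal R F"
    unfolding R F_def two_sided_ideal_free_algebra
    by (auto simp: Z_def F_def two_sided_ideal_free_algebra)
  show "x \<in> R \<Longrightarrow> scal a * x \<in> R" "leavitt_relations E \<subseteq> R" unfolding R Z_def by auto
  show "two_sided_ideal I F \<Longrightarrow> (\<And>a x. x \<in> I \<Longrightarrow> scal a * x \<in> I) \<Longrightarrow> leavitt_relations E \<subseteq> I \<Longrightarrow> R \<subseteq> I"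
    unfolding R Z_def by auto
qed

lemma relation_ideal_closed:
  "R \<subseteq> carrier F" "0 \<in> R" "x \<in> R \<Longrightarrow> y \<in> R \<Longrightarrow> x + y \<in> R" "x \<in> R \<Longrightarrow> - x \<in> R"
  "x \<in> R \<Longrightarrow> y \<in> carrier F \<Longrightarrow> x * y \<in> R" "x \<in> R \<Longrightarrow> y \<in> carrier F \<Longrightarrow> y * x \<in> R"
  "x \<in> R \<Longrightarrow> y \<in> R \<Longrightarrow> x - y \<in> R"
proof -
  show *: "R \<subseteq> carrier F" "0 \<in> R" "x \<in> R \<Longrightarrow> y \<in> R \<Longrightarrow> x + y \<in> R" "x \<in> R \<Longrightarrow> - x \<in> R"
    "x \<in> R \<Longrightarrow> y \<in> carrier F \<Longrightarrow> x * y \<in> R" "x \<in> R \<Longrightarrow> y \<in> carrier F \<Longrightarrow> y * x \<in> R" for x y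
    using relation_ideal(1) unfolding F_def two_sided_ideal_free_algebra by auto
  show "x \<in> R \<Longrightarrow> y \<in> R \<Longrightarrow> x - y \<in> R" using *(3)[of x "- y"] *(4)[of y] by simp
qed

lemma lclass_eq: "lclass E x = {r + x |r. r \<in> R}"
  unfolding lclass_def R_def a_r_coset_def' by (auto simp: free_algebra_sel)

lemma lclass_eq_iff: "lclass E x = lclass E y \<longleftrightarrow> x - y \<in> R"
proof
  assume "lclass E x = lclass E y"
  moreover have "x \<in> lclass E x" using relation_ideal_closed(2) by (force simp: lclass_eq)
  ultimately obtain r where "x = r + y" "r \<in> R" by (auto simp: lclass_eq)
  then show "x - y \<in> R" by simp
next
  assume d: "x - y \<in> R"
  have "r + x \<in> lclass E y" if "r \<in> R" for r
  proof -
    have "r + x = (r + (x - y)) + y" by simp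
    then show ?thesis using relation_ideal_closed(3)[OF that d] unfolding lclass_eq by blast
  qed
  moreover have "r + y \<in> lclass E x" if "r \<in> R" for r
  proof -
    have "r + y = (r - (x - y)) + x" by simp
    then show ?thesis using relation_ideal_closed(7)[OF that d] unfolding lclass_eq by blast
  qed
  ultimately show "lclass E x = lclass E y" unfolding lclass_eq by fastforce
qed

lemma carrier_L: "carrier L = lclass E ` carrier F"
  unfolding L_def F_def leavitt_path_algebra_def FactRing_def A_RCOSETS_def' lclass_def by auto

lemma lclass_add: "lclass E x \<oplus>\<^bsub>L\<^esub> lclass E y = lclass E (x + y)"
proof -
  have "lclass E x \<oplus>\<^bsub>L\<^esub> lclass E y = {(r + x) + (s + y) |r s. r \<in> R \<and> s \<in> R}"
    unfolding L_def leavitt_path_algebra_def FactRing_def set_add_def'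
    by (auto simp: lclass_eq free_algebra_sel)
  also have "\<dots> = lclass E (x + y)"
  proof (intro equalityI subsetI)
    fix z assume "z \<in> {(r + x) + (s + y) |r s. r \<in> R \<and> s \<in> R}"
    then obtain r s where "z = (r + s) + (x + y)" "r \<in> R" "s \<in> R" by (auto simp: algebra_simps)
    then show "z \<in> lclass E (x + y)" unfolding lclass_eq using relation_ideal_closed(3) by blast
  next
    fix z assume "z \<in> lclass E (x + y)"
    then obtain r where "z = (r + x) + (0 + y)" "r \<in> R" by (auto simp: lclass_eq algebra_simps)
    then show "z \<in> {(r + x) + (s + y) |r s. r \<in> R \<and> s \<in> R}" using relation_ideal_closed(2) by blast
  qed
  finally show ?thesis .
qed

lemma lclass_mult:
  assumes "x \<in> carrier F" "y \<in> carrier F"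
  shows "lclass E x \<otimes>\<^bsub>L\<^esub> lclass E y = lclass E (x * y)"
proof -
  have "lclass E x \<otimes>\<^bsub>L\<^esub> lclass E y = (\<Union>a\<in>lclass E x. \<Union>b\<in>lclass E y. lclass E (a * b))"
    unfolding L_def leavitt_path_algebra_def FactRing_def rcoset_mult_def
    by (simp add: lclass_def free_algebra_sel)
  also have "\<dots> = lclass E (x * y)"
  proof -
    have "lclass E (a * b) = lclass E (x * y)" if ab: "a \<in> lclass E x" "b \<in> lclass E y" for a b
    proof -
      obtain r s where rs: "a = r + x" "b = s + y" "r \<in> R" "s \<in> R" using ab by (auto simp: lclass_eq)
      have "a * b - x * y = r * (s + y) + x * s" by (simp add: rs algebra_simps)
      moreover have "s + y \<in> carrier F"
        using rs(4) assms(2) relation_ideal_closed(1) free_algebra_closed(1) unfolding F_def by blast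
      ultimately show ?thesis
        unfolding lclass_eq_iff using relation_ideal_closed(3,5,6) rs(3,4) assms(1) by auto
    qed
    moreover have "x \<in> lclass E x" "y \<in> lclass E y" using relation_ideal_closed(2) by (force simp: lclass_eq)+
    ultimately show ?thesis by blast
  qed
  finally show ?thesis .
qed

lemma zero_L: "\<zero>\<^bsub>L\<^esub> = lclass E 0"
  unfolding L_def leavitt_path_algebra_def FactRing_def by (simp add: lclass_eq R_def)

lemma abelian_group_L: "abelian_group L"
proof (rule abelian_groupI)
  fix x assume "x \<in> carrier L"
  then obtain y where y: "y \<in> carrier F" "x = lclass E y" unfolding carrier_L by blast
  then have "lclass E (- y) \<oplus>\<^bsub>L\<^esub> x = \<zero>\<^bsub>L\<^esub>" by (simp add: lclass_add zero_L)
  moreover have "lclass E (- y) \<in> carrier L" using y unfolding carrier_L F_def by (simp add: free_algebra_closed)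
  ultimately show "\<exists>y\<in>carrier L. y \<oplus>\<^bsub>L\<^esub> x = \<zero>\<^bsub>L\<^esub>" by blast
next
  show "\<zero>\<^bsub>L\<^esub> \<in> carrier L" unfolding zero_L carrier_L F_def
    by (rule imageI) (simp add: carrier_free_algebra augmentation_closed)
qed (auto simp: carrier_L lclass_add zero_L F_def free_algebra_closed add_ac)

lemma two_sided_ideal_L:
  "two_sided_ideal P L \<longleftrightarrow> P \<subseteq> carrier L \<and> lclass E 0 \<in> P \<and>
    (\<forall>x\<in>carrier F. \<forall>y\<in>carrier F. lclass E x \<in> P \<longrightarrow> lclass E y \<in> P \<longrightarrow> lclass E (x + y) \<in> P) \<and>
    (\<forall>x\<in>carrier F. lclass E x \<in> P \<longrightarrow> lclass E (- x) \<in> P) \<and>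
    (\<forall>x\<in>carrier F. \<forall>y\<in>carrier F. lclass E x \<in> P \<longrightarrow> lclass E (x * y) \<in> P \<and> lclass E (y * x) \<in> P)"
    (is "_ \<longleftrightarrow> ?r")
proof -
  interpret abelian_group L by (rule abelian_group_L)
  have "\<ominus>\<^bsub>L\<^esub> lclass E x = lclass E (- x)" if "x \<in> carrier F" for x
    using that by (intro minus_equality) (auto simp: lclass_add zero_L carrier_L F_def free_algebra_closed)
  then have inv: "inv\<^bsub>add_monoid L\<^esub> lclass E x = lclass E (- x)" if "x \<in> carrier F" for x
    using that by (simp add: a_inv_def)
  show ?thesis
  proof
    assume "two_sided_ideal P L"
    then have sub: "subgroup P (add_monoid L)"
      and m: "\<And>a x. a \<in> P \<Longrightarrow> x \<in> carrier L \<Longrightarrow> x \<otimes>\<^bsub>L\<^esub> a \<in> P \<and> a \<otimes>\<^bsub>L\<^esub> x \<in> P"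
      unfolding two_sided_ideal_def additive_subgroup_def by auto
    have "P \<subseteq> carrier L" "lclass E 0 \<in> P" using subgroup.subset[OF sub] subgroup.one_closed[OF sub] by (simp_all add: zero_L)
    moreover have "lclass E (x + y) \<in> P" if "lclass E x \<in> P" "lclass E y \<in> P" for x y
      using subgroup.m_closed[OF sub that] by (simp add: lclass_add)
    moreover have "lclass E (- x) \<in> P" if "x \<in> carrier F" "lclass E x \<in> P" for x
      using subgroup.m_inv_closed[OF sub that(2)] inv[OF that(1)] by simp
    moreover have "lclass E (x * y) \<in> P \<and> lclass E (y * x) \<in> P"
      if "x \<in> carrier F" "y \<in> carrier F" "lclass E x \<in> P" for x y
      using m[OF that(3), of "lclass E y"] that by (simp add: lclass_mult carrier_L)
    ultimately show ?r by blast
  next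
    assume r: ?r
    then have P: "P \<subseteq> lclass E ` carrier F" by (simp add: carrier_L)
    have "subgroup P (add_monoid L)"
    proof
      show "P \<subseteq> carrier (add_monoid L)" using r by simp
      show "\<one>\<^bsub>add_monoid L\<^esub> \<in> P" using r by (simp add: zero_L)
      fix x assume x: "x \<in> P"
      then obtain x' where x': "x' \<in> carrier F" "x = lclass E x'" using P by blast
      then show "inv\<^bsub>add_monoid L\<^esub> x \<in> P" using r x inv[OF x'(1)] by simp
      fix y assume y: "y \<in> P"
      then obtain y' where y': "y' \<in> carrier F" "y = lclass E y'" using P by blast
      then show "x \<otimes>\<^bsub>add_monoid L\<^esub> y \<in> P" using r x x' y by (simp add: lclass_add)
    qed
    moreover have "x \<otimes>\<^bsub>L\<^esub> a \<in> P \<and> a \<otimes>\<^bsub>L\<^esub> x \<in> P" if a: "a \<in> P" and x: "x \<in> carrier L" for a x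
    proof -
      obtain x' where x': "x' \<in> carrier F" "x = lclass E x'" using x unfolding carrier_L by blast
      obtain a' where a': "a' \<in> carrier F" "a = lclass E a'" using P a by blast
      show ?thesis using r a x' a' by (simp add: lclass_mult)
    qed
    ultimately show "two_sided_ideal P L" unfolding two_sided_ideal_def additive_subgroup_def by blast
  qed
qed

end

section \<open>Calculus of paths modulo an ideal\<close>

lemma scal_simps:
  "scal (a * b) = scal a * scal b" "scal 1 = 1" "scal 0 = 0" "scal (a + b) = scal a + scal b"
  "scal (- a) = - scal a" "scal (a - b) = scal a - scal b"
  by (simp_all add: scal_def monom_mult one_monom single_add single_uminus single_diff)

lemma scal_commute: "x * scal a = scal a * x"
  by (induct x rule: poly_mapping_additive_induct)
     (simp_all add: scal_def monom_mult mult.commute distrib_left distrib_right)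

lemma scal_left_commute: "x * (scal a * y) = scal a * (x * y)"
  by (metis mult.assoc scal_commute)

text \<open>Only sums are formed here; scalars are carried by the spanning elements
  themselves.\<close>

inductive_set add_span :: "'a::comm_monoid_add set \<Rightarrow> 'a set" for X where
  zero: "0 \<in> add_span X"
| base: "x \<in> X \<Longrightarrow> x \<in> add_span X"
| add: "x \<in> add_span X \<Longrightarrow> y \<in> add_span X \<Longrightarrow> x + y \<in> add_span X"

lemma add_span_mono: "X \<subseteq> Y \<Longrightarrow> x \<in> add_span X \<Longrightarrow> x \<in> add_span Y"
  by (erule add_span.induct) (auto intro: add_span.intros)

text \<open>The leading vertex turns the empty path at \<open>u\<close> into the vertex
  \<open>u\<close>, so paths of length zero need no separate treatment. The ghost path
  \<open>gst\<close> is the mirror image.\<close>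

definition pth :: "'v \<Rightarrow> 'e list \<Rightarrow> ('v, 'e, 'k::field) falg" where
  "pth u p = vtx u * prod_list (map edge p)"

definition gst :: "'v \<Rightarrow> 'e list \<Rightarrow> ('v, 'e, 'k::field) falg" where
  "gst u p = prod_list (map ghost (rev p)) * vtx u"

lemma pth_Nil [simp]: "pth u [] = vtx u" and gst_Nil [simp]: "gst u [] = vtx u"
  by (simp_all add: pth_def gst_def)

locale leavitt_quotient = wf_digraph E for E :: "('v, 'e) pre_digraph" +
  fixes I :: "('v, 'e, 'k::field) falg set"
  assumes leavitt_ideal: "leavitt_ideal E I"
begin

lemma ring_ideal: "ring_ideal I"
  using leavitt_ideal by (simp add: leavitt_ideal_def)

lemmas I_closed = ring_idealD[OF ring_ideal]

lemma relation_in: "r \<in> leavitt_relations E \<Longrightarrow> r \<in> I"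
  using leavitt_ideal by (auto simp: leavitt_ideal_def)

definition cg (infix \<open>\<approx>\<close> 50) where "x \<approx> y \<longleftrightarrow> x - y \<in> I"

lemma cg_refl [simp, intro]: "x \<approx> x"
  by (simp add: cg_def I_closed)

lemma cg_sym: "x \<approx> y \<Longrightarrow> y \<approx> x"
  unfolding cg_def using I_closed(5)[of "x - y"] by simp

lemma cg_trans [trans]: "x \<approx> y \<Longrightarrow> y \<approx> z \<Longrightarrow> x \<approx> z"
  unfolding cg_def using I_closed(2)[of "x - y" "y - z"] by simp

lemma cg_add: "x \<approx> y \<Longrightarrow> x' \<approx> y' \<Longrightarrow> x + x' \<approx> y + y'"
  unfolding cg_def using I_closed(2)[of "x - y" "x' - y'"] by (simp add: algebra_simps)

lemma cg_diff: "x \<approx> y \<Longrightarrow> x' \<approx> y' \<Longrightarrow> x - x' \<approx> y - y'"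
  unfolding cg_def using I_closed(6)[of "x - y" "x' - y'"] by (simp add: algebra_simps)

lemma cg_mult: "x \<approx> y \<Longrightarrow> x' \<approx> y' \<Longrightarrow> x * x' \<approx> y * y'"
proof -
  assume "x \<approx> y" "x' \<approx> y'"
  then have "(x - y) * x' + y * (x' - y') \<in> I" unfolding cg_def
    by (intro I_closed(2) I_closed(3)[of "x' - y'"] I_closed(4)[of "x - y"])
  then show ?thesis by (simp add: cg_def algebra_simps)
qed

lemma cg_mult_l: "x \<approx> y \<Longrightarrow> z * x \<approx> z * y"
  and cg_mult_r: "x \<approx> y \<Longrightarrow> x * z \<approx> y * z"
  by (auto intro: cg_mult)

lemma cg_mult_assoc:
  "x * y \<approx> w \<Longrightarrow> x * (y * z) \<approx> w * z"
  by (metis cg_mult_r mult.assoc)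

lemma cg_sum: "(\<And>s. s \<in> S \<Longrightarrow> f s \<approx> g s) \<Longrightarrow> sum f S \<approx> sum g S"
  by (induct S rule: infinite_finite_induct) (auto intro: cg_add)

lemma cg_0: "x \<approx> 0 \<longleftrightarrow> x \<in> I"
  by (simp add: cg_def)

lemma cg_mult_0: "x \<approx> 0 \<Longrightarrow> x * y \<approx> 0" "y \<approx> 0 \<Longrightarrow> x * y \<approx> 0"
  by (simp_all add: cg_0 I_closed)

lemma cg_cong_ideal:
  assumes "ring_ideal A" "I \<subseteq> A" "x \<approx> y"
  shows "x \<in> A \<longleftrightarrow> y \<in> A"
proof -
  have d: "x - y \<in> A" using assms(2,3) by (auto simp: cg_def)
  then show ?thesis
    using ring_idealD(2)[OF assms(1), of "x - y" y] ring_idealD(6)[OF assms(1), of x "x - y"] by auto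
qed

lemma cg_in: "x \<approx> y \<Longrightarrow> x \<in> I \<longleftrightarrow> y \<in> I"
  by (rule cg_cong_ideal[OF ring_ideal]) auto

lemma generator_notin:
  "v \<notin> verts E \<Longrightarrow> vtx v \<in> I" "e \<notin> arcs E \<Longrightarrow> edge e \<in> I" "e \<notin> arcs E \<Longrightarrow> ghost e \<in> I"
  using leavitt_ideal unfolding leavitt_ideal_def generators_def vtx_def edge_def ghost_def by auto

lemma vtx_idem: "vtx v * vtx v \<approx> vtx v"
proof (cases "v \<in> verts E")
  case True
  then show ?thesis unfolding cg_def by (intro relation_in leavitt_relations.intros)
next
  case False
  then show ?thesis unfolding cg_def by (intro I_closed generator_notin)
qed

lemma vtx_orth: "u \<noteq> v \<Longrightarrow> vtx u * vtx v \<approx> 0"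
  using relation_in[OF leavitt_relations.vertex_orth, of u v] I_closed generator_notin(1)
  by (cases "u \<in> verts E"; cases "v \<in> verts E") (auto simp: cg_0)

lemma vtx_edge: "vtx (tail E e) * edge e \<approx> edge e"
  and edge_vtx: "edge e * vtx (head E e) \<approx> edge e"
  and vtx_ghost: "vtx (head E e) * ghost e \<approx> ghost e"
  and ghost_vtx: "ghost e * vtx (tail E e) \<approx> ghost e"
  using relation_in[OF leavitt_relations.source_edge, of e] relation_in[OF leavitt_relations.edge_range, of e]
    relation_in[OF leavitt_relations.range_ghost, of e] relation_in[OF leavitt_relations.ghost_source, of e]
    generator_notin(2,3)[of e]
  by (cases "e \<in> arcs E"; simp add: cg_def I_closed)+

lemma vtx_edge_0: "v \<noteq> tail E e \<Longrightarrow> vtx v * edge e \<approx> 0"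
proof -
  assume "v \<noteq> tail E e"
  have "vtx v * edge e \<approx> vtx v * (vtx (tail E e) * edge e)" by (rule cg_mult_l[OF cg_sym[OF vtx_edge]])
  also have "\<dots> = (vtx v * vtx (tail E e)) * edge e" by (simp add: mult.assoc)
  also have "\<dots> \<approx> 0" by (rule cg_mult_0(1)[OF vtx_orth[OF \<open>v \<noteq> tail E e\<close>]])
  finally show ?thesis .
qed

lemma edge_vtx_0: "v \<noteq> head E e \<Longrightarrow> edge e * vtx v \<approx> 0"
proof -
  assume "v \<noteq> head E e"
  have "edge e * vtx v \<approx> (edge e * vtx (head E e)) * vtx v" by (rule cg_mult_r[OF cg_sym[OF edge_vtx]])
  also have "\<dots> = edge e * (vtx (head E e) * vtx v)" by (simp add: mult.assoc)
  also have "\<dots> \<approx> 0" using \<open>v \<noteq> head E e\<close> by (intro cg_mult_0(2) vtx_orth) simp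
  finally show ?thesis .
qed

lemma vtx_ghost_0: "v \<noteq> head E e \<Longrightarrow> vtx v * ghost e \<approx> 0"
proof -
  assume "v \<noteq> head E e"
  have "vtx v * ghost e \<approx> vtx v * (vtx (head E e) * ghost e)" by (rule cg_mult_l[OF cg_sym[OF vtx_ghost]])
  also have "\<dots> = (vtx v * vtx (head E e)) * ghost e" by (simp add: mult.assoc)
  also have "\<dots> \<approx> 0" by (rule cg_mult_0(1)[OF vtx_orth[OF \<open>v \<noteq> head E e\<close>]])
  finally show ?thesis .
qed

lemma ghost_vtx_0: "v \<noteq> tail E e \<Longrightarrow> ghost e * vtx v \<approx> 0"
proof -
  assume "v \<noteq> tail E e"
  have "ghost e * vtx v \<approx> (ghost e * vtx (tail E e)) * vtx v" by (rule cg_mult_r[OF cg_sym[OF ghost_vtx]])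
  also have "\<dots> = ghost e * (vtx (tail E e) * vtx v)" by (simp add: mult.assoc)
  also have "\<dots> \<approx> 0" using \<open>v \<noteq> tail E e\<close> by (intro cg_mult_0(2) vtx_orth) simp
  finally show ?thesis .
qed

lemma ghost_edge: "e \<in> arcs E \<Longrightarrow> ghost e * edge e \<approx> vtx (head E e)"
  unfolding cg_def by (intro relation_in leavitt_relations.intros)

lemma ghost_edge_0: "e \<noteq> f \<Longrightarrow> ghost e * edge f \<approx> 0"
  using relation_in[OF leavitt_relations.CK1_neq, of e f] I_closed generator_notin
  by (cases "e \<in> arcs E"; cases "f \<in> arcs E") (auto simp: cg_0)

lemma CK2: "regular_vertex E v \<Longrightarrow> vtx v \<approx> (\<Sum>e\<in>out_arcs E v. edge e * ghost e)"
  unfolding cg_def by (intro relation_in leavitt_relations.intros)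

section \<open>Products of paths and ghost paths\<close>

lemma pth_Cons:
  assumes "tail E e = u"
  shows "pth u (e # p) \<approx> edge e * pth (head E e) p"
proof -
  have "pth u (e # p) = (vtx (tail E e) * edge e) * prod_list (map edge p)"
    by (simp add: pth_def mult.assoc assms)
  also have "\<dots> \<approx> edge e * prod_list (map edge p)" by (rule cg_mult_r[OF vtx_edge])
  also have "\<dots> \<approx> (edge e * vtx (head E e)) * prod_list (map edge p)" by (rule cg_mult_r[OF cg_sym[OF edge_vtx]])
  also have "\<dots> = edge e * pth (head E e) p" by (simp add: pth_def mult.assoc)
  finally show ?thesis .
qed

lemma gst_Cons:
  assumes "tail E e = u"
  shows "gst u (e # p) \<approx> gst (head E e) p * ghost e"
proof -
  have "gst u (e # p) = prod_list (map ghost (rev p)) * (ghost e * vtx (tail E e))"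
    by (simp add: gst_def mult.assoc assms)
  also have "\<dots> \<approx> prod_list (map ghost (rev p)) * ghost e" by (rule cg_mult_l[OF ghost_vtx])
  also have "\<dots> \<approx> prod_list (map ghost (rev p)) * (vtx (head E e) * ghost e)" by (rule cg_mult_l[OF cg_sym[OF vtx_ghost]])
  also have "\<dots> = gst (head E e) p * ghost e" by (simp add: gst_def mult.assoc)
  finally show ?thesis .
qed

lemma vtx_pth: "vtx u * pth u p \<approx> pth u p"
  unfolding pth_def using cg_mult_r[OF vtx_idem] by (simp add: mult.assoc)

lemma vtx_pth_0: "v \<noteq> u \<Longrightarrow> vtx v * pth u p \<approx> 0"
  unfolding pth_def using cg_mult_0(1)[OF vtx_orth] by (metis mult.assoc)

lemma gst_vtx: "gst u p * vtx u \<approx> gst u p"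
  unfolding gst_def using cg_mult_l[OF vtx_idem] by (simp add: mult.assoc)

lemma gst_vtx_0: "v \<noteq> u \<Longrightarrow> gst u p * vtx v \<approx> 0"
  unfolding gst_def using cg_mult_0(2)[OF vtx_orth] by (metis mult.assoc)

lemma pth_append:
  assumes "awalk u p w"
  shows "pth u (p @ q) \<approx> pth u p * pth w q"
  using assms
proof (induct p arbitrary: u)
  case Nil
  then show ?case by (simp add: awalk_Nil_iff cg_sym[OF vtx_pth])
next
  case (Cons e p)
  then have e: "tail E e = u" "awalk (head E e) p w" by (auto simp: awalk_Cons_iff)
  have "pth u ((e # p) @ q) \<approx> edge e * pth (head E e) (p @ q)" using pth_Cons[OF e(1)] by simp
  also have "\<dots> \<approx> edge e * (pth (head E e) p * pth w q)" by (rule cg_mult_l[OF Cons(1)[OF e(2)]])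
  also have "\<dots> = (edge e * pth (head E e) p) * pth w q" by (simp add: mult.assoc)
  also have "\<dots> \<approx> pth u (e # p) * pth w q" by (rule cg_mult_r[OF cg_sym[OF pth_Cons[OF e(1)]]])
  finally show ?case .
qed

lemma gst_append:
  assumes "awalk u p w"
  shows "gst u (p @ q) \<approx> gst w q * gst u p"
  using assms
proof (induct p arbitrary: u)
  case Nil
  then show ?case by (simp add: awalk_Nil_iff cg_sym[OF gst_vtx])
next
  case (Cons e p)
  then have e: "tail E e = u" "awalk (head E e) p w" by (auto simp: awalk_Cons_iff)
  have "gst u ((e # p) @ q) \<approx> gst (head E e) (p @ q) * ghost e" using gst_Cons[OF e(1)] by simp
  also have "\<dots> \<approx> (gst w q * gst (head E e) p) * ghost e" by (rule cg_mult_r[OF Cons(1)[OF e(2)]])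
  also have "\<dots> = gst w q * (gst (head E e) p * ghost e)" by (simp add: mult.assoc)
  also have "\<dots> \<approx> gst w q * gst u (e # p)" by (rule cg_mult_l[OF cg_sym[OF gst_Cons[OF e(1)]]])
  finally show ?case .
qed

lemma pth_vtx: "awalk u p w \<Longrightarrow> pth u p * vtx w \<approx> pth u p"
  using cg_sym[OF pth_append, of u p w "[]"] by simp

lemma vtx_gst: "awalk u p w \<Longrightarrow> vtx w * gst u p \<approx> gst u p"
  using cg_sym[OF gst_append, of u p w "[]"] by simp

text \<open>CK1 cancels the arcs from the inside of the product outwards.\<close>

lemma gst_pth:
  assumes "awalk u p w"
  shows "gst u p * pth u p \<approx> vtx w"
  using assms
proof (induct p arbitrary: u)
  case Nil
  then show ?case by (simp add: awalk_Nil_iff vtx_idem)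
next
  case (Cons e p)
  then have e: "e \<in> arcs E" "tail E e = u" "awalk (head E e) p w" by (auto simp: awalk_Cons_iff)
  have "gst u (e # p) * pth u (e # p) \<approx> (gst (head E e) p * ghost e) * (edge e * pth (head E e) p)"
    by (rule cg_mult[OF gst_Cons[OF e(2)] pth_Cons[OF e(2)]])
  also have "\<dots> = gst (head E e) p * ((ghost e * edge e) * pth (head E e) p)" by (simp add: mult.assoc)
  also have "\<dots> \<approx> gst (head E e) p * (vtx (head E e) * pth (head E e) p)"
    by (rule cg_mult_l[OF cg_mult_r[OF ghost_edge[OF e(1)]]])
  also have "\<dots> \<approx> gst (head E e) p * pth (head E e) p" by (rule cg_mult_l[OF vtx_pth])
  also have "\<dots> \<approx> vtx w" by (rule Cons(1)[OF e(3)])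
  finally show ?case .
qed

lemma gst_pth_append:
  assumes "awalk u p w"
  shows "gst u p * pth u (p @ q) \<approx> pth w q"
proof -
  have "gst u p * pth u (p @ q) \<approx> gst u p * (pth u p * pth w q)" by (rule cg_mult_l[OF pth_append[OF assms]])
  also have "\<dots> = (gst u p * pth u p) * pth w q" by (simp add: mult.assoc)
  also have "\<dots> \<approx> vtx w * pth w q" by (rule cg_mult_r[OF gst_pth[OF assms]])
  also have "\<dots> \<approx> pth w q" by (rule vtx_pth)
  finally show ?thesis .
qed

text \<open>Where the two walks part, CK1 gives a factor e^*f = 0; if their sources differ, the
  source vertices are already orthogonal.\<close>

lemma gst_pth_0:
  assumes "awalk u p w" "awalk u' q w'" "u = u' \<Longrightarrow> (\<nexists>r. q = p @ r) \<and> (\<nexists>r. p = q @ r)"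
  shows "gst u p * pth u' q \<approx> 0"
  using assms
proof (induct p arbitrary: u u' q)
  case Nil
  then have "u \<noteq> u'" by auto
  then show ?case by (simp add: vtx_pth_0)
next
  case (Cons e p)
  then have e: "e \<in> arcs E" "tail E e = u" "awalk (head E e) p w" by (auto simp: awalk_Cons_iff)
  show ?case
  proof (cases "u = u'")
    case False
    have "gst u (e # p) * pth u' q \<approx> (gst u (e # p) * vtx u) * pth u' q" by (rule cg_mult_r[OF cg_sym[OF gst_vtx]])
    also have "\<dots> = gst u (e # p) * (vtx u * pth u' q)" by (simp add: mult.assoc)
    also have "\<dots> \<approx> 0" by (intro cg_mult_0(2) vtx_pth_0 False)
    finally show ?thesis .
  next
    case True
    then obtain f q' where q: "q = f # q'" using Cons(4) by (cases q) auto
    then have f: "f \<in> arcs E" "tail E f = u'" "awalk (head E f) q' w'" using Cons(3) by (auto simp: awalk_Cons_iff)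
    have "gst u (e # p) * pth u' q \<approx> (gst (head E e) p * ghost e) * (edge f * pth (head E f) q')"
      unfolding q by (rule cg_mult[OF gst_Cons[OF e(2)] pth_Cons[OF f(2)]])
    also have "\<dots> = gst (head E e) p * ((ghost e * edge f) * pth (head E f) q')" by (simp add: mult.assoc)
    also have "\<dots> \<approx> 0"
    proof (cases "e = f")
      case False
      then show ?thesis by (intro cg_mult_0(2) cg_mult_0(1) ghost_edge_0)
    next
      case ef: True
      have "gst (head E e) p * ((ghost e * edge f) * pth (head E f) q')
          \<approx> gst (head E e) p * (vtx (head E e) * pth (head E e) q')"
        using ef e by (auto intro!: cg_mult_l cg_mult_r ghost_edge)
      also have "\<dots> \<approx> gst (head E e) p * pth (head E e) q'" by (rule cg_mult_l[OF vtx_pth])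
      also have "\<dots> \<approx> 0" using Cons(1)[OF e(3), of "head E f" q'] f(3) ef Cons(4)[OF True] q by auto
      finally show ?thesis .
    qed
    finally show ?thesis .
  qed
qed

lemma gst_edge_0:
  assumes "u \<noteq> tail E f"
  shows "gst u p * edge f \<approx> 0"
  unfolding gst_def using cg_mult_0(2)[OF vtx_edge_0[OF assms]] by (metis mult.assoc)

lemma gst_edge:
  assumes "awalk u (e # p) w"
  shows "gst u (e # p) * edge f \<approx> (if e = f then gst (head E e) p else 0)"
proof -
  have e: "e \<in> arcs E" "tail E e = u" "awalk (head E e) p w" using assms by (auto simp: awalk_Cons_iff)
  have "gst u (e # p) * edge f \<approx> (gst (head E e) p * ghost e) * edge f" by (rule cg_mult_r[OF gst_Cons[OF e(2)]])
  also have "\<dots> = gst (head E e) p * (ghost e * edge f)" by (simp add: mult.assoc)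
  also have "\<dots> \<approx> (if e = f then gst (head E e) p else 0)"
  proof (cases "e = f")
    case True
    have "gst (head E e) p * (ghost e * edge f) \<approx> gst (head E e) p * vtx (head E e)"
      using True e by (auto intro!: cg_mult_l ghost_edge)
    also have "\<dots> \<approx> gst (head E e) p" by (rule gst_vtx)
    finally show ?thesis using True by simp
  next
    case False
    then show ?thesis by (auto intro: cg_mult_0(2) ghost_edge_0)
  qed
  finally show ?thesis .
qed

section \<open>Spanning by the monomials pq^* and local units\<close>

lemma pth_in_augmentation: "pth u p \<in> augmentation_ideal" and gst_in_augmentation: "gst u p \<in> augmentation_ideal"
  unfolding pth_def gst_def by (intro augmentation_closed; simp add: vtx_def monom_in_augmentation)+

text \<open>The bound \<open>d\<close> on the number of ghost arcs is the induction parameter when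
  they are stripped off; \<open>X\<close> restricts the common end of the two walks.\<close>

definition std :: "'v set \<Rightarrow> nat \<Rightarrow> ('v, 'e, 'k) falg set" where
  "std X d = {scal k * (pth u p * gst u' q) |k u p u' q w. awalk u p w \<and> awalk u' q w \<and> w \<in> X \<and> length q \<le> d}"

lemma stdI:
  "awalk u p w \<Longrightarrow> awalk u' q w \<Longrightarrow> w \<in> X \<Longrightarrow> length q \<le> d \<Longrightarrow> scal k * (pth u p * gst u' q) \<in> std X d"
  unfolding std_def by blast

lemma std_mono:
  assumes "d \<le> d'" "X \<subseteq> Y"
  shows "std X d \<subseteq> std Y d'"
proof
  fix x assume "x \<in> std X d"
  then obtain k u p u' q w where
    "x = scal k * (pth u p * gst u' q)" "awalk u p w" "awalk u' q w" "w \<in> X" "length q \<le> d"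
    unfolding std_def by blast
  then show "x \<in> std Y d'" using assms by (auto intro!: stdI)
qed

definition reduced :: "('v, 'e, 'k) falg \<Rightarrow> bool" where
  "reduced x \<longleftrightarrow> x \<approx> 0 \<or> (\<exists>u p u' q w. awalk u p w \<and> awalk u' q w \<and> x \<approx> pth u p * gst u' q)"

lemma reduced_cong: "x \<approx> y \<Longrightarrow> reduced y \<Longrightarrow> reduced x"
  unfolding reduced_def by (meson cg_trans)

lemma reducedI: "awalk u p w \<Longrightarrow> awalk u' q w \<Longrightarrow> reduced (pth u p * gst u' q)"
  unfolding reduced_def by blast

lemma reduced_0: "reduced 0" "x \<in> I \<Longrightarrow> reduced x"
  unfolding reduced_def by (auto simp: cg_0)

text \<open>A vertex or an arc has to fit the source of \<open>p\<close>, otherwise the product is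
  zero. A ghost arc cancels the first arc of \<open>p\<close> or, if \<open>p\<close> is empty,
  lengthens the ghost part.\<close>

lemma reduced_letter_mult:
  assumes "awalk u p w" "awalk u' q w"
  shows "reduced (monom [g] 1 * (pth u p * gst u' q))"
proof (cases g)
  case (Vert v)
  have "vtx v * (pth u p * gst u' q) \<approx> (if v = u then pth u p else 0) * gst u' q"
    by (rule cg_mult_assoc) (simp add: vtx_pth vtx_pth_0)
  then show ?thesis using reduced_cong reducedI[OF assms] reduced_0 Vert by (fastforce simp: vtx_def split: if_splits)
next
  case (Edge e)
  show ?thesis
  proof (cases "e \<in> arcs E \<and> u = head E e")
    case True
    have "edge e * (pth u p * gst u' q) \<approx> pth (tail E e) (e # p) * gst u' q"
      using cg_sym[OF pth_Cons[of e "tail E e" p]] True by (intro cg_mult_assoc) simp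
    moreover have "reduced (pth (tail E e) (e # p) * gst u' q)"
      using True assms by (intro reducedI) (auto simp: awalk_Cons_iff)
    ultimately show ?thesis using reduced_cong Edge by (simp add: edge_def)
  next
    case False
    have "edge e * (pth u p * gst u' q) \<approx> 0"
    proof (cases "e \<in> arcs E")
      case True
      then have "edge e * vtx u \<approx> 0" using False by (intro edge_vtx_0) auto
      then have "edge e * vtx u * (prod_list (map edge p) * gst u' q) \<approx> 0" by (rule cg_mult_0)
      then show ?thesis by (simp add: pth_def mult.assoc)
    qed (auto simp: cg_0 intro: I_closed generator_notin)
    then show ?thesis using reduced_cong reduced_0 Edge by (auto simp: edge_def)
  qed
next
  case (Ghost e)
  have "reduced (ghost e * (pth u p * gst u' q))"
  proof (cases "e \<in> arcs E \<and> tail E e = u")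
    case False
    have "ghost e * (pth u p * gst u' q) \<approx> 0"
    proof (cases "e \<in> arcs E")
      case True
      then have "ghost e * vtx u \<approx> 0" using False by (intro ghost_vtx_0) auto
      then have "ghost e * vtx u * (prod_list (map edge p) * gst u' q) \<approx> 0" by (rule cg_mult_0)
      then show ?thesis by (simp add: pth_def mult.assoc)
    qed (auto simp: cg_0 intro: I_closed generator_notin)
    then show ?thesis using reduced_cong reduced_0 by blast
  next
    case True
    show ?thesis
    proof (cases p)
      case Nil
      then have u: "u = w" "awalk u' q u" using assms by (auto simp: awalk_Nil_iff)
      have "awalk u [e] (head E e)" using True arc_implies_awalk[of e] by auto
      then have aw: "awalk u' (q @ [e]) (head E e)" by (rule awalk_appendI[OF u(2)])
      have "ghost e * (pth u p * gst u' q) \<approx> ghost e * gst u' q"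
        unfolding Nil pth_Nil by (rule cg_mult_l[OF vtx_gst[OF u(2)]])
      also have "\<dots> \<approx> gst u [e] * gst u' q"
        using True ghost_vtx[of e] by (intro cg_mult_r cg_sym[of "gst u [e]"]) (simp add: gst_def)
      also have "\<dots> \<approx> gst u' (q @ [e])" by (rule cg_sym[OF gst_append[OF u(2)]])
      also have "\<dots> \<approx> pth (head E e) [] * gst u' (q @ [e])"
        by (simp add: cg_sym[OF vtx_gst[OF aw]])
      finally show ?thesis
        by (rule reduced_cong) (rule reducedI[OF _ aw], use True in \<open>simp add: awalk_Nil_iff\<close>)
    next
      case (Cons f p')
      then have f: "f \<in> arcs E" "tail E f = u" "awalk (head E f) p' w" using assms by (auto simp: awalk_Cons_iff)
      have "ghost e * (pth u p * gst u' q) \<approx> ghost e * (edge f * pth (head E f) p' * gst u' q)"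
        unfolding Cons by (intro cg_mult_l cg_mult_r pth_Cons f)
      also have "\<dots> = (ghost e * edge f) * (pth (head E f) p' * gst u' q)" by (simp add: mult.assoc)
      finally have *: "ghost e * (pth u p * gst u' q) \<approx> (ghost e * edge f) * (pth (head E f) p' * gst u' q)" .
      show ?thesis
      proof (cases "e = f")
        case False
        then show ?thesis using * ghost_edge_0[OF False] cg_mult_0(1) cg_trans reduced_cong reduced_0(1) by blast
      next
        case ef: True
        note *
        also have "(ghost e * edge f) * (pth (head E f) p' * gst u' q) \<approx> vtx (head E f) * (pth (head E f) p' * gst u' q)"
          using ef f by (auto intro!: cg_mult_r ghost_edge)
        also have "\<dots> \<approx> pth (head E f) p' * gst u' q" by (rule cg_mult_assoc[OF vtx_pth])
        finally show ?thesis by (rule reduced_cong) (use f assms in \<open>auto intro!: reducedI\<close>)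
      qed
    qed
  qed
  then show ?thesis using Ghost by (simp add: ghost_def)
qed

lemma reduced_word: "w \<noteq> [] \<Longrightarrow> reduced (monom w 1)"
proof (induct w)
  case (Cons g w)
  have eq: "monom (g # w) 1 = monom [g] 1 * monom w 1" by (simp add: monom_mult)
  show ?case
  proof (cases "w = []")
    case True
    \<comment> \<open>The vertex that is a right identity of the last letter. It is inserted twice,
      so that it reads as the monomial of two empty walks.\<close>
    define v where "v = (case g of Vert v \<Rightarrow> v | Edge e \<Rightarrow> head E e | Ghost e \<Rightarrow> tail E e)"
    have "monom [g] 1 * vtx v \<approx> monom [g] 1"
      using vtx_idem[of v] edge_vtx ghost_vtx by (cases g) (auto simp: v_def vtx_def edge_def ghost_def)
    then have "monom [g] 1 \<approx> monom [g] 1 * (vtx v * vtx v)"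
      using cg_sym cg_trans cg_mult_l[OF vtx_idem] by metis
    moreover have "reduced (monom [g] 1 * (vtx v * vtx v))"
    proof (cases "v \<in> verts E")
      case True
      then show ?thesis using reduced_letter_mult[of v "[]" v v "[]"] by (simp add: awalk_Nil_iff)
    next
      case False
      then show ?thesis by (intro reduced_0 I_closed generator_notin)
    qed
    ultimately show ?thesis using True reduced_cong by simp
  next
    case False
    then consider "monom w 1 \<approx> 0" | u p u' q x where "awalk u p x" "awalk u' q x" "monom w 1 \<approx> pth u p * gst u' q"
      using Cons(1) unfolding reduced_def by blast
    then show ?thesis
    proof cases
      case 1
      then show ?thesis unfolding eq using reduced_0(1) reduced_cong cg_mult_0(2) by blast
    next
      case 2
      then show ?thesis unfolding eq using reduced_letter_mult reduced_cong cg_mult_l by blast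
    qed
  qed
qed simp

lemma augmentation_std:
  assumes "x \<in> augmentation_ideal"
  obtains d y where "y \<in> add_span (std UNIV d)" "x \<approx> y"
proof -
  have "\<exists>d. \<exists>y \<in> add_span (std UNIV d). x \<approx> y"
  proof -
    have main: "\<exists>d. \<exists>y \<in> add_span (std UNIV d). (\<Sum>w\<in>S. monom w (c w)) \<approx> y" if "finite S" "[] \<notin> S" for S and c :: "_ \<Rightarrow> 'k"
      using that
    proof (induct S rule: finite_induct)
      case empty
      then show ?case by (auto intro: add_span.intros)
    next
      case (insert w S)
      then obtain d y where dy: "y \<in> add_span (std UNIV d)" "(\<Sum>w\<in>S. monom w (c w)) \<approx> y" by blast
      have m: "monom w (c w) = scal (c w) * monom w 1" by (simp add: scal_def monom_mult)
      have "\<exists>e. \<exists>z \<in> add_span (std UNIV e). monom w (c w) \<approx> z"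
      proof -
        consider "monom w 1 \<approx> 0" | u p u' q x where "awalk u p x" "awalk u' q x" "monom w 1 \<approx> pth u p * gst u' q"
          using reduced_word[of w] insert(4) unfolding reduced_def by blast
        then show ?thesis
        proof cases
          case 1
          then have "monom w (c w) \<approx> 0" unfolding m by (rule cg_mult_0)
          then show ?thesis using add_span.zero by blast
        next
          case 2
          then have "monom w (c w) \<approx> scal (c w) * (pth u p * gst u' q)" unfolding m by (intro cg_mult_l)
          moreover have "scal (c w) * (pth u p * gst u' q) \<in> add_span (std UNIV (length q))"
            using 2 by (intro add_span.base stdI) auto
          ultimately show ?thesis by blast
        qed
      qed
      then obtain e z where ez: "z \<in> add_span (std UNIV e)" "monom w (c w) \<approx> z" by blast
      have "z + y \<in> add_span (std UNIV (max d e))"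
        using add_span_mono[OF std_mono ez(1)] add_span_mono[OF std_mono dy(1)] by (auto intro: add_span.add)
      moreover have "(\<Sum>w\<in>insert w S. monom w (c w)) \<approx> z + y" using insert(1,2) dy(2) ez(2) by (simp add: cg_add)
      ultimately show ?case by blast
    qed
    have "[] \<notin> Poly_Mapping.keys x" using assms by (simp add: augmentation_ideal_def in_keys_iff)
    from main[OF finite_keys this, of "Poly_Mapping.lookup x"] show ?thesis
      by (simp only: poly_mapping_sum_single[of x, symmetric])
  qed
  then show ?thesis using that by blast
qed

text \<open>Local units. The auxiliary claim speaks of all sufficiently large finite sets of
  vertices, because the sets found for two summands have to be enlarged to a common one.\<close>

lemma right_unit:
  assumes "x \<in> augmentation_ideal"
  obtains W where "finite W" "W \<subseteq> verts E" "x \<approx> (\<Sum>v\<in>W. x * vtx v)"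
proof -
  have aux: "\<exists>W0. finite W0 \<and> W0 \<subseteq> verts E \<and> (\<forall>W. finite W \<longrightarrow> W0 \<subseteq> W \<longrightarrow> y \<approx> (\<Sum>v\<in>W. y * vtx v))"
    if "y \<in> add_span (std UNIV d)" for y d
    using that
  proof induct
    case zero
    then show ?case by (intro exI[of _ "{}"]) simp
  next
    case (base x)
    then obtain k u p u' q w where x: "awalk u p w" "awalk u' q w" "x = scal k * (pth u p * gst u' q)"
      unfolding std_def by blast
    have one: "x * vtx v \<approx> (if v = u' then x else 0)" for v
      unfolding x(3) mult.assoc using gst_vtx[of u' q] gst_vtx_0[of v u' q]
      by (auto intro: cg_mult_l cg_mult_0)
    have "x \<approx> (\<Sum>v\<in>W. x * vtx v)" if "finite W" "{u'} \<subseteq> W" for W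
    proof -
      have "x = (\<Sum>v\<in>W. if v = u' then x else 0)" using that by (simp add: sum.delta)
      also have "\<dots> \<approx> (\<Sum>v\<in>W. x * vtx v)" by (rule cg_sum[OF cg_sym[OF one]])
      finally show ?thesis .
    qed
    then show ?case using x(2) by (intro exI[of _ "{u'}"]) (auto simp: awalk_hd_in_verts)
  next
    case (add x y)
    then obtain W1 W2 where W: "finite W1" "W1 \<subseteq> verts E" "\<forall>W. finite W \<longrightarrow> W1 \<subseteq> W \<longrightarrow> x \<approx> (\<Sum>v\<in>W. x * vtx v)"
      "finite W2" "W2 \<subseteq> verts E" "\<forall>W. finite W \<longrightarrow> W2 \<subseteq> W \<longrightarrow> y \<approx> (\<Sum>v\<in>W. y * vtx v)" by blast
    have "x + y \<approx> (\<Sum>v\<in>W. (x + y) * vtx v)" if "finite W" "W1 \<union> W2 \<subseteq> W" for W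
      using cg_add[of x "\<Sum>v\<in>W. x * vtx v" y "\<Sum>v\<in>W. y * vtx v"] W that by (simp add: distrib_right sum.distrib)
    then show ?case using W by (intro exI[of _ "W1 \<union> W2"]) auto
  qed
  obtain d y where y: "y \<in> add_span (std UNIV d)" "x \<approx> y" by (rule augmentation_std[OF assms])
  obtain W where W: "finite W" "W \<subseteq> verts E" "y \<approx> (\<Sum>v\<in>W. y * vtx v)" using aux[OF y(1)] by blast
  have "x \<approx> (\<Sum>v\<in>W. x * vtx v)"
    using cg_trans[OF y(2) cg_trans[OF W(3) cg_sum[OF cg_mult_r[OF cg_sym[OF y(2)]]]]] .
  then show ?thesis using that W by blast
qed

end

section \<open>The correspondence of ideals\<close>

definition pull :: "('v, 'e) pre_digraph \<Rightarrow> ('v, 'e, 'k::field) falg set set \<Rightarrow> ('v, 'e, 'k) falg set" where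
  "pull E P = {x \<in> augmentation_ideal. lclass E (restr E x) \<in> P}"

definition leavitt_gen :: "('v, 'e) pre_digraph \<Rightarrow> ('v, 'e, 'k::field) falg set \<Rightarrow> ('v, 'e, 'k) falg set" where
  "leavitt_gen E T = \<Inter>{I. leavitt_ideal E I \<and> T \<subseteq> I}"

definition leavitt_prime :: "('v, 'e) pre_digraph \<Rightarrow> ('v, 'e, 'k::field) falg set \<Rightarrow> bool" where
  "leavitt_prime E Q \<longleftrightarrow> leavitt_ideal E Q \<and> Q \<noteq> augmentation_ideal \<and>
     (\<forall>A B. leavitt_ideal E A \<longrightarrow> leavitt_ideal E B \<longrightarrow> (\<forall>a\<in>A. \<forall>b\<in>B. a * b \<in> Q) \<longrightarrow> A \<subseteq> Q \<or> B \<subseteq> Q)"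

lemma leavitt_gen_least: "leavitt_ideal E I \<Longrightarrow> T \<subseteq> I \<Longrightarrow> leavitt_gen E T \<subseteq> I"
  unfolding leavitt_gen_def by blast

lemma leavitt_gen_superset: "T \<subseteq> leavitt_gen E T"
  unfolding leavitt_gen_def by blast

lemma leavitt_ideal_Inter:
  assumes "\<And>I. I \<in> Z \<Longrightarrow> leavitt_ideal E I" "Z \<noteq> {}"
  shows "leavitt_ideal E (\<Inter>Z)"
proof -
  have "ring_ideal (\<Inter>Z)" using assms(1) unfolding leavitt_ideal_def ring_ideal_def by blast
  moreover have "\<Inter>Z \<subseteq> augmentation_ideal" using assms unfolding leavitt_ideal_def by blast
  moreover have "leavitt_relations E \<subseteq> \<Inter>Z" using assms(1) unfolding leavitt_ideal_def by blast
  moreover have "\<forall>g. g \<notin> generators E \<longrightarrow> monom [g] 1 \<in> \<Inter>Z" using assms(1) unfolding leavitt_ideal_def by blast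
  ultimately show ?thesis unfolding leavitt_ideal_def by blast
qed

lemma leavitt_ideal_augmentation:
  assumes "wf_digraph E"
  shows "leavitt_ideal E augmentation_ideal"
  using leavitt_relations_carrier[OF assms] ring_ideal_augmentation
  by (auto simp: leavitt_ideal_def carrier_free_algebra monom_in_augmentation)

lemma leavitt_ideal_gen:
  assumes "wf_digraph E" "T \<subseteq> augmentation_ideal"
  shows "leavitt_ideal E (leavitt_gen E T)"
  unfolding leavitt_gen_def
  using leavitt_ideal_augmentation[OF assms(1)] assms(2) by (intro leavitt_ideal_Inter) auto

section \<open>The bijection between ideals of L_K(E) and Leavitt ideals\<close>

context
  fixes E :: "('v, 'e) pre_digraph"
  assumes wf: "wf_digraph E"
begin

lemmas relation_ideal_members = relation_ideal_closed[OF wf]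

lemma carrier_F: "x \<in> carrier (free_algebra E) \<longleftrightarrow> x \<in> augmentation_ideal \<and> restr E x = x"
  by (rule carrier_free_algebra)

lemma restr_in_F: "x \<in> augmentation_ideal \<Longrightarrow> restr E x \<in> carrier (free_algebra E)"
  by (simp add: carrier_F restr_augmentation)

lemma scal_augmentation_decomp:
  obtains a r0 where "r = scal a + r0" "r0 \<in> augmentation_ideal"
proof -
  have "r - scal (Poly_Mapping.lookup r []) \<in> augmentation_ideal"
    by (simp add: augmentation_ideal_def scal_def lookup_minus)
  then show ?thesis using that[of "Poly_Mapping.lookup r []" "r - scal (Poly_Mapping.lookup r [])"] by simp
qed

lemma restr_scal: "restr E (scal a) = scal a"
  by (simp add: scal_def restr_monom)

text \<open>An element of the unital algebra is a scalar plus an element without constant term, so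
  it suffices to absorb these two kinds of factors.\<close>

lemma ring_ideal_of_augmentation:
  assumes "0 \<in> A" "\<And>x y. x \<in> A \<Longrightarrow> y \<in> A \<Longrightarrow> x + y \<in> A"
    "\<And>x a. x \<in> A \<Longrightarrow> scal a * x \<in> A"
    "\<And>x r. x \<in> A \<Longrightarrow> r \<in> augmentation_ideal \<Longrightarrow> r * x \<in> A \<and> x * r \<in> A"
  shows "ring_ideal (A :: ('v, 'e, 'k::field) falg set)"
  unfolding ring_ideal_def
proof (intro conjI ballI allI)
  fix x r :: "('v, 'e, 'k) falg" assume x: "x \<in> A"
  obtain a r0 where r: "r = scal a + r0" "r0 \<in> augmentation_ideal" by (rule scal_augmentation_decomp)
  show "r * x \<in> A" unfolding r(1) distrib_right by (intro assms(2) assms(3) x assms(4)[THEN conjunct1] r)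
  have "x * r = scal a * x + x * r0" by (simp add: r(1) distrib_left scal_commute)
  then show "x * r \<in> A" using assms(2)[OF assms(3)[OF x, of a] assms(4)[OF x r(2), THEN conjunct2]] by simp
qed (use assms in auto)

text \<open>This is the pullback of the zero ideal. Congruence modulo it means equality in L_K(E),
  so the local units become available for L_K(E) itself.\<close>

lemma leavitt_ideal_relations:
  "leavitt_ideal E ({x \<in> augmentation_ideal. restr E x \<in> leavitt_relation_ideal E} :: ('v, 'e, 'k::field) falg set)"
    (is "leavitt_ideal E ?Z")
  unfolding leavitt_ideal_def
proof (intro conjI)
  show "ring_ideal ?Z"
  proof (rule ring_ideal_of_augmentation)
    fix x y :: "('v, 'e, 'k) falg" and a :: 'k
    assume x: "x \<in> ?Z"
    show "scal a * x \<in> ?Z"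
      using x by (simp add: relation_ideal(2)[OF wf] restr_mult restr_scal augmentation_closed)
    show "x + y \<in> ?Z" if "y \<in> ?Z"
      using x that by (simp add: relation_ideal_members(3) restr_add augmentation_closed)
    show "y * x \<in> ?Z \<and> x * y \<in> ?Z"
      if "y \<in> augmentation_ideal"
      using x relation_ideal_members(5,6)[OF _ restr_in_F[OF that]] by (simp add: restr_mult augmentation_closed)
  qed (simp add: augmentation_closed relation_ideal_members)
  show "leavitt_relations E \<subseteq> ?Z"
  proof
    fix r :: "('v, 'e, 'k::field) falg" assume r: "r \<in> leavitt_relations E"
    then have "r \<in> carrier (free_algebra E)" by (rule leavitt_relations_carrier[OF wf])
    moreover have "r \<in> leavitt_relation_ideal E" using relation_ideal(3)[OF wf] r by blast
    ultimately show "r \<in> ?Z" by (simp add: carrier_F)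
  qed
qed (auto simp: monom_in_augmentation restr_monom relation_ideal_members)

lemma lclass_restr_eq:
  assumes "leavitt_quotient.cg {x \<in> augmentation_ideal. restr E x \<in> leavitt_relation_ideal E} x y"
  shows "lclass E (restr E x) = lclass E (restr E y)"
proof -
  interpret leavitt_quotient E "{x \<in> augmentation_ideal. restr E x \<in> leavitt_relation_ideal E}"
    by (intro leavitt_quotient.intro wf leavitt_quotient_axioms.intro leavitt_ideal_relations)
  show ?thesis
    using assms unfolding cg_def by (simp add: lclass_eq_iff[OF wf] restr_diff)
qed

lemma pull_leavitt_ideal:
  fixes P :: "('v, 'e, 'k::field) falg set set"
  assumes "two_sided_ideal P (leavitt_path_algebra E)"
  shows "leavitt_ideal E (pull E P)"
proof -
  interpret leavitt_quotient E "{x \<in> augmentation_ideal. restr E x \<in> leavitt_relation_ideal E} :: ('v, 'e, 'k) falg set"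
    by (intro leavitt_quotient.intro wf leavitt_quotient_axioms.intro leavitt_ideal_relations)
  have P: "P \<subseteq> carrier (leavitt_path_algebra E)" "lclass E 0 \<in> P"
    "\<And>x y. x \<in> carrier (free_algebra E) \<Longrightarrow> y \<in> carrier (free_algebra E) \<Longrightarrow> lclass E x \<in> P \<Longrightarrow> lclass E y \<in> P \<Longrightarrow> lclass E (x + y) \<in> P"
    "\<And>x y. x \<in> carrier (free_algebra E) \<Longrightarrow> y \<in> carrier (free_algebra E) \<Longrightarrow> lclass E x \<in> P \<Longrightarrow> lclass E (x * y) \<in> P"
    "\<And>x y. x \<in> carrier (free_algebra E) \<Longrightarrow> y \<in> carrier (free_algebra E) \<Longrightarrow> lclass E x \<in> P \<Longrightarrow> lclass E (y * x) \<in> P"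
    using assms unfolding two_sided_ideal_L[OF wf] by auto
  have "ring_ideal (pull E P)"
  proof (rule ring_ideal_of_augmentation)
    show "0 \<in> pull E P" using P(2) by (simp add: pull_def augmentation_closed)
    fix x y a
    assume "x \<in> pull E P"
    then have x: "x \<in> augmentation_ideal" "lclass E (restr E x) \<in> P" by (auto simp: pull_def)
    show "x + y \<in> pull E P" if "y \<in> pull E P"
      using that x P(3)[OF restr_in_F restr_in_F] by (simp add: pull_def augmentation_closed restr_add)
    show "y * x \<in> pull E P \<and> x * y \<in> pull E P" if "y \<in> augmentation_ideal"
      using that x P(4,5)[OF restr_in_F restr_in_F] by (simp add: pull_def augmentation_closed restr_mult)
    \<comment> \<open>Closure under scalars is not part of \<open>two_sided_ideal\<close>. With a
      local unit \<open>u\<close> of \<open>x\<close> the scalar moves into the right factor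
      \<open>scal a * u\<close>, which the ideal absorbs.\<close>
    obtain W where W: "finite W" "W \<subseteq> verts E" "cg x (\<Sum>v\<in>W. x * vtx v)" using right_unit[OF x(1)] by blast
    define u where "u = (\<Sum>v\<in>W. vtx v :: ('v, 'e, 'k) falg)"
    have u: "u \<in> augmentation_ideal"
      unfolding u_def by (intro ring_ideal_sum ring_ideal_augmentation) (simp add: vtx_def monom_in_augmentation)
    have "cg (scal a * x) (scal a * (x * u))" using cg_mult_l[OF W(3)] by (simp add: u_def sum_distrib_left)
    also have "\<dots> = x * (scal a * u)" by (simp add: scal_left_commute)
    finally have "lclass E (restr E (scal a * x)) = lclass E (restr E (x * (scal a * u)))"
      by (rule lclass_restr_eq)
    then have "lclass E (restr E (scal a * x)) = lclass E (restr E x * restr E (scal a * u))"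
      unfolding restr_mult[of E x] .
    moreover have "lclass E (restr E x * restr E (scal a * u)) \<in> P"
      by (intro P(4) restr_in_F x augmentation_closed u)
    ultimately show "scal a * x \<in> pull E P" by (simp add: pull_def x augmentation_closed)
  qed
  moreover have "x \<in> pull E P" if "x \<in> augmentation_ideal" "restr E x \<in> leavitt_relation_ideal E" for x
  proof -
    from that show ?thesis using P(2) lclass_eq_iff[OF wf, of "restr E x" 0] by (simp add: pull_def)
  qed
  ultimately show ?thesis using leavitt_ideal unfolding leavitt_ideal_def by (auto simp: pull_def)
qed

lemma relations_subset_leavitt_ideal:
  assumes "leavitt_ideal E A"
  shows "leavitt_relation_ideal E \<subseteq> A \<inter> carrier (free_algebra E)"
proof (rule relation_ideal_least[OF wf])
  have A: "ring_ideal A" "leavitt_relations E \<subseteq> A" using assms unfolding leavitt_ideal_def by auto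
  note A' = ring_idealD[OF A(1)]
  show "two_sided_ideal (A \<inter> carrier (free_algebra E)) (free_algebra E)"
    unfolding two_sided_ideal_free_algebra 
    by (auto simp: A' free_algebra_closed) (auto simp: carrier_free_algebra augmentation_closed)
  show "scal a * x \<in> A \<inter> carrier (free_algebra E)" if "x \<in> A \<inter> carrier (free_algebra E)" for a x
    using that scal_carrier[OF wf, of x] by (auto simp: A' )
  show "leavitt_relations E \<subseteq> A \<inter> carrier (free_algebra E)"
    using A(2) leavitt_relations_carrier[OF wf] by (auto simp: )
qed

text \<open>The inverse of \<open>pull\<close>, as \<open>pull_push\<close> and
  \<open>push_pull\<close> show.\<close>

definition push :: "('v, 'e, 'k::field) falg set \<Rightarrow> ('v, 'e, 'k) falg set set" where
  "push A = lclass E ` (A \<inter> carrier (free_algebra E))"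

text \<open>Membership does not depend on the representative, because a Leavitt ideal contains the
  relation ideal.\<close>

lemma lclass_in_push:
  assumes "leavitt_ideal E A" "x \<in> carrier (free_algebra E)"
  shows "lclass E x \<in> push A \<longleftrightarrow> x \<in> A"
proof
  assume "lclass E x \<in> push A"
  then obtain y where y: "y \<in> A" "y \<in> carrier (free_algebra E)" "lclass E x = lclass E y" unfolding push_def by blast
  then have "x - y \<in> leavitt_relation_ideal E" using lclass_eq_iff[OF wf] by blast
  then have "x - y \<in> A" using relations_subset_leavitt_ideal[OF assms(1)] by blast
  then show "x \<in> A" using ring_idealD(2)[of A "x - y" y] assms(1) y(1) by (simp add: leavitt_ideal_def)
qed (use assms in \<open>auto simp: push_def\<close>)

lemma pull_push:
  assumes "leavitt_ideal E A"
  shows "pull E (push A) = A"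
proof -
  have aug: "A \<subseteq> augmentation_ideal" and id: "ring_ideal A" using assms by (auto simp: leavitt_ideal_def)
  have "restr E x \<in> A \<longleftrightarrow> x \<in> A" for x
    using diff_restr_in_leavitt_ideal[OF assms, of x] ring_idealD(2)[OF id, of "x - restr E x" "restr E x"]
      ring_idealD(6)[OF id, of x "x - restr E x"] by auto
  then show ?thesis
    using aug lclass_in_push[OF assms restr_in_F] by (auto simp: pull_def)
qed

lemma push_ideal:
  assumes "leavitt_ideal E A"
  shows "two_sided_ideal (push A) (leavitt_path_algebra E)"
proof -
  have id: "ring_ideal A" using assms by (auto simp: leavitt_ideal_def)
  note A = ring_idealD[OF id]
  have Fc: "x + y \<in> carrier (free_algebra E)" "x * y \<in> carrier (free_algebra E)" "- x \<in> carrier (free_algebra E)" "0 \<in> carrier (free_algebra E)"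
    if "x \<in> carrier (free_algebra E)" "y \<in> carrier (free_algebra E)" for x y
    using free_algebra_closed[OF that] by simp_all
  have z: "0 \<in> carrier (free_algebra E)" by (simp add: carrier_F augmentation_closed)
  have sub: "push A \<subseteq> carrier (leavitt_path_algebra E)" unfolding push_def carrier_L[OF wf] by auto
  show ?thesis
    unfolding two_sided_ideal_L[OF wf]
    using sub by (simp add: lclass_in_push[OF assms] Fc z A)
qed

lemma push_pull:
  assumes "two_sided_ideal P (leavitt_path_algebra E)"
  shows "push (pull E P) = P"
proof -
  have "P \<subseteq> lclass E ` carrier (free_algebra E)"
    using assms unfolding two_sided_ideal_L[OF wf] carrier_L[OF wf] by auto
  moreover have "x \<in> pull E P \<longleftrightarrow> lclass E x \<in> P" if "x \<in> carrier (free_algebra E)" for x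
    using that by (simp add: carrier_F pull_def)
  ultimately show ?thesis unfolding push_def by auto
qed

text \<open>Since \<open>pull\<close> and \<open>push\<close> are monotone and mutually inverse,
  they match the least ideal over a set with the least Leavitt ideal over it.\<close>

lemma pull_eq_gen_iff:
  assumes P: "two_sided_ideal P (leavitt_path_algebra E)" and T: "T \<subseteq> carrier (free_algebra E)"
  shows "P = ideal_generated (leavitt_path_algebra E) (lclass E ` T) \<longleftrightarrow> pull E P = leavitt_gen E T"
proof -
  have *: "lclass E ` T \<subseteq> Q \<longleftrightarrow> T \<subseteq> pull E Q" for Q
  proof -
    have "x \<in> augmentation_ideal" "restr E x = x" if "x \<in> T" for x using T that carrier_F by blast+
    then show ?thesis by (fastforce simp: pull_def)
  qed
  have mono: "pull E P \<subseteq> pull E Q" if "P \<subseteq> Q" for P Q using that by (auto simp: pull_def)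
  have mono': "push P \<subseteq> push Q" if "P \<subseteq> Q" for P Q using that by (auto simp: push_def)
  have Taug: "T \<subseteq> augmentation_ideal" using T by (auto simp: carrier_F)
  have gen: "leavitt_ideal E (leavitt_gen E T)" by (rule leavitt_ideal_gen[OF wf Taug])
  have "ideal_generated (leavitt_path_algebra E) (lclass E ` T) = push (leavitt_gen E T)"
  proof
    have "lclass E ` T \<subseteq> push (leavitt_gen E T)"
      unfolding * pull_push[OF gen] by (rule leavitt_gen_superset)
    then show "ideal_generated (leavitt_path_algebra E) (lclass E ` T) \<subseteq> push (leavitt_gen E T)"
      unfolding ideal_generated_def using push_ideal[OF gen] by blast
    show "push (leavitt_gen E T) \<subseteq> ideal_generated (leavitt_path_algebra E) (lclass E ` T)"
      unfolding ideal_generated_def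
    proof (rule Inter_greatest)
      fix Q assume "Q \<in> {I. two_sided_ideal I (leavitt_path_algebra E) \<and> lclass E ` T \<subseteq> I}"
      then have Q: "two_sided_ideal Q (leavitt_path_algebra E)" "T \<subseteq> pull E Q" by (simp_all add: *)
      then have "push (leavitt_gen E T) \<subseteq> push (pull E Q)"
        by (intro mono' leavitt_gen_least pull_leavitt_ideal)
      then show "push (leavitt_gen E T) \<subseteq> Q" by (simp add: push_pull[OF Q(1)])
    qed
  qed
  then show ?thesis using push_pull[OF P] pull_push[OF gen] by metis
qed

lemma pull_subset_iff:
  assumes "two_sided_ideal A (leavitt_path_algebra E)" "two_sided_ideal P (leavitt_path_algebra E)"
  shows "pull E A \<subseteq> pull E P \<longleftrightarrow> A \<subseteq> P"
proof
  assume "pull E A \<subseteq> pull E P"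
  then have "push (pull E A) \<subseteq> push (pull E P)" by (auto simp: push_def)
  then show "A \<subseteq> P" by (simp add: push_pull assms)
qed (auto simp: pull_def)

lemma pull_carrier: "pull E (carrier (leavitt_path_algebra E)) = augmentation_ideal"
  unfolding pull_def  carrier_L[OF wf] using restr_in_F by auto

text \<open>The product ideal consists of sums of products, so its inclusion in an ideal can be
  tested on single products.\<close>

lemma ideal_prod_pull:
  assumes "two_sided_ideal A (leavitt_path_algebra E)" "two_sided_ideal B (leavitt_path_algebra E)" "two_sided_ideal P (leavitt_path_algebra E)"
  shows "ideal_prod (leavitt_path_algebra E) A B \<subseteq> P \<longleftrightarrow> (\<forall>a\<in>pull E A. \<forall>b\<in>pull E B. a * b \<in> pull E P)"
proof -
  have sub: "Q \<subseteq> lclass E ` carrier (free_algebra E)" if "two_sided_ideal Q (leavitt_path_algebra E)" for Q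
    using that unfolding two_sided_ideal_L[OF wf] carrier_L[OF wf] by auto
  have mult: "lclass E x \<otimes>\<^bsub>leavitt_path_algebra E\<^esub> lclass E y = lclass E (x * y)" if "x \<in> carrier (free_algebra E)" "y \<in> carrier (free_algebra E)" for x y
    using lclass_mult[OF wf] that by blast
  show ?thesis
  proof
    assume *: "ideal_prod (leavitt_path_algebra E) A B \<subseteq> P"
    show "\<forall>a\<in>pull E A. \<forall>b\<in>pull E B. a * b \<in> pull E P"
    proof (intro ballI)
      fix a b assume "a \<in> pull E A" "b \<in> pull E B"
      then have ab: "a \<in> augmentation_ideal" "lclass E (restr E a) \<in> A" "b \<in> augmentation_ideal" "lclass E (restr E b) \<in> B"
        by (auto simp: pull_def)
      have "lclass E (restr E a) \<otimes>\<^bsub>leavitt_path_algebra E\<^esub> lclass E (restr E b) \<in> P"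
        using * ideal_prod.prod[OF ab(2,4)] by blast
      then show "a * b \<in> pull E P"
        using ab by (simp add: pull_def mult restr_in_F restr_mult augmentation_closed)
    qed
  next
    assume *: "\<forall>a\<in>pull E A. \<forall>b\<in>pull E B. a * b \<in> pull E P"
    show "ideal_prod (leavitt_path_algebra E) A B \<subseteq> P"
    proof
      fix x assume "x \<in> ideal_prod (leavitt_path_algebra E) A B"
      then show "x \<in> P"
      proof (induct rule: ideal_prod.induct)
        case (prod i j)
        obtain x y where xy: "i = lclass E x" "x \<in> carrier (free_algebra E)" "j = lclass E y" "y \<in> carrier (free_algebra E)"
          using sub assms(1,2) prod by blast
        then have "x \<in> pull E A" "y \<in> pull E B" using prod by (simp_all add: pull_def carrier_F)
        then have "x * y \<in> pull E P" using * by blast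
        then show ?case using xy by (simp add: mult pull_def carrier_F restr_mult)
      next
        case (sum s1 s2)
        obtain x y where xy: "s1 = lclass E x" "x \<in> carrier (free_algebra E)" "s2 = lclass E y" "y \<in> carrier (free_algebra E)"
          using sub assms(3) sum by blast
        then show ?case
          using assms(3) sum lclass_add[OF wf, of x y] unfolding two_sided_ideal_L[OF wf] by auto
      qed
    qed
  qed
qed

lemma prime_pull_iff:
  fixes P :: "('v, 'e, 'k::field) falg set set"
  assumes "two_sided_ideal P (leavitt_path_algebra E)"
  shows "prime_two_sided_ideal P (leavitt_path_algebra E) \<longleftrightarrow> leavitt_prime E (pull E P)"
proof -
  have c: "two_sided_ideal (carrier (leavitt_path_algebra E :: ('v, 'e, 'k) falg set ring)) (leavitt_path_algebra E)"
  proof -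
    have "augmentation_ideal \<inter> carrier (free_algebra E) = (carrier (free_algebra E) :: ('v, 'e, 'k) falg set)"
      by (auto simp: carrier_F)
    moreover have "two_sided_ideal (push (augmentation_ideal :: ('v, 'e, 'k) falg set)) (leavitt_path_algebra E)"
      by (rule push_ideal[OF leavitt_ideal_augmentation[OF wf]])
    ultimately show ?thesis unfolding push_def carrier_L[OF wf] by simp
  qed
  have ne: "P \<noteq> carrier (leavitt_path_algebra E) \<longleftrightarrow> pull E P \<noteq> augmentation_ideal"
    using push_pull[OF assms] push_pull[OF c] pull_carrier by metis
  have "(\<forall>A B. two_sided_ideal A (leavitt_path_algebra E) \<longrightarrow> two_sided_ideal B (leavitt_path_algebra E) \<longrightarrow> ideal_prod (leavitt_path_algebra E) A B \<subseteq> P \<longrightarrow> A \<subseteq> P \<or> B \<subseteq> P)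
    \<longleftrightarrow> (\<forall>A B. leavitt_ideal E A \<longrightarrow> leavitt_ideal E B \<longrightarrow> (\<forall>a\<in>A. \<forall>b\<in>B. a * b \<in> pull E P) \<longrightarrow> A \<subseteq> pull E P \<or> B \<subseteq> pull E P)"
    (is "?l \<longleftrightarrow> ?r")
  proof
    assume l: ?l
    show ?r
    proof (intro allI impI)
      fix A B assume A: "leavitt_ideal E A" and B: "leavitt_ideal E B" and ab: "\<forall>a\<in>A. \<forall>b\<in>B. a * b \<in> pull E P"
      have "ideal_prod (leavitt_path_algebra E) (push A) (push B) \<subseteq> P"
        unfolding ideal_prod_pull[OF push_ideal[OF A] push_ideal[OF B] assms] pull_push[OF A] pull_push[OF B] by (rule ab)
      then have "push A \<subseteq> P \<or> push B \<subseteq> P" using l push_ideal A B by blast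
      then show "A \<subseteq> pull E P \<or> B \<subseteq> pull E P"
        using pull_subset_iff[OF push_ideal assms] pull_push A B by metis
    qed
  next
    assume r: ?r
    show ?l
      using r pull_leavitt_ideal pull_subset_iff[OF _ assms] ideal_prod_pull[OF _ _ assms] by meson
  qed
  then show ?thesis
    unfolding prime_two_sided_ideal_def leavitt_prime_def using ne pull_leavitt_ideal[OF assms] assms by blast
qed

end

section \<open>Vertices, breaking vertices and cycles without exits modulo an ideal\<close>

context leavitt_quotient
begin

definition H :: "'v set" where "H = {v \<in> verts E. vtx v \<in> I}"

abbreviation Av :: "'v \<Rightarrow> 'e set" where "Av \<equiv> arcs_avoiding E H"

text \<open>For a breaking vertex this represents \<open>v^H\<close>, but it is defined everywhere:
  if \<open>Av v\<close> is empty or infinite, the sum is zero and \<open>bre v\<close> is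
  \<open>vtx v\<close>.\<close>

definition bre :: "'v \<Rightarrow> ('v, 'e, 'k) falg" where
  "bre v = vtx v - (\<Sum>e\<in>Av v. edge e * ghost e)"

text \<open>The vertices at which the relation CK2 holds modulo \<open>I\<close> with respect to the arcs avoiding \<open>H\<close>.\<close>

definition tame :: "'v \<Rightarrow> bool" where
  "tame v \<longleftrightarrow> finite (Av v) \<and> bre v \<in> I"

text \<open>The vertices on cycles without exits in the graph underlying the quotient by \<open>I\<close>.\<close>

definition Y :: "'v set" where
  "Y = {x \<in> verts E - H. \<exists>q. q \<noteq> [] \<and> awalk x q x \<and> (\<forall>e\<in>set q. Av (tail E e) = {e} \<and> tame (tail E e))}"

lemma H_vtx: "v \<in> H \<Longrightarrow> vtx v \<in> I"
  by (simp add: H_def)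

lemma vtx_H: "v \<in> verts E \<Longrightarrow> vtx v \<in> I \<Longrightarrow> v \<in> H"
  by (simp add: H_def)

lemma Av_iff: "e \<in> Av v \<longleftrightarrow> e \<in> arcs E \<and> tail E e = v \<and> head E e \<notin> H"
  by (auto simp: arcs_avoiding_def)

lemma edge_H: "head E e \<in> H \<Longrightarrow> edge e \<in> I"
  using cg_in[OF edge_vtx[of e]] I_closed(3)[OF H_vtx] by blast

text \<open>Heredity: e^* s(e) e = r(e) by CK1, so the range of an arc lies in every ideal that
  contains its source.\<close>

lemma awalk_H:
  assumes "awalk u p w" "u \<in> H"
  shows "w \<in> H"
  using assms
proof (induct p arbitrary: u)
  case (Cons e p)
  then have e: "e \<in> arcs E" "tail E e \<in> H" "awalk (head E e) p w" by (auto simp: awalk_Cons_iff)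
  have "ghost e * vtx (tail E e) * edge e \<in> I" by (intro I_closed(3,4) H_vtx e)
  moreover have "ghost e * vtx (tail E e) * edge e \<approx> vtx (head E e)"
    using cg_trans[OF cg_mult_r[OF ghost_vtx] ghost_edge[OF e(1)]] .
  ultimately have "head E e \<in> H" using cg_in vtx_H wellformed(2)[OF e(1)] by blast
  then show ?case using Cons(1) e(3) by blast
qed (simp add: awalk_Nil_iff)

lemma pth_H:
  assumes "awalk u p w" "w \<in> H"
  shows "pth u p \<in> I"
  using cg_in[OF pth_vtx[OF assms(1)]] I_closed(3)[OF H_vtx[OF assms(2)]] by blast

lemma bre_vtx: "bre v * vtx v \<approx> bre v"
  and vtx_bre: "vtx v * bre v \<approx> bre v"
proof -
  have *: "(edge e * ghost e) * vtx v \<approx> edge e * ghost e" "vtx v * (edge e * ghost e) \<approx> edge e * ghost e"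
    if "e \<in> Av v" for e
    using that cg_mult_l[OF ghost_vtx] cg_mult_assoc[OF vtx_edge] by (auto simp: Av_iff mult.assoc)
  show "bre v * vtx v \<approx> bre v" unfolding bre_def left_diff_distrib sum_distrib_right
    by (intro cg_diff cg_sum * vtx_idem)
  show "vtx v * bre v \<approx> bre v" unfolding bre_def right_diff_distrib sum_distrib_left
    by (intro cg_diff cg_sum * vtx_idem)
qed

text \<open>A finite substitute for CK2 that exists at infinite emitters as well. By
  \<open>cut_edge\<close> and \<open>ghost_cut\<close> it annihilates the arcs in \<open>F\<close>
  and leaves the other arcs at \<open>v\<close> alone.\<close>

definition cut :: "'v \<Rightarrow> 'e set \<Rightarrow> ('v, 'e, 'k) falg" where
  "cut v F = vtx v - (\<Sum>e\<in>F. edge e * ghost e)"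

lemma cut_edge:
  assumes "finite F" "f \<in> arcs E" "tail E f = v"
  shows "cut v F * edge f \<approx> (if f \<in> F then 0 else edge f)"
proof -
  have 1: "(edge e * ghost e) * edge f \<approx> (if e = f then edge f else 0)" for e
  proof (cases "e = f")
    case True
    have "edge e * (ghost e * edge f) \<approx> edge e * vtx (head E e)" using True assms(2) by (auto intro: cg_mult_l ghost_edge)
    also have "\<dots> \<approx> edge e" by (rule edge_vtx)
    finally show ?thesis using True by (simp add: mult.assoc)
  next
    case False
    have "edge e * (ghost e * edge f) \<approx> 0" by (intro cg_mult_0 ghost_edge_0 False)
    then show ?thesis using False by (simp add: mult.assoc)
  qed
  have "cut v F * edge f \<approx> edge f - (\<Sum>e\<in>F. if e = f then edge f else 0)"
    unfolding cut_def left_diff_distrib sum_distrib_right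
    using vtx_edge[of f] assms(3) by (intro cg_diff cg_sum 1) simp
  also have "\<dots> = (if f \<in> F then 0 else edge f)" using assms(1) by (simp add: sum.delta)
  finally show ?thesis .
qed

lemma ghost_cut:
  assumes "finite F" "f \<in> F" "f \<in> arcs E" "tail E f = v"
  shows "ghost f * cut v F \<approx> 0"
proof -
  have 1: "ghost f * (edge e * ghost e) \<approx> (if e = f then ghost f else 0)" for e
  proof (cases "e = f")
    case True
    have "ghost f * (edge f * ghost f) \<approx> vtx (head E f) * ghost f" using assms(3) by (intro cg_mult_assoc ghost_edge)
    also have "\<dots> \<approx> ghost f" by (rule vtx_ghost)
    finally show ?thesis using True by simp
  next
    case False
    then have "(ghost f * edge e) * ghost e \<approx> 0" by (intro cg_mult_0 ghost_edge_0) simp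
    then show ?thesis using False by (simp add: mult.assoc)
  qed
  have "ghost f * cut v F \<approx> ghost f - (\<Sum>e\<in>F. if e = f then ghost f else 0)"
    unfolding cut_def right_diff_distrib sum_distrib_left
    using ghost_vtx[of f] assms(4) by (intro cg_diff cg_sum 1) simp
  also have "\<dots> = 0" using assms(1,2) by (simp add: sum.delta)
  finally show ?thesis .
qed

lemma bre_cut: "bre v = cut v (Av v)"
  by (simp add: bre_def cut_def)

lemma cut_cong:
  assumes "finite F" "F \<subseteq> F'" "finite F'" "\<And>e. e \<in> F' - F \<Longrightarrow> head E e \<in> H"
  shows "cut v F' \<approx> cut v F"
proof -
  have "(\<Sum>e\<in>F' - F. edge e * ghost e) \<approx> (\<Sum>e\<in>F' - F. 0)"
    using assms(4) by (intro cg_sum cg_mult_0(1)) (simp add: cg_0 edge_H)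
  then have "(\<Sum>e\<in>F' - F. edge e * ghost e) + (\<Sum>e\<in>F. edge e * ghost e) \<approx> 0 + (\<Sum>e\<in>F. edge e * ghost e)"
    by (intro cg_add) simp_all
  then have "(\<Sum>e\<in>F'. edge e * ghost e) \<approx> (\<Sum>e\<in>F. edge e * ghost e)"
    by (simp add: sum.subset_diff[OF assms(2,3)])
  then show ?thesis unfolding cut_def by (intro cg_diff) simp_all
qed

lemma bre_edge:
  assumes "finite (Av v)" "f \<in> arcs E" "tail E f = v"
  shows "bre v * edge f \<in> I"
proof (cases "f \<in> Av v")
  case True
  then show ?thesis using cut_edge[OF assms] by (simp add: bre_cut cg_0)
next
  case False
  then show ?thesis using assms by (intro I_closed(3) edge_H) (auto simp: Av_iff)
qed

lemma bre_pth:
  assumes "finite (Av v)" "awalk v p w" "p \<noteq> []"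
  shows "bre v * pth v p \<in> I"
proof -
  obtain e p' where p: "p = e # p'" using assms(3) by (cases p) auto
  then have e: "e \<in> arcs E" "tail E e = v" using assms(2) by (auto simp: awalk_Cons_iff)
  have "bre v * pth v p \<approx> bre v * (edge e * pth (head E e) p')" unfolding p by (intro cg_mult_l pth_Cons e)
  moreover have "bre v * edge e * pth (head E e) p' \<in> I" by (intro I_closed(4) bre_edge assms e)
  ultimately show ?thesis using cg_in by (simp add: mult.assoc)
qed

lemma bre_idem:
  assumes "finite (Av v)"
  shows "bre v * bre v \<approx> bre v"
proof -
  have "bre v * (edge e * ghost e) \<approx> 0" if "e \<in> Av v" for e
    using bre_edge[OF assms, of e] that I_closed(4) by (auto simp: cg_0 Av_iff mult.assoc[symmetric])
  then have "bre v * vtx v - (\<Sum>e\<in>Av v. bre v * (edge e * ghost e)) \<approx> bre v - (\<Sum>e\<in>Av v. 0)"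
    by (intro cg_diff cg_sum bre_vtx)
  then show ?thesis by (subst (2) bre_def) (simp add: right_diff_distrib sum_distrib_left)
qed

lemma tame_vtx: "tame v \<Longrightarrow> vtx v \<approx> (\<Sum>e\<in>Av v. edge e * ghost e)"
  by (simp add: tame_def bre_def cg_def)

text \<open>The summands of CK2 that belong to arcs into \<open>H\<close> vanish modulo
  \<open>I\<close>.\<close>

lemma regular_tame:
  assumes "regular_vertex E v"
  shows "tame v"
proof -
  have fin: "finite (out_arcs E v)" and sub: "Av v \<subseteq> out_arcs E v"
    using assms by (auto simp: regular_vertex_def arcs_avoiding_def)
  have "cut v (out_arcs E v) \<approx> bre v" unfolding bre_cut
    using fin sub by (intro cut_cong) (auto simp: Av_iff intro: finite_subset)
  moreover have "cut v (out_arcs E v) \<approx> 0" using CK2[OF assms] by (simp add: cut_def cg_def)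
  ultimately have "bre v \<in> I" using cg_0 cg_trans cg_sym by metis
  then show ?thesis using fin sub by (auto simp: tame_def intro: finite_subset)
qed

text \<open>In the graph without \<open>H\<close> the vertex is an infinite emitter, a sink, or it
  emits finitely many arcs after losing infinitely many to \<open>H\<close>. In the last case CK2
  fails exactly because \<open>v^H\<close> is missing from \<open>I\<close>.\<close>

lemma not_tame_cases:
  assumes "v \<in> verts E - H" "\<not> tame v"
  obtains "infinite (Av v)" | "Av v = {}" | "v \<in> breaking_vertices E H" "finite (Av v)" "bre v \<notin> I"
proof -
  have "infinite (out_arcs E v) \<or> out_arcs E v = {}" using assms regular_tame by (auto simp: regular_vertex_def)
  moreover have "out_arcs E v = {} \<Longrightarrow> Av v = {}" unfolding arcs_avoiding_def by blast
  ultimately consider "infinite (Av v)" | "Av v = {}" | "infinite (out_arcs E v)" "finite (Av v)" "Av v \<noteq> {}"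
    by blast
  then show ?thesis
  proof cases
    case 3
    then have "v \<in> breaking_vertices E H" using assms(1) by (auto simp: breaking_vertices_def)
    then show ?thesis using that(3) 3 assms(2) by (auto simp: tame_def)
  qed (use that in auto)
qed

section \<open>Walks along cycles without exits\<close>

lemma Y_verts: "y \<in> Y \<Longrightarrow> y \<in> verts E" "y \<in> Y \<Longrightarrow> y \<notin> H"
  by (auto simp: Y_def)

lemma Y_arc:
  assumes "y \<in> Y"
  obtains e where "Av y = {e}" "e \<in> arcs E" "tail E e = y" "head E e \<in> Y" "tame y"
proof -
  obtain q where q: "q \<noteq> []" "awalk y q y" "\<forall>e\<in>set q. Av (tail E e) = {e} \<and> tame (tail E e)"
    using assms by (auto simp: Y_def)
  obtain e q' where qe: "q = e # q'" using q(1) by (cases q) auto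
  then have e: "e \<in> arcs E" "tail E e = y" "awalk (head E e) q' y" using q(2) by (auto simp: awalk_Cons_iff)
  have "awalk y [e] (head E e)" using e arc_implies_awalk by auto
  then have "awalk (head E e) (q' @ [e]) (head E e)" using e(3) awalk_appendI by blast
  moreover have A: "Av y = {e}" "tame y" using q(3) qe e by auto
  then have "head E e \<notin> H" by (auto simp: Av_iff set_eq_iff)
  moreover have "\<forall>f\<in>set (q' @ [e]). Av (tail E f) = {f} \<and> tame (tail E f)" using q(3) qe by auto
  ultimately have "head E e \<in> Y" using e(1) unfolding Y_def by blast
  then show ?thesis using that A e by blast
qed

text \<open>A walk avoiding \<open>H\<close> has no choice: each vertex of \<open>Y\<close> has a
  single arc avoiding \<open>H\<close>, whose head is in \<open>Y\<close> again.\<close>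

lemma Y_awalk:
  assumes "awalk y p w" "y \<in> Y" "w \<notin> H"
  shows "w \<in> Y"
  using assms
proof (induct p arbitrary: y)
  case (Cons f p)
  then have f: "f \<in> arcs E" "tail E f = y" "awalk (head E f) p w" by (auto simp: awalk_Cons_iff)
  then have "head E f \<notin> H" using awalk_H Cons(4) by blast
  then have "f \<in> Av y" using f by (simp add: Av_iff)
  then have "head E f \<in> Y" using Y_arc[OF Cons(3)] by (metis singletonD)
  then show ?case using Cons f by blast
qed (simp add: awalk_Nil_iff)

text \<open>CK2 at a vertex of \<open>Y\<close> has the single summand ee^*, so it can be applied
  repeatedly along the walk.\<close>

lemma Y_vtx_pth_gst:
  assumes "awalk y p w" "y \<in> Y" "w \<notin> H"
  shows "vtx y \<approx> pth y p * gst y p"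
  using assms
proof (induct p arbitrary: y)
  case Nil
  then show ?case by (simp add: awalk_Nil_iff cg_sym[OF vtx_idem])
next
  case (Cons f p)
  then have f: "f \<in> arcs E" "tail E f = y" "awalk (head E f) p w" by (auto simp: awalk_Cons_iff)
  then have "f \<in> Av y" using awalk_H Cons(4) by (auto simp: Av_iff)
  then have A: "Av y = {f}" "head E f \<in> Y" "tame y" using Y_arc[OF Cons(3)] by (metis singletonD)+
  have "vtx y \<approx> edge f * ghost f" using tame_vtx[OF A(3)] A(1) by simp
  also have "\<dots> \<approx> edge f * (vtx (head E f) * ghost f)" by (rule cg_mult_l[OF cg_sym[OF vtx_ghost]])
  also have "\<dots> \<approx> edge f * ((pth (head E f) p * gst (head E f) p) * ghost f)"
    by (intro cg_mult_l cg_mult_r Cons(1) f A Cons(4))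
  also have "\<dots> = (edge f * pth (head E f) p) * (gst (head E f) p * ghost f)" by (simp add: mult.assoc)
  also have "\<dots> \<approx> pth y (f # p) * gst y (f # p)"
    by (intro cg_mult cg_sym[OF pth_Cons] cg_sym[OF gst_Cons] f)
  finally show ?case .
qed

text \<open>From qg = gr it follows that \<open>g\<close> is an initial piece of a power of
  \<open>q\<close>, and the rest of the current turn leads back to \<open>x\<close>. The induction
  removes whole turns.\<close>

lemma prefix_closed_walk_back:
  assumes "awalk x g y" "awalk x q x" "q \<noteq> []" "q @ g = g @ r"
  shows "\<exists>z. awalk y z x"
  using assms
proof (induct "length g" arbitrary: g rule: less_induct)
  case less
  show ?case
  proof (cases "length g \<le> length q")
    case True
    then obtain z where "q = g @ z" using less(5) by (metis append_eq_append_conv_if append_eq_conv_conj append_take_drop_id)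
    then have "awalk x (g @ z) x" using less(3) by simp
    then have "awalk y z x" using less(2) by auto
    then show ?thesis ..
  next
    case False
    then obtain g' where g': "g = q @ g'" using less(5)
      by (metis append_eq_append_conv2 append_eq_conv_conj linorder_le_cases length_append le_add1)
    then have "awalk x (q @ g') y" using less(2) by simp
    then have "awalk x g' y" using less(3) by auto
    moreover have "length g' < length g" using less(4) unfolding g' by simp
    moreover have "q @ g' = g' @ r" using less(5) unfolding g' by simp
    ultimately show ?thesis using less(1) less(3,4) by blast
  qed
qed

end

section \<open>Enlarging an ideal without new vertices and without new \<open>v^H\<close>\<close>

locale no_new_vertices = leavitt_quotient E I for E :: "('v, 'e) pre_digraph" and I :: "('v, 'e, 'k::field) falg set" +
  fixes A :: "('v, 'e, 'k) falg set"
  assumes A_ideal: "ring_ideal A" and I_sub: "I \<subseteq> A"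
    and no_vtx: "\<And>v. v \<in> verts E \<Longrightarrow> vtx v \<in> A \<Longrightarrow> vtx v \<in> I"
    and no_bre: "\<And>v. v \<in> breaking_vertices E H \<Longrightarrow> bre v \<in> A \<Longrightarrow> bre v \<in> I"
begin

lemmas A_closed = ring_idealD[OF A_ideal]
lemmas cg_A = cg_cong_ideal[OF A_ideal I_sub]

lemma scal_unit: "k \<noteq> 0 \<Longrightarrow> scal k * x \<in> A \<Longrightarrow> x \<in> A"
proof -
  assume k: "k \<noteq> 0" "scal k * x \<in> A"
  have "scal (1 / k) * (scal k * x) \<in> A" by (rule A_closed(3)[OF k(2)])
  moreover have "scal (1 / k) * (scal k * x) = x"
    using k(1) by (simp add: mult.assoc[symmetric] scal_simps(1)[symmetric] scal_simps(2))
  ultimately show ?thesis by simp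
qed

text \<open>
  Conjugating by a path that leaves one of the closed paths \<open>q i\<close> through an exit removes that
  term; if there is no exit, the closed path runs through a breaking vertex, whose element
  \<open>v\<^sup>H\<close> kills all the terms.
\<close>

lemma closed_poly:
  fixes J :: "'i set" and c :: "'i \<Rightarrow> 'k"
  assumes "finite J" "x \<in> verts E - H" "x \<in> Y \<Longrightarrow> J = {}" "k \<noteq> 0"
    "\<And>i. i \<in> J \<Longrightarrow> awalk x (q i) x \<and> q i \<noteq> []"
    "scal k * vtx x + (\<Sum>i\<in>J. scal (c i) * pth x (q i)) \<in> A"
  shows False
  using assms
proof (induct "card J" arbitrary: J x q rule: less_induct)
  case less
  let ?z = "scal k * vtx x + (\<Sum>i\<in>J. scal (c i) * pth x (q i))"
  \<comment> \<open>The terms surviving conjugation by \<open>g\<close>: the product g^* q_i g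
    vanishes unless q_i g begins with \<open>g\<close>, and then it is the closed walk
    \<open>r g i\<close> at the end of \<open>g\<close>. That \<open>g\<close> properly extends q_i
    g is excluded by length.\<close>
  define J' where "J' g = {i \<in> J. \<exists>r. q i @ g = g @ r}" for g
  define r where "r g i = drop (length g) (q i @ g)" for g i
  have r: "q i @ g = g @ r g i" if "i \<in> J' g" for i g
    using that unfolding J'_def r_def by force
  have rw: "awalk y (r g i) y \<and> r g i \<noteq> []" if "i \<in> J' g" "awalk x g y" for i g y
  proof -
    have i: "awalk x (q i) x" "q i \<noteq> []" using that less(6) by (auto simp: J'_def)
    have "awalk x (g @ r g i) y" using awalk_appendI[OF i(1) that(2)] r[OF that(1)] by simp
    then have "awalk y (r g i) y" using that(2) by auto
    moreover have "length (r g i) = length (q i)" using arg_cong[OF r[OF that(1)], of length] by simp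
    ultimately show ?thesis using i(2) by auto
  qed
  have conj: "gst x g * ?z * pth x g \<approx> scal k * vtx y + (\<Sum>i\<in>J' g. scal (c i) * pth y (r g i))"
    if g: "awalk x g y" for g y
  proof -
    have t: "gst x g * (scal (c i) * pth x (q i)) * pth x g \<approx> (if i \<in> J' g then scal (c i) * pth y (r g i) else 0)"
      if "i \<in> J" for i
    proof -
      have i: "awalk x (q i) x" "q i \<noteq> []" using less(6) that by auto
      have "gst x g * (scal (c i) * pth x (q i)) * pth x g = scal (c i) * (gst x g * (pth x (q i) * pth x g))"
        by (simp add: mult.assoc scal_left_commute)
      also have "\<dots> \<approx> scal (c i) * (gst x g * pth x (q i @ g))"
        by (intro cg_mult_l cg_sym[OF pth_append] i)
      also have "\<dots> \<approx> (if i \<in> J' g then scal (c i) * pth y (r g i) else 0)"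
      proof (cases "i \<in> J' g")
        case True
        have "gst x g * pth x (g @ r g i) \<approx> pth y (r g i)" by (rule gst_pth_append[OF g])
        then show ?thesis using True r[OF True] by (simp add: cg_mult_l)
      next
        case False
        have "\<nexists>s. g = (q i @ g) @ s" using i(2) by (metis append_self_conv append_assoc append_is_Nil_conv length_append less_not_refl add_cancel_right_left add.commute length_0_conv add_is_0)
        then have "gst x g * pth x (q i @ g) \<approx> 0"
          using False that awalk_appendI[OF i(1) g] by (intro gst_pth_0[OF g]) (auto simp: J'_def)
        then show ?thesis using False by (simp add: cg_mult_0)
      qed
      finally show ?thesis .
    qed
    have v: "gst x g * (scal k * vtx x) * pth x g \<approx> scal k * vtx y"
    proof -
      have "gst x g * (scal k * vtx x) * pth x g = scal k * (gst x g * (vtx x * pth x g))"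
        by (simp add: mult.assoc scal_left_commute)
      also have "\<dots> \<approx> scal k * (gst x g * pth x g)" by (intro cg_mult_l vtx_pth)
      also have "\<dots> \<approx> scal k * vtx y" by (intro cg_mult_l gst_pth g)
      finally show ?thesis .
    qed
    have "gst x g * ?z * pth x g = gst x g * (scal k * vtx x) * pth x g +
        (\<Sum>i\<in>J. gst x g * (scal (c i) * pth x (q i)) * pth x g)"
      by (simp add: distrib_left distrib_right sum_distrib_left sum_distrib_right)
    also have "\<dots> \<approx> scal k * vtx y + (\<Sum>i\<in>J. if i \<in> J' g then scal (c i) * pth y (r g i) else 0)"
      by (intro cg_add cg_sum v t)
    also have "\<dots> = scal k * vtx y + (\<Sum>i\<in>J' g. scal (c i) * pth y (r g i))"
    proof -
      have "{i \<in> J. i \<in> J' g} = J' g" by (auto simp: J'_def)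
      then show ?thesis using less(2) by (simp add: sum.inter_filter[symmetric])
    qed
    finally show ?thesis .
  qed
  have inA: "scal k * vtx y + (\<Sum>i\<in>J' g. scal (c i) * pth y (r g i)) \<in> A" if "awalk x g y" for g y
    using cg_A[OF conj[OF that]] A_closed(3,4)[of _ ] less(7) by blast
  show False
  proof (cases "J = {}")
    case True
    then have "vtx x \<in> A" using scal_unit[OF less(5)] less(7) by simp
    then show False using less(3) no_vtx vtx_H by blast
  next
    case False
    then obtain j where j: "j \<in> J" by blast
    then have q: "awalk x (q j) x" "q j \<noteq> []" using less(6) by auto
    show False
    proof (cases "\<forall>e\<in>set (q j). Av (tail E e) = {e}")
      case noexit: True
      have "x \<notin> Y" using less(4) False by blast
      then obtain e where e: "e \<in> set (q j)" "\<not> tame (tail E e)" using less(3) q noexit by (auto simp: Y_def)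
      then obtain q1 q2 where q12: "q j = q1 @ e # q2" using split_list by fastforce
      define y where "y = tail E e"
      have y: "awalk x q1 y" "awalk y (e # q2) x" using q(1) q12 unfolding y_def by (auto simp: awalk_Cons_iff)
      then have "y \<in> verts E - H" using awalk_H[of y "e # q2" x] less(3) by (auto simp: awalk_hd_in_verts)
      then have B: "y \<in> breaking_vertices E H" "finite (Av y)" "bre y \<notin> I"
        using noexit e not_tame_cases[of y] unfolding y_def by force+
      let ?s = "\<Sum>i\<in>J' q1. scal (c i) * pth y (r q1 i)"
      have "bre y * (scal (c i) * pth y (r q1 i)) \<approx> 0" if "i \<in> J' q1" for i
        using bre_pth[OF B(2), of "r q1 i" y] rw[OF that y(1)] by (simp add: scal_left_commute cg_0 I_closed)
      then have "bre y * ?s \<approx> (\<Sum>i\<in>J' q1. 0)" unfolding sum_distrib_left by (rule cg_sum)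
      then have "bre y * (scal k * vtx y) + bre y * ?s \<approx> scal k * bre y + 0"
        using cg_mult_l[OF bre_vtx[of y]] by (intro cg_add) (simp_all add: scal_left_commute)
      moreover have "bre y * (scal k * vtx y + ?s) \<in> A" by (rule A_closed(3)[OF inA[OF y(1)]])
      ultimately have "scal k * bre y \<in> A" using cg_A by (simp add: distrib_left)
      then show False using scal_unit[OF less(5)] no_bre B by blast
    next
      case False
      then obtain e where e: "e \<in> set (q j)" "Av (tail E e) \<noteq> {e}" by blast
      then obtain q1 q2 where q12: "q j = q1 @ e # q2" using split_list by fastforce
      have y: "awalk x q1 (tail E e)" "awalk (tail E e) (e # q2) x" "awalk (head E e) q2 x" "e \<in> arcs E"
        using q(1) q12 by (auto simp: awalk_Cons_iff)
      have "e \<in> Av (tail E e)" using y awalk_H less(3) by (auto simp: Av_iff)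
      then obtain f where f: "f \<in> arcs E" "tail E f = tail E e" "head E f \<notin> H" "f \<noteq> e" using e(2) by (auto simp: Av_iff set_eq_iff)
      define g where "g = q1 @ [f]"
      have g: "awalk x g (head E f)" unfolding g_def
        using awalk_appendI[OF y(1)] arc_implies_awalk[OF f(1)] f(2) by auto
      have "j \<notin> J' g"
      proof
        assume "j \<in> J' g"
        from r[OF this] have "q1 @ e # q2 @ g = q1 @ f # r g j" by (simp add: q12 g_def)
        then show False using f(4) by simp
      qed
      then have "J' g \<subset> J" using j by (auto simp: J'_def)
      then have "card (J' g) < card J" using less(2) by (rule psubset_card_mono[rotated])
      moreover have "finite (J' g)" using less(2) by (simp add: J'_def)
      moreover have "head E f \<in> verts E - H" using f by simp
      \<comment> \<open>A surviving closed walk gives a walk from the head of \<open>f\<close> back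
        to \<open>x\<close>, which would put \<open>x\<close> into \<open>Y\<close>. So the
        hypothesis on \<open>Y\<close> is inherited by the smaller family.\<close>
      moreover have "J' g = {}" if "head E f \<in> Y"
      proof (rule ccontr)
        assume "J' g \<noteq> {}"
        then obtain i where i: "i \<in> J' g" by blast
        then have "i \<in> J" by (simp add: J'_def)
        then obtain z where "awalk (head E f) z x"
          using prefix_closed_walk_back[OF g _ _ r[OF i]] less(6) by blast
        then have "x \<in> Y" using Y_awalk that less(3) by blast
        then show False using less(4) j by blast
      qed
      ultimately show False
        using less(1)[of "J' g" "head E f" "r g"] less(5) rw[OF _ g] inA[OF g] by blast
    qed
  qed
qed

text \<open>The ghost of a shortest path \<open>i\<close> turns that path into the vertex
  \<open>v\<close>. The other survivors extend it, properly because they differ from it, and so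
  become closed walks of positive length.\<close>

lemma strip_path:
  fixes J :: "('v \<times> 'e list) set"
  assumes "finite J" "J \<noteq> {}" "\<And>i. i \<in> J \<Longrightarrow> awalk (fst i) (snd i) v"
  obtains i J' r where "i \<in> J" "finite J'" "J' \<subseteq> J" "\<And>j. j \<in> J' \<Longrightarrow> awalk v (r j) v \<and> r j \<noteq> []"
    "gst (fst i) (snd i) * (\<Sum>j\<in>J. scal (c j) * pth (fst j) (snd j)) \<approx>
      scal (c i) * vtx v + (\<Sum>j\<in>J'. scal (c j) * pth v (r j))"
proof -
  obtain i where i: "i \<in> J" "\<And>j. j \<in> J \<Longrightarrow> length (snd i) \<le> length (snd j)"
    using assms(2) ex_min_if_finite[of "(\<lambda>j. length (snd j)) ` J"] assms(1)
    by (metis (no_types, lifting) arg_min_if_finite(1) arg_min_least)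
  define J' where "J' = {j \<in> J - {i}. fst j = fst i \<and> (\<exists>r. snd j = snd i @ r)}"
  define r where "r j = drop (length (snd i)) (snd j)" for j :: "'v \<times> 'e list"
  have r: "snd j = snd i @ r j" if "j \<in> J'" for j using that by (auto simp: J'_def r_def)
  have rw: "awalk v (r j) v \<and> r j \<noteq> []" if "j \<in> J'" for j
  proof -
    have "awalk (fst i) (snd i @ r j) v" using assms(3)[of j] that r[OF that] by (auto simp: J'_def)
    then have "awalk v (r j) v" using assms(3)[OF i(1)] by auto
    moreover have "r j \<noteq> []" using that r[OF that] by (auto simp: J'_def prod_eq_iff)
    ultimately show ?thesis by blast
  qed
  have t: "gst (fst i) (snd i) * (scal (c j) * pth (fst j) (snd j)) \<approx> (if j \<in> J' then scal (c j) * pth v (r j) else 0)"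
    if j: "j \<in> J - {i}" for j
  proof -
    have "gst (fst i) (snd i) * pth (fst j) (snd j) \<approx> (if j \<in> J' then pth v (r j) else 0)"
    proof (cases "j \<in> J'")
      case True
      then have "gst (fst i) (snd i) * pth (fst i) (snd i @ r j) \<approx> pth v (r j)"
        using gst_pth_append assms(3) i(1) by blast
      then show ?thesis using True r[OF True] by (simp add: J'_def)
    next
      case False
      have "gst (fst i) (snd i) * pth (fst j) (snd j) \<approx> 0"
      proof (rule gst_pth_0)
        show "awalk (fst i) (snd i) v" "awalk (fst j) (snd j) v" using assms(3) i j by auto
        assume "fst i = fst j"
        moreover have "\<nexists>s. snd i = snd j @ s" if "\<nexists>s. snd j = snd i @ s"
        proof
          assume "\<exists>s. snd i = snd j @ s"
          then obtain s where s: "snd i = snd j @ s" ..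
          then have "s = []" using i(2)[of j] j by simp
          then show False using s that by auto
        qed
        ultimately show "(\<nexists>s. snd j = snd i @ s) \<and> (\<nexists>s. snd i = snd j @ s)" using False j by (auto simp: J'_def)
      qed
      then show ?thesis using False by simp
    qed
    then have "scal (c j) * (gst (fst i) (snd i) * pth (fst j) (snd j)) \<approx> scal (c j) * (if j \<in> J' then pth v (r j) else 0)"
      by (rule cg_mult_l)
    then show ?thesis by (simp add: scal_left_commute if_distrib cong: if_cong)
  qed
  have "gst (fst i) (snd i) * (\<Sum>j\<in>J. scal (c j) * pth (fst j) (snd j)) =
    scal (c i) * (gst (fst i) (snd i) * pth (fst i) (snd i)) + (\<Sum>j\<in>J - {i}. gst (fst i) (snd i) * (scal (c j) * pth (fst j) (snd j)))"
    using assms(1) i(1) by (simp add: sum.remove sum_distrib_left distrib_left scal_left_commute)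
  also have "\<dots> \<approx> scal (c i) * vtx v + (\<Sum>j\<in>J - {i}. if j \<in> J' then scal (c j) * pth v (r j) else 0)"
    using assms(3) i(1) by (intro cg_add cg_sum t cg_mult_l gst_pth) auto
  also have "\<dots> = scal (c i) * vtx v + (\<Sum>j\<in>J'. scal (c j) * pth v (r j))"
  proof -
    have "{j \<in> J - {i}. j \<in> J'} = J'" by (auto simp: J'_def)
    then show ?thesis using assms(1) by (simp add: sum.inter_filter[symmetric])
  qed
  finally show ?thesis using that[of i J' r] i(1) rw assms(1) by (auto simp: J'_def)
qed

end

section \<open>Monomials whose walks end in a prescribed set of vertices\<close>

context leavitt_quotient
begin

definition path_span :: "'v set \<Rightarrow> ('v, 'e, 'k) falg set" where
  "path_span X = {x. \<exists>y\<in>add_span (\<Union>d. std X d). x \<approx> y}"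

lemma path_span_zero: "x \<in> I \<Longrightarrow> x \<in> path_span X"
  unfolding path_span_def using cg_0 add_span.zero by blast

lemma path_span_cong: "x \<approx> y \<Longrightarrow> y \<in> path_span X \<Longrightarrow> x \<in> path_span X"
  unfolding path_span_def using cg_trans by blast

lemma path_span_add: "x \<in> path_span X \<Longrightarrow> y \<in> path_span X \<Longrightarrow> x + y \<in> path_span X"
  unfolding path_span_def using cg_add add_span.add by blast

lemma path_span_sum: "(\<And>s. s \<in> S \<Longrightarrow> f s \<in> path_span X) \<Longrightarrow> sum f S \<in> path_span X"
  by (induct S rule: infinite_finite_induct) (auto intro: path_span_add path_span_zero I_closed(1))

lemma path_span_base:
  assumes "awalk u p w" "awalk u' q w" "w \<in> X"
  shows "scal k * (pth u p * gst u' q) \<in> path_span X"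
  unfolding path_span_def using stdI[OF assms order_refl] by (blast intro: add_span.base)

lemma path_span_induct [consumes 1, case_names zero base add]:
  assumes "x \<in> path_span X"
    and "\<And>x. x \<in> I \<Longrightarrow> Q x"
    and "\<And>k u p u' q w x. awalk u p w \<Longrightarrow> awalk u' q w \<Longrightarrow> w \<in> X \<Longrightarrow>
      x \<approx> scal k * (pth u p * gst u' q) \<Longrightarrow> Q x"
    and "\<And>x y z. Q x \<Longrightarrow> Q y \<Longrightarrow> z \<approx> x + y \<Longrightarrow> Q z"
  shows "Q x"
proof -
  have "\<forall>x. x \<approx> y \<longrightarrow> Q x" if "y \<in> add_span (\<Union>d. std X d)" for y
    using that
  proof induct
    case zero
    then show ?case using assms(2) by (simp add: cg_0)
  next
    case (base x)
    then show ?case using assms(3) unfolding std_def by blast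
  next
    case (add x y)
    then show ?case using assms(4) cg_refl by blast
  qed
  then show ?thesis using assms(1) unfolding path_span_def by blast
qed

text \<open>A ghost arc on the right lengthens the ghost part or gives zero; the common end of the
  two walks stays in \<open>X\<close>.\<close>

lemma path_span_ghost:
  assumes "x \<in> path_span X" "e \<in> arcs E"
  shows "x * ghost e \<in> path_span X"
  using assms(1)
proof (induct rule: path_span_induct)
  case (zero x)
  then show ?case by (intro path_span_zero I_closed)
next
  case (base k u p u' q w x)
  have x: "x * ghost e \<approx> scal k * (pth u p * (gst u' q * ghost e))"
    using cg_mult_r[OF base(4), of "ghost e"] by (simp add: mult.assoc)
  show ?case
  proof (cases "head E e = u'")
    case True
    have "scal k * (pth u p * (gst u' q * ghost e)) \<approx> scal k * (pth u p * gst (tail E e) (e # q))"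
      using cg_mult_l[OF cg_mult_l[OF cg_sym[OF gst_Cons[OF refl, of e q]]]] True by simp
    moreover have "scal k * (pth u p * gst (tail E e) (e # q)) \<in> path_span X"
      using base True assms(2) by (intro path_span_base[of _ _ w]) (auto simp: awalk_Cons_iff)
    ultimately show ?thesis using x path_span_cong by blast
  next
    case False
    have "gst u' q * ghost e = prod_list (map ghost (rev q)) * (vtx u' * ghost e)" by (simp add: gst_def mult.assoc)
    also have "\<dots> \<approx> 0" using False by (intro cg_mult_0(2) vtx_ghost_0) auto
    finally have "scal k * (pth u p * (gst u' q * ghost e)) \<approx> 0" by (rule cg_mult_0(2)[OF cg_mult_0(2)])
    then show ?thesis using x path_span_cong path_span_zero I_closed(1) by blast
  qed
next
  case (add x y z)
  have "z * ghost e \<approx> x * ghost e + y * ghost e" using cg_mult_r[OF add(3)] by (simp add: distrib_right)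
  then show ?case using add path_span_cong path_span_add by blast
qed

lemma pth_snoc:
  assumes "awalk u p w" "e \<in> arcs E" "tail E e = w"
  shows "pth u p * edge e \<approx> pth u (p @ [e])"
proof -
  have "pth u p * edge e \<approx> pth u p * (vtx w * edge e)"
    using cg_mult_l[OF cg_sym[OF vtx_edge[of e]]] assms(3) by simp
  also have "\<dots> = pth u p * pth w [e]" by (simp add: pth_def)
  also have "\<dots> \<approx> pth u (p @ [e])" by (rule cg_sym[OF pth_append[OF assms(1)]])
  finally show ?thesis .
qed

text \<open>The descent step: an arc on the right cancels the rightmost ghost arc or kills the
  monomial. If there is no ghost arc, it extends the path instead, and the ghost part stays
  empty.\<close>

lemma std_mult_edge:
  assumes "y \<in> add_span (std UNIV (Suc d))" "e \<in> arcs E"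
  shows "\<exists>z\<in>add_span (std UNIV d). y * edge e \<approx> z"
  using assms(1)
proof induct
  case zero
  then show ?case by (auto intro: add_span.zero)
next
  case (base x)
  then obtain k u p u' q w where x: "awalk u p w" "awalk u' q w" "length q \<le> Suc d" "x = scal k * (pth u p * gst u' q)"
    unfolding std_def by blast
  have xe: "x * edge e = scal k * (pth u p * (gst u' q * edge e))" by (simp add: x(4) mult.assoc)
  consider "gst u' q * edge e \<approx> 0" | q' where "q = e # q'" "u' = tail E e" | "q = []" "u' = tail E e"
  proof (cases q)
    case Nil
    then show ?thesis using that(1,3) gst_edge_0[of u' e q] by (cases "u' = tail E e") auto
  next
    case (Cons f q')
    then show ?thesis using that(1,2) gst_edge[of u' f q' w e] x(2) by (cases "f = e") (auto simp: awalk_Cons_iff)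
  qed
  then show ?case
  proof cases
    case 1
    then have "x * edge e \<approx> 0" unfolding xe by (rule cg_mult_0(2)[OF cg_mult_0(2)])
    then show ?thesis using add_span.zero by blast
  next
    case 2
    have "x * edge e \<approx> scal k * (pth u p * gst (head E e) q')"
      unfolding xe using gst_edge[of u' e q' w e] x(2) 2 by (intro cg_mult_l) simp
    moreover have "scal k * (pth u p * gst (head E e) q') \<in> std UNIV d"
      using x 2 by (intro stdI[of _ _ w]) (auto simp: awalk_Cons_iff)
    ultimately show ?thesis using add_span.base by blast
  next
    case 3
    then have w: "w = tail E e" "w = u'" using x(2) by (auto simp: awalk_Nil_iff)
    have "pth u p * (gst u' q * edge e) \<approx> pth u p * edge e"
      using 3 vtx_edge[of e] by (intro cg_mult_l) simp
    also have "\<dots> \<approx> pth u (p @ [e])" using pth_snoc[OF x(1) assms(2)] w by simp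
    also have aw: "awalk u (p @ [e]) (head E e)" using awalk_appendI[OF x(1)] arc_implies_awalk[OF assms(2)] w by auto
    have "pth u (p @ [e]) \<approx> pth u (p @ [e]) * gst (head E e) []" using cg_sym[OF pth_vtx[OF aw]] by simp
    finally have "x * edge e \<approx> scal k * (pth u (p @ [e]) * gst (head E e) [])" unfolding xe by (rule cg_mult_l)
    moreover have "scal k * (pth u (p @ [e]) * gst (head E e) []) \<in> std UNIV d"
      using aw assms(2) by (intro stdI[of _ _ "head E e"]) (auto simp: awalk_Nil_iff)
    ultimately show ?thesis using add_span.base by blast
  qed
next
  case (add x y)
  then obtain z z' where "z \<in> add_span (std UNIV d)" "z' \<in> add_span (std UNIV d)" "x * edge e \<approx> z" "y * edge e \<approx> z'" by blast
  then have "z + z' \<in> add_span (std UNIV d)" "(x + y) * edge e \<approx> z + z'"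
    by (auto simp: distrib_right intro: add_span.add cg_add)
  then show ?case by blast
qed

lemma vtx_cut:
  assumes "F \<subseteq> out_arcs E v"
  shows "vtx v * cut v F \<approx> cut v F"
proof -
  have "vtx v * (edge e * ghost e) \<approx> edge e * ghost e" if "e \<in> F" for e
    using that assms vtx_edge[of e] by (intro cg_mult_assoc) auto
  then show ?thesis unfolding cut_def right_diff_distrib sum_distrib_left by (intro cg_diff cg_sum vtx_idem)
qed

text \<open>A monomial with rightmost ghost arc f^* is annihilated by \<open>cut v F\<close> once
  \<open>f\<close> is in \<open>F\<close>, so finitely many arcs \<open>F0\<close> suffice to leave
  only paths ending in \<open>v\<close>. The claim covers every larger finite \<open>F\<close>,
  because later \<open>F\<close> is adapted to the kind of vertex.\<close>

lemma ghost_split: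
  assumes "y \<in> add_span (std UNIV d)"
  shows "\<exists>F0 J c. finite F0 \<and> F0 \<subseteq> out_arcs E v \<and> (d = 0 \<longrightarrow> F0 = {}) \<and> finite J \<and>
    (\<forall>i\<in>J. awalk (fst i) (snd i) v) \<and>
    (\<forall>F. finite F \<longrightarrow> F0 \<subseteq> F \<longrightarrow> F \<subseteq> out_arcs E v \<longrightarrow>
      y * cut v F \<approx> (\<Sum>i\<in>J. scal (c i) * pth (fst i) (snd i)) * cut v F)"
  using assms
proof induct
  case zero
  then show ?case by (intro exI[of _ "{}"]) auto
next
  case (base x)
  then obtain k u p u' q w where x: "awalk u p w" "awalk u' q w" "length q \<le> d" "x = scal k * (pth u p * gst u' q)"
    unfolding std_def by blast
  have xc: "x * cut v F = scal k * (pth u p * (gst u' q * cut v F))" for F by (simp add: x(4) mult.assoc)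
  consider "u' \<noteq> v" | e q' where "u' = v" "q = e # q'" | "u' = v" "q = []" by (cases q) auto
  then show ?case
  proof cases
    case 1
    have "x * cut v F \<approx> 0" if "F \<subseteq> out_arcs E v" for F
    proof -
      have "gst u' q * cut v F \<approx> gst u' q * (vtx v * cut v F)" by (rule cg_mult_l[OF cg_sym[OF vtx_cut[OF that]]])
      also have "\<dots> = (gst u' q * vtx v) * cut v F" by (simp add: mult.assoc)
      also have "\<dots> \<approx> 0" using 1 by (intro cg_mult_0(1) gst_vtx_0) auto
      finally show ?thesis unfolding xc by (rule cg_mult_0(2)[OF cg_mult_0(2)])
    qed
    then show ?thesis by (intro exI[of _ "{}"] exI[of _ "\<lambda>_. 0"]) auto
  next
    case 2
    then have e: "e \<in> arcs E" "tail E e = v" using x(2) by (auto simp: awalk_Cons_iff)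
    have "x * cut v F \<approx> 0" if "finite F" "{e} \<subseteq> F" for F
    proof -
      have "gst u' q * cut v F \<approx> (gst (head E e) q' * ghost e) * cut v F"
        unfolding 2 by (rule cg_mult_r[OF gst_Cons[OF e(2)]])
      also have "\<dots> = gst (head E e) q' * (ghost e * cut v F)" by (simp add: mult.assoc)
      also have "\<dots> \<approx> 0" using that e by (intro cg_mult_0(2)[OF ghost_cut]) auto
      finally show ?thesis unfolding xc by (rule cg_mult_0(2)[OF cg_mult_0(2)])
    qed
    then show ?thesis using e x(3) 2
      by (intro exI[of _ "{e}"] exI[of _ "{}"] exI[of _ "\<lambda>_. 0"]) auto
  next
    case 3
    have "x * cut v F \<approx> scal k * pth u p * cut v F" if "F \<subseteq> out_arcs E v" for F
      unfolding xc mult.assoc using 3 vtx_cut[OF that] by (intro cg_mult_l) simp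
    then show ?thesis using x(1,2) 3
      by (intro exI[of _ "{}"] exI[of _ "{(u, p)}"] exI[of _ "\<lambda>_. k"]) (auto simp: awalk_Nil_iff)
  qed
next
  case (add x y)
  obtain F1 J1 c1 where 1: "finite F1" "F1 \<subseteq> out_arcs E v" "d = 0 \<longrightarrow> F1 = {}" "finite J1"
    "\<forall>i\<in>J1. awalk (fst i) (snd i) v"
    "\<And>F. finite F \<Longrightarrow> F1 \<subseteq> F \<Longrightarrow> F \<subseteq> out_arcs E v \<Longrightarrow>
      x * cut v F \<approx> (\<Sum>i\<in>J1. scal (c1 i) * pth (fst i) (snd i)) * cut v F"
    using add(2) by auto
  obtain F2 J2 c2 where 2: "finite F2" "F2 \<subseteq> out_arcs E v" "d = 0 \<longrightarrow> F2 = {}" "finite J2"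
    "\<forall>i\<in>J2. awalk (fst i) (snd i) v"
    "\<And>F. finite F \<Longrightarrow> F2 \<subseteq> F \<Longrightarrow> F \<subseteq> out_arcs E v \<Longrightarrow>
      y * cut v F \<approx> (\<Sum>i\<in>J2. scal (c2 i) * pth (fst i) (snd i)) * cut v F"
    using add(4) by auto
  define c where "c i = (if i \<in> J1 then c1 i else 0) + (if i \<in> J2 then c2 i else 0)" for i
  have r: "(\<Sum>i\<in>J1 \<union> J2. (if i \<in> J then scal (f i) else 0) * pth (fst i) (snd i)) =
      (\<Sum>i\<in>J. scal (f i) * pth (fst i) (snd i))" if "J \<subseteq> J1 \<union> J2" for J f
  proof -
    have "(\<Sum>i\<in>J. scal (f i) * pth (fst i) (snd i)) = (\<Sum>i\<in>J. (if i \<in> J then scal (f i) else 0) * pth (fst i) (snd i))"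
      by (rule sum.cong) auto
    also have "\<dots> = (\<Sum>i\<in>J1 \<union> J2. (if i \<in> J then scal (f i) else 0) * pth (fst i) (snd i))"
      using that 1(4) 2(4) by (intro sum.mono_neutral_left) auto
    finally show ?thesis ..
  qed
  have sc: "scal (c i) = (if i \<in> J1 then scal (c1 i) else 0) + (if i \<in> J2 then scal (c2 i) else 0)" for i
    by (simp add: c_def scal_simps)
  have s: "(\<Sum>i\<in>J1 \<union> J2. scal (c i) * pth (fst i) (snd i)) =
      (\<Sum>i\<in>J1. scal (c1 i) * pth (fst i) (snd i)) + (\<Sum>i\<in>J2. scal (c2 i) * pth (fst i) (snd i))"
    unfolding sc distrib_right sum.distrib using r[of J1 c1] r[of J2 c2] by simp
  have "(x + y) * cut v F \<approx> (\<Sum>i\<in>J1 \<union> J2. scal (c i) * pth (fst i) (snd i)) * cut v F"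
    if "finite F" "F1 \<union> F2 \<subseteq> F" "F \<subseteq> out_arcs E v" for F
    unfolding s distrib_right using that by (intro cg_add 1 2) auto
  then show ?case using 1 2
    by (intro exI[of _ "F1 \<union> F2"] exI[of _ "J1 \<union> J2"] exI[of _ c]) auto
qed

end

section \<open>Combinations of paths in the larger ideal\<close>

context no_new_vertices
begin

text \<open>\<open>strip_path\<close> with a right factor carried along; below \<open>w\<close> is a
  vertex, an element \<open>bre v\<close> or an arc.\<close>

lemma strip_mult:
  fixes J :: "('v \<times> 'e list) set"
  assumes "finite J" "J \<noteq> {}" "\<And>i. i \<in> J \<Longrightarrow> awalk (fst i) (snd i) v" "\<And>i. i \<in> J \<Longrightarrow> c i \<noteq> 0"
    and "(\<Sum>j\<in>J. scal (c j) * pth (fst j) (snd j)) * w \<in> A"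
  obtains k J' r where "k \<noteq> 0" "finite J'" "J' \<subseteq> J" "\<forall>j\<in>J'. awalk v (r j) v \<and> r j \<noteq> []"
    "scal k * (vtx v * w) + (\<Sum>j\<in>J'. scal (c j) * (pth v (r j) * w)) \<in> A"
proof -
  obtain i J' r where i: "i \<in> J" "finite J'" "J' \<subseteq> J" "\<And>j. j \<in> J' \<Longrightarrow> awalk v (r j) v \<and> r j \<noteq> []"
    "gst (fst i) (snd i) * (\<Sum>j\<in>J. scal (c j) * pth (fst j) (snd j)) \<approx>
      scal (c i) * vtx v + (\<Sum>j\<in>J'. scal (c j) * pth v (r j))"
    using strip_path[OF assms(1-3), of c] by blast
  have "gst (fst i) (snd i) * ((\<Sum>j\<in>J. scal (c j) * pth (fst j) (snd j)) * w) \<in> A"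
    by (rule A_closed(3)[OF assms(5)])
  moreover have "gst (fst i) (snd i) * ((\<Sum>j\<in>J. scal (c j) * pth (fst j) (snd j)) * w) \<approx>
      scal (c i) * (vtx v * w) + (\<Sum>j\<in>J'. scal (c j) * (pth v (r j) * w))"
    using cg_mult_r[OF i(5), of w] by (simp add: mult.assoc distrib_right sum_distrib_right)
  ultimately have "scal (c i) * (vtx v * w) + (\<Sum>j\<in>J'. scal (c j) * (pth v (r j) * w)) \<in> A"
    using cg_A by blast
  then show ?thesis using that[of "c i" J' r] assms(4) i by blast
qed

lemma real_not_in:
  fixes J :: "('v \<times> 'e list) set"
  assumes "finite J" "J \<noteq> {}" "\<And>i. i \<in> J \<Longrightarrow> awalk (fst i) (snd i) v" "\<And>i. i \<in> J \<Longrightarrow> c i \<noteq> 0"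
    and "v \<in> verts E - H" "v \<notin> Y"
  shows "(\<Sum>j\<in>J. scal (c j) * pth (fst j) (snd j)) \<notin> A"
proof
  assume "(\<Sum>j\<in>J. scal (c j) * pth (fst j) (snd j)) \<in> A"
  then have m: "(\<Sum>j\<in>J. scal (c j) * pth (fst j) (snd j)) * vtx v \<in> A" by (rule A_closed(4))
  obtain k J' r where *: "k \<noteq> 0" "finite J'" "J' \<subseteq> J"
    "\<forall>j\<in>J'. awalk v (r j) v \<and> r j \<noteq> []"
    "scal k * (vtx v * vtx v) + (\<Sum>j\<in>J'. scal (c j) * (pth v (r j) * vtx v)) \<in> A"
    by (rule strip_mult[OF assms(1-4) m])
  have "scal k * (vtx v * vtx v) + (\<Sum>j\<in>J'. scal (c j) * (pth v (r j) * vtx v)) \<approx>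
    scal k * vtx v + (\<Sum>j\<in>J'. scal (c j) * pth v (r j))"
    using *(4) by (intro cg_add cg_sum cg_mult_l vtx_idem pth_vtx) auto
  then have "scal k * vtx v + (\<Sum>j\<in>J'. scal (c j) * pth v (r j)) \<in> A" using *(5) cg_A by blast
  then show False using closed_poly[OF *(2) assms(5) _ *(1), of r c] *(4) assms(6) by blast
qed

text \<open>After stripping, left multiplication by \<open>bre v\<close> annihilates the closed
  walks and turns the vertex term into a multiple of \<open>bre v\<close>, which would then lie in
  \<open>A\<close>.\<close>

lemma real_bre_not_in:
  fixes J :: "('v \<times> 'e list) set"
  assumes "finite J" "J \<noteq> {}" "\<And>i. i \<in> J \<Longrightarrow> awalk (fst i) (snd i) v" "\<And>i. i \<in> J \<Longrightarrow> c i \<noteq> 0"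
    and "v \<in> breaking_vertices E H" "finite (Av v)" "bre v \<notin> I"
  shows "(\<Sum>j\<in>J. scal (c j) * pth (fst j) (snd j)) * bre v \<notin> A"
proof
  assume m: "(\<Sum>j\<in>J. scal (c j) * pth (fst j) (snd j)) * bre v \<in> A"
  obtain k J' r where *: "k \<noteq> 0" "finite J'" "J' \<subseteq> J"
    "\<forall>j\<in>J'. awalk v (r j) v \<and> r j \<noteq> []"
    "scal k * (vtx v * bre v) + (\<Sum>j\<in>J'. scal (c j) * (pth v (r j) * bre v)) \<in> A"
    by (rule strip_mult[OF assms(1-4) m])
  have "bre v * (scal k * (vtx v * bre v) + (\<Sum>j\<in>J'. scal (c j) * (pth v (r j) * bre v))) =
    scal k * (bre v * (vtx v * bre v)) + (\<Sum>j\<in>J'. scal (c j) * ((bre v * pth v (r j)) * bre v))"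
    by (simp add: distrib_left sum_distrib_left scal_left_commute mult.assoc)
  also have "\<dots> \<approx> scal k * bre v + (\<Sum>j\<in>J'. 0)"
  proof (rule cg_add[OF cg_mult_l cg_sum])
    show "bre v * (vtx v * bre v) \<approx> bre v" using cg_trans[OF cg_mult_l[OF vtx_bre] bre_idem[OF assms(6)]] .
    show "scal (c j) * ((bre v * pth v (r j)) * bre v) \<approx> 0" if "j \<in> J'" for j
      using bre_pth[OF assms(6)] bspec[OF *(4) that] by (intro cg_mult_0(2)[OF cg_mult_0(1)]) (auto simp: cg_0)
  qed
  finally have "scal k * bre v \<in> A" using A_closed(3)[OF *(5), of "bre v"] cg_A by auto
  then show False using scal_unit[OF *(1)] no_bre assms(5,7) by blast
qed

text \<open>Used at infinite emitters. Multiplying by f^* and \<open>f\<close> from the two sides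
  rotates the closed walks that begin with \<open>f\<close> into closed walks at the head of
  \<open>f\<close>, removes the others, and leads to \<open>closed_poly\<close>.\<close>

lemma real_edge_not_in:
  fixes J :: "('v \<times> 'e list) set"
  assumes "finite J" "J \<noteq> {}" "\<And>i. i \<in> J \<Longrightarrow> awalk (fst i) (snd i) v" "\<And>i. i \<in> J \<Longrightarrow> c i \<noteq> 0"
    and "v \<in> verts E - H" "v \<notin> Y" and f: "f \<in> Av v"
  shows "(\<Sum>j\<in>J. scal (c j) * pth (fst j) (snd j)) * edge f \<notin> A"
proof
  have f': "f \<in> arcs E" "tail E f = v" "head E f \<notin> H" using f by (auto simp: Av_iff)
  assume m: "(\<Sum>j\<in>J. scal (c j) * pth (fst j) (snd j)) * edge f \<in> A"
  obtain k J' r where *: "k \<noteq> 0" "finite J'" "J' \<subseteq> J"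
    "\<forall>j\<in>J'. awalk v (r j) v \<and> r j \<noteq> []"
    "scal k * (vtx v * edge f) + (\<Sum>j\<in>J'. scal (c j) * (pth v (r j) * edge f)) \<in> A"
    by (rule strip_mult[OF assms(1-4) m])
  define J'' where "J'' = {j \<in> J'. hd (r j) = f}"
  have 1: "ghost f * (vtx v * edge f) \<approx> vtx (head E f)"
    using cg_trans[OF cg_mult_l[OF vtx_edge[of f]] ghost_edge[OF f'(1)]] f'(2) by simp
  have 2: "ghost f * (pth v (r j) * edge f) \<approx> (if j \<in> J'' then pth (head E f) (tl (r j) @ [f]) else 0)"
    if j: "j \<in> J'" for j
  proof -
    obtain e r' where r: "r j = e # r'" using bspec[OF *(4) j] by (cases "r j") auto
    have e: "e \<in> arcs E" "tail E e = v" using bspec[OF *(4) j] r by (auto simp: awalk_Cons_iff)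
    have "pth v (r j) * edge f \<approx> pth v (r j @ [f])" using pth_snoc bspec[OF *(4) j] f' by blast
    also have "\<dots> \<approx> edge e * pth (head E e) (r' @ [f])" using pth_Cons[OF e(2), of "r' @ [f]"] by (simp add: r)
    finally have "ghost f * (pth v (r j) * edge f) \<approx> ghost f * (edge e * pth (head E e) (r' @ [f]))"
      by (rule cg_mult_l)
    also have "\<dots> = (ghost f * edge e) * pth (head E e) (r' @ [f])" by (simp add: mult.assoc)
    also have "\<dots> \<approx> (if e = f then vtx (head E f) else 0) * pth (head E e) (r' @ [f])"
      using ghost_edge[OF f'(1)] ghost_edge_0[of f e] by (intro cg_mult_r) auto
    also have "\<dots> \<approx> (if e = f then pth (head E f) (r' @ [f]) else 0)" using vtx_pth by simp
    finally show ?thesis using j r by (auto simp: J''_def)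
  qed
  have "ghost f * (scal k * (vtx v * edge f) + (\<Sum>j\<in>J'. scal (c j) * (pth v (r j) * edge f))) =
    scal k * (ghost f * (vtx v * edge f)) + (\<Sum>j\<in>J'. scal (c j) * (ghost f * (pth v (r j) * edge f)))"
    by (simp add: distrib_left sum_distrib_left scal_left_commute)
  also have "\<dots> \<approx> scal k * vtx (head E f) + (\<Sum>j\<in>J'. scal (c j) * (if j \<in> J'' then pth (head E f) (tl (r j) @ [f]) else 0))"
    by (intro cg_add cg_sum cg_mult_l 1 2)
  also have "\<dots> = scal k * vtx (head E f) + (\<Sum>j\<in>J''. scal (c j) * pth (head E f) (tl (r j) @ [f]))"
  proof -
    have "(\<Sum>j\<in>J'. scal (c j) * (if j \<in> J'' then pth (head E f) (tl (r j) @ [f]) else 0)) =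
        (\<Sum>j\<in>J''. scal (c j) * (if j \<in> J'' then pth (head E f) (tl (r j) @ [f]) else 0))"
      using *(2) by (intro sum.mono_neutral_right) (auto simp: J''_def)
    then show ?thesis by simp
  qed
  finally have inA: "scal k * vtx (head E f) + (\<Sum>j\<in>J''. scal (c j) * pth (head E f) (tl (r j) @ [f])) \<in> A"
    using A_closed(3)[OF *(5), of "ghost f"] cg_A by blast
  have ret: "awalk (head E f) (tl (r j)) v" if "j \<in> J''" for j
    using that *(4) by (cases "r j") (auto simp: J''_def awalk_Cons_iff)
  have "awalk v [f] (head E f)" using f' arc_implies_awalk by auto
  then have aw: "awalk (head E f) (tl (r j) @ [f]) (head E f)" if "j \<in> J''" for j
    using awalk_appendI[OF ret[OF that]] by blast
  \<comment> \<open>A survivor would walk from the head of \<open>f\<close> back to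
    \<open>v\<close>, which lies outside \<open>Y\<close>.\<close>
  have "J'' = {}" if "head E f \<in> Y"
    using Y_awalk[OF ret that] assms(5,6) by blast
  then show False
    using closed_poly[of J'' "head E f" k "\<lambda>j. tl (r j) @ [f]" c] *(1,2) inA f' aw by (auto simp: J''_def)
qed

text \<open>The ghost walk starts in \<open>Y\<close>, so it ends in \<open>Y\<close> or in
  \<open>H\<close>; in the latter case the monomial is zero modulo \<open>I\<close>.\<close>

lemma path_span_vtx_Y:
  assumes "y \<in> add_span (std UNIV d)" "v \<in> Y"
  shows "y * vtx v \<in> path_span Y"
  using assms(1)
proof induct
  case zero
  then show ?case by (simp add: path_span_zero I_closed)
next
  case (base x)
  then obtain k u p u' q w where x: "awalk u p w" "awalk u' q w" "x = scal k * (pth u p * gst u' q)"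
    unfolding std_def by blast
  have xv: "x * vtx v = scal k * (pth u p * (gst u' q * vtx v))" by (simp add: x(3) mult.assoc)
  consider "u' \<noteq> v" | "u' = v" "w \<in> H" | "u' = v" "w \<in> Y" using Y_awalk x(2) assms(2) by blast
  then show ?case
  proof cases
    case 1
    then have "gst u' q * vtx v \<approx> 0" by (intro gst_vtx_0) auto
    then have "x * vtx v \<approx> 0" unfolding xv by (rule cg_mult_0(2)[OF cg_mult_0(2)])
    then show ?thesis by (simp add: cg_0 path_span_zero)
  next
    case 2
    then show ?thesis unfolding xv using pth_H[OF x(1)] by (intro path_span_zero I_closed(3) I_closed(4))
  next
    case 3
    then have "x * vtx v \<approx> scal k * (pth u p * gst u' q)" unfolding xv by (intro cg_mult_l) (simp add: gst_vtx)
    then show ?thesis using path_span_cong path_span_base[OF x(1,2)] 3 by blast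
  qed
next
  case (add x y)
  then show ?case by (simp add: distrib_right path_span_add)
qed

text \<open>The element av is a times \<open>cut v F0\<close> plus the sum of aee^* over
  \<open>F0\<close>. The sum is controlled by \<open>edges\<close>. The first part is congruent to a
  combination of paths without ghost arcs, which must be empty: otherwise \<open>A\<close> would
  contain a new vertex or a new \<open>v^H\<close>.\<close>

lemma in_path_span_vtx:
  assumes a: "a \<in> A" "y \<in> add_span (std UNIV d)" "a \<approx> y" and v: "v \<in> verts E"
    and edges: "\<And>e. d \<noteq> 0 \<Longrightarrow> e \<in> arcs E \<Longrightarrow> a * edge e \<in> path_span Y"
  shows "a * vtx v \<in> path_span Y"
proof -
  have ee: "a * (edge e * ghost e) \<in> path_span Y" if "d \<noteq> 0" "e \<in> arcs E" for e
    using path_span_ghost[OF edges[OF that] that(2)] by (simp add: mult.assoc)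
  consider "v \<in> H" | "v \<in> Y" | "tame v" "d \<noteq> 0" | "v \<in> verts E - H" "v \<notin> Y" "\<not> (tame v \<and> d \<noteq> 0)" using v by blast
  then show ?thesis
  proof cases
    case 1
    then show ?thesis by (intro path_span_zero I_closed H_vtx)
  next
    case 2
    then show ?thesis using path_span_vtx_Y[OF a(2)] path_span_cong cg_mult_r[OF a(3)] by blast
  next
    case 3
    have "a * vtx v \<approx> (\<Sum>e\<in>Av v. a * (edge e * ghost e))"
      using cg_mult_l[OF tame_vtx[OF 3(1)]] by (simp add: sum_distrib_left)
    moreover have "(\<Sum>e\<in>Av v. a * (edge e * ghost e)) \<in> path_span Y"
      by (intro path_span_sum ee 3) (simp add: Av_iff)
    ultimately show ?thesis using path_span_cong by blast
  next
    case 4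
    obtain F0 J0 c where F0: "finite F0" "F0 \<subseteq> out_arcs E v" "d = 0 \<longrightarrow> F0 = {}" and J0: "finite J0"
        "\<forall>i\<in>J0. awalk (fst i) (snd i) v"
      and cut0: "\<And>F. finite F \<Longrightarrow> F0 \<subseteq> F \<Longrightarrow> F \<subseteq> out_arcs E v \<Longrightarrow>
        y * cut v F \<approx> (\<Sum>i\<in>J0. scal (c i) * pth (fst i) (snd i)) * cut v F"
      using ghost_split[OF a(2), of v] by auto
    define J where "J = {i \<in> J0. c i \<noteq> 0}"
    define b where "b = (\<Sum>i\<in>J. scal (c i) * pth (fst i) (snd i))"
    have "(\<Sum>i\<in>J0. scal (c i) * pth (fst i) (snd i)) = b"
      unfolding b_def J_def using J0(1) by (intro sum.mono_neutral_right) (auto simp: scal_simps)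
    then have cut: "a * cut v F \<approx> b * cut v F" if "finite F" "F0 \<subseteq> F" "F \<subseteq> out_arcs E v" for F
      using cg_trans[OF cg_mult_r[OF a(3)] cut0[OF that]] by simp
    have J: "finite J" "\<And>i. i \<in> J \<Longrightarrow> awalk (fst i) (snd i) v" "\<And>i. i \<in> J \<Longrightarrow> c i \<noteq> 0"
      using J0 by (auto simp: J_def)
    have bv: "b * vtx v \<approx> b"
      unfolding b_def sum_distrib_right mult.assoc using J(2) by (intro cg_sum cg_mult_l pth_vtx) auto
    have inA: "b * cut v F \<in> A" if "finite F" "F0 \<subseteq> F" "F \<subseteq> out_arcs E v" for F
      using cg_A[OF cut[OF that]] A_closed(4)[OF a(1)] by blast
    have real: "b \<in> A" if "F0 \<subseteq> F" "finite F" "F \<subseteq> out_arcs E v" "cut v F \<approx> vtx v" for F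
      using cg_A[OF cg_trans[OF cg_mult_l[OF that(4)] bv]] inA that by blast
    \<comment> \<open>Each way in which CK2 can fail at \<open>v\<close> has its own test factor: an
      arc outside \<open>F0\<close>, the vertex itself, or \<open>bre v\<close>. A tame
      \<open>v\<close> occurs here only for \<open>d\<close> = 0, where \<open>F0\<close> is empty
      and the vertex serves as well.\<close>
    have "J = {}"
    proof (rule ccontr)
      assume ne: "J \<noteq> {}"
      show False
      proof (cases "tame v")
        case True
        then have "b \<in> A" using real[of "{}"] F0(3) 4(3) by (simp add: cut_def)
        with real_not_in[where c = c, OF J(1) ne J(2,3) 4(1,2)] show False unfolding b_def by blast
      next
        case False
        with 4(1) show False
        proof (cases rule: not_tame_cases)
          case 1
          then obtain f where f: "f \<in> Av v" "f \<notin> F0" using F0(1) by (meson finite_subset subsetI)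
          then have "cut v F0 * edge f \<approx> edge f" using cut_edge[OF F0(1), of f v] by (auto simp: Av_iff)
          then have "b * cut v F0 * edge f \<approx> b * edge f" unfolding mult.assoc by (rule cg_mult_l)
          moreover have "b * cut v F0 * edge f \<in> A" using A_closed(4)[OF inA] F0 by blast
          ultimately have "b * edge f \<in> A" using cg_A by blast
          with real_edge_not_in[where c = c, OF J(1) ne J(2,3) 4(1,2) f(1)] show False unfolding b_def by blast
        next
          case 2
          have "head E e \<in> H" if "e \<in> F0" for e
          proof (rule ccontr)
            assume "head E e \<notin> H"
            then have "e \<in> Av v" using that F0(2) by (auto simp: Av_iff)
            then show False using 2 by simp
          qed
          then have "cut v F0 \<approx> cut v {}" by (intro cut_cong F0(1)) simp_all
          then have "b \<in> A" using real[of F0] F0 by (simp add: cut_def)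
          with real_not_in[where c = c, OF J(1) ne J(2,3) 4(1,2)] show False unfolding b_def by blast
        next
          case 3
          have "head E e \<in> H" if "e \<in> F0 \<union> Av v - Av v" for e
            using that F0(2) by (auto simp: Av_iff)
          then have "cut v (F0 \<union> Av v) \<approx> bre v" unfolding bre_cut
            using F0(1) 3(2) by (intro cut_cong) simp_all
          then have "b * cut v (F0 \<union> Av v) \<approx> b * bre v" by (rule cg_mult_l)
          moreover have "b * cut v (F0 \<union> Av v) \<in> A" using F0 3 by (intro inA) (auto simp: arcs_avoiding_def)
          ultimately have "b * bre v \<in> A" using cg_A by blast
          with real_bre_not_in[where c = c, OF J(1) ne J(2,3) 3] show False unfolding b_def by blast
        qed
      qed
    qed
    then have "a * cut v F0 \<approx> 0" using cut[OF F0(1) order_refl F0(2)] by (simp add: b_def)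
    then have "a * cut v F0 + (\<Sum>e\<in>F0. a * (edge e * ghost e)) \<approx> 0 + (\<Sum>e\<in>F0. a * (edge e * ghost e))"
      by (intro cg_add) auto
    moreover have "a * cut v F0 + (\<Sum>e\<in>F0. a * (edge e * ghost e)) = a * vtx v"
      by (simp add: cut_def right_diff_distrib sum_distrib_left)
    moreover have "(\<Sum>e\<in>F0. a * (edge e * ghost e)) \<in> path_span Y"
    proof (cases "d = 0")
      case True
      then show ?thesis using F0(3) by (simp add: path_span_zero I_closed)
    next
      case False
      then show ?thesis using F0(2) by (intro path_span_sum ee) auto
    qed
    ultimately show ?thesis using path_span_cong by simp
  qed
qed

text \<open>Local units reduce the claim to the elements av; the induction on the bound
  \<open>d\<close> works because right multiplication by an arc lowers the bound.\<close>

theorem in_path_span: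
  assumes "a \<in> A" "a \<in> augmentation_ideal"
  shows "a \<in> path_span Y"
proof -
  have sum: "a \<in> path_span Y" if "\<And>v. v \<in> verts E \<Longrightarrow> a * vtx v \<in> path_span Y" "a \<approx> y" "y \<in> add_span (std UNIV d)" for a y d
  proof -
    have "y \<in> augmentation_ideal"
      using that(3)
      by induct (auto simp: std_def augmentation_closed pth_in_augmentation)
    then obtain W where W: "W \<subseteq> verts E" "y \<approx> (\<Sum>v\<in>W. y * vtx v)" by (rule right_unit)
    have "a \<approx> (\<Sum>v\<in>W. a * vtx v)"
      using cg_trans[OF that(2) cg_trans[OF W(2) cg_sum[OF cg_mult_r[OF cg_sym[OF that(2)]]]]] .
    moreover have "(\<Sum>v\<in>W. a * vtx v) \<in> path_span Y" using W(1) that(1) by (intro path_span_sum) auto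
    ultimately show ?thesis by (rule path_span_cong)
  qed
  have main: "a \<in> A \<Longrightarrow> y \<in> add_span (std UNIV d) \<Longrightarrow> a \<approx> y \<Longrightarrow> a \<in> path_span Y" for d a y
  proof (induct d arbitrary: a y)
    case 0
    show ?case using in_path_span_vtx[OF 0(1,2,3)] by (intro sum[OF _ 0(3,2)]) auto
  next
    case (Suc d)
    have "a * edge e \<in> path_span Y" if e: "e \<in> arcs E" for e
    proof -
      obtain z where "z \<in> add_span (std UNIV d)" "y * edge e \<approx> z" using std_mult_edge[OF Suc(3) e] by blast
      then show ?thesis using Suc(1)[of "a * edge e" z] A_closed(4)[OF Suc(2)] cg_trans[OF cg_mult_r[OF Suc(4)]] by blast
    qed
    then show ?case using in_path_span_vtx[OF Suc(2,3,4)] by (intro sum[OF _ Suc(4,3)]) auto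
  qed
  obtain d y where "y \<in> add_span (std UNIV d)" "a \<approx> y" by (rule augmentation_std[OF assms(2)])
  then show ?thesis using main assms(1) by blast
qed

end

section \<open>Cycles without exits and Laurent polynomials\<close>

lemma int_trichotomy:
  fixes i :: int
  obtains "i = 0" | n where "i = int (Suc n)" | n where "i = - int (Suc n)"
  by (metis int_cases2 nat_int not0_implies_Suc of_nat_0 minus_zero)

lemma map_eq_append_Cons:
  assumes "map f p = xs @ x # ys"
  shows "\<exists>p1 e p2. p = p1 @ e # p2 \<and> f e = x \<and> map f p1 = xs \<and> map f p2 = ys"
  using assms by (fastforce simp: map_eq_append_conv map_eq_Cons_conv)

text \<open>Loops are cut out while the first arc is kept. This is how a given exit that leads back
  becomes part of a cycle.\<close>

lemma (in wf_digraph) shorten_closed_walk: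
  assumes "awalk v (e # p) v"
  shows "\<exists>c. awalk v (e # c) v \<and> distinct (map (tail G) (e # c)) \<and> set c \<subseteq> set p"
  using assms
proof (induct "length p" arbitrary: p rule: less_induct)
  case less
  show ?case
  proof (cases "distinct (map (tail G) (e # p))")
    case True
    then show ?thesis using less(2) by blast
  next
    case False
    then obtain xs ys zs x where d: "map (tail G) (e # p) = xs @ [x] @ ys @ [x] @ zs"
      using not_distinct_decomp by blast
    have tv: "tail G e = v" using less(2) by (simp add: awalk_Cons_iff)
    have "\<exists>q. length q < length p \<and> awalk v (e # q) v \<and> set q \<subseteq> set p"
    proof (cases xs)
      \<comment> \<open>If the repeated vertex is the base, the walk is stopped at the return, since
        cutting out the loop would lose \<open>e\<close>.\<close>
      case Nil
      then have "x = v" "map (tail G) p = ys @ [x] @ zs" using d tv by auto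
      then obtain p1 f p2 where p: "p = p1 @ f # p2" "tail G f = v"
        using map_eq_append_Cons[of "tail G" p ys x zs] by force
      then have "awalk v ((e # p1) @ f # p2) v" using less(2) by simp
      then obtain y where "awalk v (e # p1) y" "awalk y (f # p2) v" by (metis awalk_append_iff)
      then have "awalk v (e # p1) v" using p(2) by (auto simp: awalk_Cons_iff)
      then show ?thesis using p by (intro exI[of _ p1]) auto
    next
      case (Cons x' xs')
      then have "map (tail G) p = xs' @ [x] @ ys @ [x] @ zs" using d by simp
      then obtain p1 f p' where p': "p = p1 @ f # p'" "tail G f = x" "map (tail G) p' = ys @ x # zs"
        using map_eq_append_Cons[of "tail G" p xs' x "ys @ [x] @ zs"] by force
      from map_eq_append_Cons[OF p'(3)] obtain p2 g p3 where "p' = p2 @ g # p3" "tail G g = x" by blast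
      with p' have p: "p = p1 @ f # p2 @ g # p3" "tail G f = x" "tail G g = x" by auto
      then have "awalk v ((e # p1) @ f # p2 @ g # p3) v" using less(2) by simp
      then obtain y where y: "awalk v (e # p1) y" "awalk y ((f # p2) @ g # p3) v" by (metis awalk_append_iff append_Cons)
      then obtain y' where "awalk y (f # p2) y'" "awalk y' (g # p3) v" by (metis awalk_append_iff)
      then have "awalk y (g # p3) v" using p(2,3) by (auto simp: awalk_Cons_iff)
      then have "awalk v ((e # p1) @ g # p3) v" using awalk_appendI y(1) by blast
      then show ?thesis using p by (intro exI[of _ "p1 @ g # p3"]) auto
    qed
    then obtain q where q: "length q < length p" "awalk v (e # q) v" "set q \<subseteq> set p" by blast
    then show ?thesis using less(1)[of q] by blast
  qed
qed

context leavitt_quotient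
begin

lemma Y_cycle:
  assumes "v \<in> Y"
  obtains c where "cycle_based_at E v c" "\<forall>e\<in>set c. Av (tail E e) = {e} \<and> tame (tail E e)"
proof -
  obtain q where q: "q \<noteq> []" "awalk v q v" "\<forall>e\<in>set q. Av (tail E e) = {e} \<and> tame (tail E e)"
    using assms by (auto simp: Y_def)
  obtain e p where ep: "q = e # p" using q(1) by (cases q) auto
  obtain c where c: "awalk v (e # c) v" "distinct (map (tail E) (e # c))" "set c \<subseteq> set p"
    using shorten_closed_walk q(2) unfolding ep by blast
  show ?thesis
    by (rule that[of "e # c"]) (use c q(3) ep in \<open>auto simp: cycle_based_at_def\<close>)
qed

text \<open>Along \<open>c\<close> there is only one arc avoiding \<open>H\<close>, and
  \<open>p\<close> cannot enter the hereditary set \<open>H\<close> because it ends outside.\<close>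

lemma forced_walk:
  assumes "awalk u p w" "w \<notin> H" "awalk u c x" "\<forall>e\<in>set c. Av (tail E e) = {e}"
  shows "(\<exists>r. p = c @ r) \<or> (\<exists>r. c = p @ r)"
  using assms
proof (induct c arbitrary: u p)
  case (Cons e c)
  show ?case
  proof (cases p)
    case (Cons f p')
    have f: "f \<in> arcs E" "tail E f = u" "awalk (head E f) p' w" using Cons.prems(1) Cons by (auto simp: awalk_Cons_iff)
    then have "f \<in> Av u" using awalk_H Cons.prems(2) by (auto simp: Av_iff)
    moreover have "tail E e = u" "awalk (head E e) c x" using Cons.prems(3) by (auto simp: awalk_Cons_iff)
    ultimately have "f = e" using Cons.prems(4) by auto
    then show ?thesis using Cons.hyps[OF f(3) Cons.prems(2)] Cons.prems(3,4) Cons by (auto simp: awalk_Cons_iff)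
  qed simp
qed simp

end

section \<open>One exitless cycle reached from all vertices outside \<open>H\<close>\<close>

locale single_cycle = leavitt_quotient E I for E :: "('v, 'e) pre_digraph" and I :: "('v, 'e, 'k::field) falg set" +
  fixes v :: 'v and c :: "'e list"
  assumes cycle: "cycle_based_at E v c" and v_notin_H: "v \<notin> H"
    and no_exit: "\<forall>e\<in>set c. Av (tail E e) = {e} \<and> tame (tail E e)"
    and connected: "\<And>w. w \<in> verts E - H \<Longrightarrow> \<exists>z. awalk w z v"
begin

lemma c_props: "awalk v c v" "c \<noteq> []" "distinct (map (tail E) c)" "v \<in> verts E"
  using cycle by (auto simp: cycle_based_at_def)

lemma v_in_Y: "v \<in> Y"
  using c_props no_exit v_notin_H by (auto simp: Y_def)

text \<open>By \<open>forced_walk\<close> the closed walk begins with \<open>c\<close> or is an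
  initial piece of it. A proper nonempty initial piece would return to \<open>v\<close> in the
  middle of \<open>c\<close>, against distinctness.\<close>

lemma closed_walk_power:
  assumes "awalk v p v"
  obtains n where "p = concat (replicate n c)"
proof -
  have "\<exists>n. p = concat (replicate n c)"
    using assms
  proof (induct "length p" arbitrary: p rule: less_induct)
    case less
    consider "p = []" | r where "p \<noteq> []" "p = c @ r" | r where "p \<noteq> []" "c = p @ r"
      using forced_walk[OF less(2) v_notin_H c_props(1)] no_exit by blast
    then show ?case
    proof cases
      case 1
      then show ?thesis by (intro exI[of _ 0]) simp
    next
      case 2
      then have "awalk v r v" using less(2) c_props(1) by auto
      moreover have "length r < length p" using 2 c_props(2) by simp
      ultimately obtain n where "r = concat (replicate n c)" using less(1) by blast
      then show ?thesis using 2 by (intro exI[of _ "Suc n"]) simp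
    next
      case 3
      have "r = []"
      proof (rule ccontr)
        assume "r \<noteq> []"
        then obtain f r' where r: "r = f # r'" by (cases r) auto
        obtain e p' where p: "p = e # p'" using 3 by (cases p) auto
        have "awalk v (p @ r) v" using c_props(1) 3 by simp
        then have "awalk v r v" using less(2) by auto
        then have "tail E f = v" "tail E e = v" using r p less(2) by (auto simp: awalk_Cons_iff)
        then show False using c_props(3) 3 r p by simp
      qed
      then show ?thesis using 3 by (intro exI[of _ 1]) simp
    qed
  qed
  then show ?thesis using that by blast
qed

abbreviation "C \<equiv> prod_list (map edge c) :: ('v, 'e, 'k) falg"
abbreviation "D \<equiv> prod_list (map ghost (rev c)) :: ('v, 'e, 'k) falg"
abbreviation "cp \<equiv> cycle_power v c :: int \<Rightarrow> ('v, 'e, 'k) falg"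

text \<open>The powers in \<open>cycle_power\<close> carry no explicit vertex; the first arc of the
  nonempty walk \<open>c\<close> supplies it.\<close>

lemma pth_c: "pth v c \<approx> C" and gst_c: "gst v c \<approx> D"
proof -
  obtain e p where p: "c = e # p" using c_props(2) by (cases c) auto
  then have e: "tail E e = v" using c_props(1) by (simp add: awalk_Cons_iff)
  show "pth v c \<approx> C" using cg_mult_r[OF vtx_edge[of e]] e by (simp add: pth_def p mult.assoc)
  show "gst v c \<approx> D" using cg_mult_l[OF ghost_vtx[of e]] e by (simp add: gst_def p mult.assoc)
qed

text \<open>The relation \<open>C * D \<approx> vtx v\<close> is the one that relies on the absence
  of exits; it makes \<open>C\<close> invertible at \<open>v\<close>.\<close>

lemma cycle_calc:
  "vtx v * C \<approx> C" "C * vtx v \<approx> C" "vtx v * D \<approx> D" "D * vtx v \<approx> D" "C * D \<approx> vtx v" "D * C \<approx> vtx v"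
proof -
  show "vtx v * C \<approx> C" using pth_c by (simp add: pth_def)
  show "D * vtx v \<approx> D" using gst_c by (simp add: gst_def)
  show "C * vtx v \<approx> C"
    using cg_trans[OF cg_mult_r[OF cg_sym[OF pth_c]] cg_trans[OF pth_vtx[OF c_props(1)] pth_c]] .
  show "vtx v * D \<approx> D"
    using cg_trans[OF cg_mult_l[OF cg_sym[OF gst_c]] cg_trans[OF vtx_gst[OF c_props(1)] gst_c]] .
  show "C * D \<approx> vtx v"
    using cg_trans[OF cg_mult[OF cg_sym[OF pth_c] cg_sym[OF gst_c]]
        cg_sym[OF Y_vtx_pth_gst[OF c_props(1) v_in_Y v_notin_H]]] .
  show "D * C \<approx> vtx v"
    using cg_trans[OF cg_mult[OF cg_sym[OF gst_c] cg_sym[OF pth_c]] gst_pth[OF c_props(1)]] .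
qed

lemma power_vtx: "C ^ Suc n * vtx v \<approx> C ^ Suc n" "D ^ Suc n * vtx v \<approx> D ^ Suc n"
  unfolding power_Suc2 mult.assoc by (intro cg_mult_l cycle_calc)+

lemma cp_vtx: "cp i * vtx v \<approx> cp i"
proof -
  show ?thesis
  proof (cases i rule: int_trichotomy)
    case 1
    then show ?thesis by (simp add: cycle_power_def vtx_idem)
  next
    case (2 n)
    then have "cp i = C ^ Suc n" by (simp add: cycle_power_def nat_add_distrib)
    then show ?thesis using power_vtx by simp
  next
    case (3 n)
    then have "cp i = D ^ Suc n" by (simp add: cycle_power_def nat_add_distrib)
    then show ?thesis using power_vtx by simp
  qed
qed

lemma cp_simps: "cp 0 = vtx v" "cp (int (Suc n)) = C ^ Suc n" "cp (- int (Suc n)) = D ^ Suc n"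
  by (simp_all add: cycle_power_def nat_add_distrib)

lemma power_C_D: "C ^ Suc n * D \<approx> cp (int n)" and power_D_C: "D ^ Suc n * C \<approx> cp (- int n)"
proof -
  have "C ^ Suc n * D = C ^ n * (C * D)" by (simp only: power_Suc2 mult.assoc)
  also have "\<dots> \<approx> C ^ n * vtx v" by (rule cg_mult_l[OF cycle_calc(5)])
  also have "\<dots> \<approx> cp (int n)"
    using power_vtx(1) by (cases n) (simp_all add: cp_simps del: power_Suc of_nat_Suc)
  finally show "C ^ Suc n * D \<approx> cp (int n)" .
  have "D ^ Suc n * C = D ^ n * (D * C)" by (simp only: power_Suc2 mult.assoc)
  also have "\<dots> \<approx> D ^ n * vtx v" by (rule cg_mult_l[OF cycle_calc(6)])
  also have "\<dots> \<approx> cp (- int n)"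
    using power_vtx(2) by (cases n) (simp_all add: cp_simps del: power_Suc of_nat_Suc)
  finally show "D ^ Suc n * C \<approx> cp (- int n)" .
qed

lemma cp_step: "cp i * C \<approx> cp (i + 1)" "cp i * D \<approx> cp (i - 1)"
proof -
  show "cp i * C \<approx> cp (i + 1)"
  proof (cases i rule: int_trichotomy)
    case 1
    then show ?thesis using cycle_calc(1) cp_simps(2)[of 0] by (simp add: cp_simps(1))
  next
    case (2 n)
    then have "cp (i + 1) = C ^ Suc (Suc n)" using cp_simps(2)[of "Suc n"] by (simp add: algebra_simps)
    then show ?thesis using 2 cp_simps(2)[of n] by (simp only: power_Suc2[of _ "Suc n"] cg_refl)
  next
    case (3 n)
    then have "i + 1 = - int n" by simp
    then show ?thesis using 3 power_D_C[of n] cp_simps(3)[of n] by simp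
  qed
  show "cp i * D \<approx> cp (i - 1)"
  proof (cases i rule: int_trichotomy)
    case 1
    then show ?thesis using cycle_calc(3) cp_simps(3)[of 0] by (simp add: cp_simps(1))
  next
    case (2 n)
    then have "i - 1 = int n" by simp
    then show ?thesis using 2 power_C_D[of n] cp_simps(2)[of n] by simp
  next
    case (3 n)
    then have "i - 1 = - int (Suc (Suc n))" by simp
    then have "cp (i - 1) = D ^ Suc (Suc n)" by (simp only: cp_simps(3))
    then show ?thesis using 3 cp_simps(3)[of n] by (simp only: power_Suc2[of _ "Suc n"] cg_refl)
  qed
qed

text \<open>Induction on \<open>j\<close> in both directions, where a step up multiplies by
  \<open>C\<close> and a step down by \<open>D\<close>; this avoids a case analysis on
  signs.\<close>

lemma cp_mult: "cp i * cp j \<approx> cp (i + j)"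
proof (induct j rule: int_induct[where k = 0])
  case base
  then show ?case using cp_vtx by (simp add: cp_simps(1))
next
  case (step1 j)
  have "cp i * cp (j + 1) \<approx> cp i * (cp j * C)" by (rule cg_mult_l[OF cg_sym[OF cp_step(1)]])
  also have "\<dots> \<approx> cp (i + j) * C" by (rule cg_mult_assoc[OF step1(2)])
  also have "\<dots> \<approx> cp (i + j + 1)" by (rule cp_step)
  finally show ?case by (simp add: add.assoc)
next
  case (step2 j)
  have "cp i * cp (j - 1) \<approx> cp i * (cp j * D)" by (rule cg_mult_l[OF cg_sym[OF cp_step(2)]])
  also have "\<dots> \<approx> cp (i + j) * D" by (rule cg_mult_assoc[OF step2(2)])
  also have "\<dots> \<approx> cp (i + j - 1)" by (rule cp_step)
  finally show ?case by (simp add: algebra_simps)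
qed

lemma pth_power: "pth v (concat (replicate n c)) \<approx> cp (int n)"
  and gst_power: "gst v (concat (replicate n c)) \<approx> cp (- int n)"
proof -
  have C1: "C = cp 1" "D = cp (- 1)" by (simp_all add: cycle_power_def)
  show "pth v (concat (replicate n c)) \<approx> cp (int n)"
  proof (induct n)
    case (Suc n)
    have "pth v (concat (replicate (Suc n) c)) \<approx> pth v c * pth v (concat (replicate n c))"
      using pth_append[OF c_props(1)] by simp
    also have "\<dots> \<approx> cp 1 * cp (int n)" using cg_mult[OF pth_c Suc] C1 by simp
    also have "\<dots> \<approx> cp (int (Suc n))" using cp_mult[of 1 "int n"] by simp
    finally show ?case .
  qed (simp add: cp_simps(1))
  show "gst v (concat (replicate n c)) \<approx> cp (- int n)"
  proof (induct n)
    case (Suc n)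
    have "gst v (concat (replicate (Suc n) c)) \<approx> gst v (concat (replicate n c)) * gst v c"
      using gst_append[OF c_props(1)] by simp
    also have "\<dots> \<approx> cp (- int n) * cp (- 1)" using cg_mult[OF Suc gst_c] C1 by simp
    also have "\<dots> \<approx> cp (- int (Suc n))" using cp_mult[of "- int n" "- 1"] by (simp add: algebra_simps)
    finally show ?case .
  qed (simp add: cp_simps(1))
qed

text \<open>The representative that occurs in \<open>laurent_at_cycle\<close>. Modulo
  \<open>I\<close> it is a ring homomorphism on Laurent polynomials, sending 1 to the vertex
  \<open>v\<close>.\<close>

definition ev :: "(int \<Rightarrow>\<^sub>0 'k) \<Rightarrow> ('v, 'e, 'k) falg" where
  "ev f = (\<Sum>i\<in>Poly_Mapping.keys f. scal (Poly_Mapping.lookup f i) * cp i)"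

lemma ev_add: "ev (f + g) = ev f + ev g"
  unfolding ev_def by (rule setsum_keys_plus_distrib) (simp_all add: scal_simps distrib_right)

lemma ev_single: "ev (Poly_Mapping.single i a) = scal a * cp i"
  by (simp add: ev_def scal_simps)

lemma ev_zero: "ev 0 = 0"
  by (simp add: ev_def)

lemma ev_one: "ev 1 = vtx v"
  using ev_single[of 0 1] by (simp add: scal_simps cp_simps(1))

lemma ev_mult: "ev (f * g) \<approx> ev f * ev g"
proof (induct f rule: poly_mapping_additive_induct)
  case zero
  then show ?case by (simp add: ev_zero)
next
  case (single i a)
  show ?case
  proof (induct g rule: poly_mapping_additive_induct)
    case zero
    then show ?case by (simp add: ev_zero)
  next
    case (single j b)
    have "(scal a * scal b) * cp (i + j) \<approx> (scal a * scal b) * (cp i * cp j)" by (rule cg_mult_l[OF cg_sym[OF cp_mult]])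
    moreover have "scal a * cp i * (scal b * cp j) = (scal a * scal b) * (cp i * cp j)"
      by (simp only: mult.assoc scal_left_commute[of "cp i"])
    ultimately show ?case using cg_sym by (simp add: mult_single ev_single scal_simps(1) cg_sym)
  next
    case (add f g)
    then show ?case by (simp add: distrib_left ev_add cg_add)
  qed
next
  case (add f g)
  then show ?case by (simp add: distrib_right ev_add cg_add)
qed

lemma ev_ideal:
  assumes "ring_ideal A" "I \<subseteq> A"
  shows "laurent_ideal {f. ev f \<in> A}"
  unfolding laurent_ideal_def
  using ring_idealD[OF assms(1)] cg_cong_ideal[OF assms ev_mult] by (simp add: ev_zero ev_add)

text \<open>Both walks can be prolonged by a walk \<open>z\<close> to \<open>v\<close>, since zz^*
  equals the vertex \<open>w\<close> when \<open>w\<close> lies on an exitless cycle.\<close>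

lemma standard_to_v:
  assumes "awalk u p w" "awalk u' q w" "w \<in> Y" "awalk w z v"
  shows "pth u p * gst u' q \<approx> pth u (p @ z) * gst u' (q @ z)"
proof -
  have "pth u p * gst u' q \<approx> (pth u p * vtx w) * gst u' q" by (intro cg_mult_r cg_sym[OF pth_vtx] assms)
  also have "\<dots> \<approx> (pth u p * (pth w z * gst w z)) * gst u' q"
    by (rule cg_mult_r[OF cg_mult_l[OF Y_vtx_pth_gst[OF assms(4,3) v_notin_H]]])
  also have "\<dots> = (pth u p * pth w z) * (gst w z * gst u' q)" by (simp add: mult.assoc)
  also have "\<dots> \<approx> pth u (p @ z) * gst u' (q @ z)"
    by (intro cg_mult cg_sym[OF pth_append] cg_sym[OF gst_append] assms)
  finally show ?thesis .
qed

text \<open>Compression to \<open>v\<close> leaves monomials whose two walks start at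
  \<open>v\<close>. Prolonged to closed walks they are powers of \<open>c\<close>, so the corner at
  \<open>v\<close> is the image of the Laurent polynomials.\<close>

lemma corner:
  assumes "b \<in> augmentation_ideal"
  shows "\<exists>f. vtx v * b * vtx v \<approx> ev f"
proof -
  obtain d y where y: "y \<in> add_span (std UNIV d)" "b \<approx> y" by (rule augmentation_std[OF assms])
  have "\<exists>f. vtx v * y * vtx v \<approx> ev f"
    using y(1)
  proof induct
    case zero
    then show ?case by (intro exI[of _ 0]) (simp add: ev_zero)
  next
    case (base x)
    then obtain k u p u' q w where x: "awalk u p w" "awalk u' q w" "x = scal k * (pth u p * gst u' q)"
      unfolding std_def by blast
    have eq: "vtx v * x * vtx v = scal k * ((vtx v * pth u p) * (gst u' q * vtx v))"
      unfolding x(3) by (simp add: mult.assoc scal_left_commute)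
    show ?case
    proof (cases "u = v \<and> u' = v \<and> w \<notin> H")
      case False
      have "(vtx v * pth u p) * (gst u' q * vtx v) \<approx> 0"
      proof -
        consider "u \<noteq> v" | "u' \<noteq> v" | "w \<in> H" using False by blast
        then show ?thesis
        proof cases
          case 1
          then show ?thesis by (intro cg_mult_0(1) vtx_pth_0) auto
        next
          case 2
          then show ?thesis by (intro cg_mult_0(2) gst_vtx_0) auto
        next
          case 3
          then have "vtx v * pth u p \<approx> 0" using pth_H[OF x(1)] I_closed(3) by (simp add: cg_0)
          then show ?thesis by (rule cg_mult_0(1))
        qed
      qed
      then have "vtx v * x * vtx v \<approx> ev 0" unfolding eq ev_zero by (rule cg_mult_0(2))
      then show ?thesis by blast
    next
      case True
      then have aw: "awalk v p w" "awalk v q w" using x by auto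
      have wY: "w \<in> Y" using Y_awalk[OF aw(1) v_in_Y] True by blast
      obtain z where z: "awalk w z v" using connected Y_verts[OF wY] by blast
      obtain n where n: "p @ z = concat (replicate n c)"
        using closed_walk_power[OF awalk_appendI[OF aw(1) z]] by blast
      obtain m where m: "q @ z = concat (replicate m c)"
        using closed_walk_power[OF awalk_appendI[OF aw(2) z]] by blast
      have "(vtx v * pth u p) * (gst u' q * vtx v) \<approx> pth v p * gst v q"
        using True by (auto intro: cg_mult vtx_pth gst_vtx)
      also have "\<dots> \<approx> pth v (p @ z) * gst v (q @ z)" by (rule standard_to_v[OF aw wY z])
      also have "\<dots> \<approx> cp (int n) * cp (- int m)" unfolding n m by (intro cg_mult pth_power gst_power)
      also have "\<dots> \<approx> cp (int n - int m)" using cp_mult[of "int n" "- int m"] by simp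
      finally have "vtx v * x * vtx v \<approx> ev (Poly_Mapping.single (int n - int m) k)"
        unfolding eq ev_single by (rule cg_mult_l)
      then show ?thesis by blast
    qed
  next
    case (add x y)
    then obtain f g where "vtx v * x * vtx v \<approx> ev f" "vtx v * y * vtx v \<approx> ev g" by blast
    then have "vtx v * (x + y) * vtx v \<approx> ev (f + g)" by (simp add: ev_add distrib_left distrib_right cg_add)
    then show ?case by blast
  qed
  then show ?thesis using cg_trans[OF cg_mult_r[OF cg_mult_l[OF y(2)]]] by blast
qed

text \<open>
  The paths that reach \<open>v\<close> only at their end form a system of matrix units for the span of the
  \<open>\<alpha>\<beta>\<^sup>*\<close> with \<open>\<alpha>\<close>, \<open>\<beta>\<close> ending on the cycle.
\<close>

definition T :: "('v \<times> 'e list) set" where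
  "T = {(u, p). awalk u p v \<and> v \<notin> set (map (tail E) p)}"

text \<open>No walk in \<open>T\<close> is a proper initial piece of another, since the longer one
  would pass through \<open>v\<close> before its end.\<close>

lemma matrix_unit_orth:
  assumes "s \<in> T" "t \<in> T"
  shows "gst (fst s) (snd s) * pth (fst t) (snd t) \<approx> (if s = t then vtx v else 0)"
proof (cases "s = t")
  case True
  then show ?thesis using assms gst_pth by (auto simp: T_def)
next
  case False
  have aux: "r = []" if "awalk u p v" "awalk u (p @ r) v" "v \<notin> set (map (tail E) (p @ r))" for u p r
  proof (cases r)
    case (Cons f r')
    have "awalk v r v" using that(1,2) by auto
    then have "tail E f = v" using Cons by (simp add: awalk_Cons_iff)
    then show ?thesis using that(3) Cons by simp
  qed
  have s: "awalk (fst s) (snd s) v" "v \<notin> set (map (tail E) (snd s))"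
    and t: "awalk (fst t) (snd t) v" "v \<notin> set (map (tail E) (snd t))"
    using assms by (simp_all add: T_def case_prod_beta)
  have "gst (fst s) (snd s) * pth (fst t) (snd t) \<approx> 0"
  proof (rule gst_pth_0[OF s(1) t(1)])
    assume eq: "fst s = fst t"
    have "\<nexists>r. snd t = snd s @ r"
    proof
      assume "\<exists>r. snd t = snd s @ r"
      then obtain r where r: "snd t = snd s @ r" ..
      have "r = []" by (rule aux[OF s(1)]) (use t in \<open>simp_all only: eq r not_False_eq_True\<close>)
      then show False using r eq False by (simp add: prod_eq_iff)
    qed
    moreover have "\<nexists>r. snd s = snd t @ r"
    proof
      assume "\<exists>r. snd s = snd t @ r"
      then obtain r where r: "snd s = snd t @ r" ..
      have "r = []" by (rule aux[OF t(1)]) (use s in \<open>simp_all only: eq r not_False_eq_True\<close>)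
      then show False using r eq False by (simp add: prod_eq_iff)
    qed
    ultimately show "(\<nexists>r. snd t = snd s @ r) \<and> (\<nexists>r. snd s = snd t @ r)" by blast
  qed
  then show ?thesis using False by simp
qed

lemma first_visit_decomp:
  assumes "awalk u p v"
  obtains p1 p2 where "p = p1 @ p2" "(u, p1) \<in> T" "awalk v p2 v"
proof -
  have "\<exists>p1 p2. p = p1 @ p2 \<and> (u, p1) \<in> T \<and> awalk v p2 v"
    using assms
  proof (induct p arbitrary: u)
    case Nil
    then show ?case by (auto simp: T_def awalk_Nil_iff)
  next
    case (Cons e p)
    show ?case
    proof (cases "u = v")
      case True
      then have "(u, []) \<in> T" using c_props(4) by (simp add: T_def awalk_Nil_iff)
      moreover have "awalk v (e # p) v" using Cons(2) True by simp
      ultimately show ?thesis using append_Nil by metis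
    next
      case False
      have e: "e \<in> arcs E" "tail E e = u" "awalk (head E e) p v" using Cons(2) by (auto simp: awalk_Cons_iff)
      obtain p1 p2 where "p = p1 @ p2" "(head E e, p1) \<in> T" "awalk v p2 v" using Cons(1)[OF e(3)] by blast
      moreover from this have "(u, e # p1) \<in> T" using e False by (simp add: T_def awalk_Cons_iff)
      ultimately show ?thesis using append_Cons by metis
    qed
  qed
  then show ?thesis using that by blast
qed

lemma matrix_unit_left:
  assumes "s \<in> T" "awalk v p2 v" "finite S" "s \<in> S" "S \<subseteq> T"
  shows "(\<Sum>t\<in>S. pth (fst t) (snd t) * (gst (fst t) (snd t) * pth (fst s) (snd s @ p2))) \<approx> pth (fst s) (snd s @ p2)"
proof -
  have s: "awalk (fst s) (snd s) v" using assms(1) by (auto simp: T_def)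
  have "pth (fst t) (snd t) * (gst (fst t) (snd t) * pth (fst s) (snd s @ p2)) \<approx>
    (if t = s then pth (fst s) (snd s @ p2) else 0)" if "t \<in> S" for t
  proof -
    have t: "t \<in> T" "awalk (fst t) (snd t) v" using that assms(5) by (auto simp: T_def)
    have "gst (fst t) (snd t) * pth (fst s) (snd s @ p2) \<approx> gst (fst t) (snd t) * (pth (fst s) (snd s) * pth v p2)"
      by (intro cg_mult_l pth_append s)
    also have "\<dots> \<approx> (if t = s then vtx v else 0) * pth v p2" by (rule cg_mult_assoc[OF matrix_unit_orth[OF t(1) assms(1)]])
    also have "\<dots> \<approx> (if t = s then pth v p2 else 0)" by (simp add: vtx_pth)
    finally have "pth (fst t) (snd t) * (gst (fst t) (snd t) * pth (fst s) (snd s @ p2)) \<approx>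
      pth (fst t) (snd t) * (if t = s then pth v p2 else 0)" by (rule cg_mult_l)
    also have "\<dots> \<approx> (if t = s then pth (fst s) (snd s @ p2) else 0)"
      using cg_sym[OF pth_append[OF s]] by simp
    finally show ?thesis .
  qed
  then have "(\<Sum>t\<in>S. pth (fst t) (snd t) * (gst (fst t) (snd t) * pth (fst s) (snd s @ p2))) \<approx>
    (\<Sum>t\<in>S. if t = s then pth (fst s) (snd s @ p2) else 0)" by (rule cg_sum)
  then show ?thesis using assms(3,4) by (simp add: sum.delta)
qed

lemma matrix_unit_right:
  assumes "s \<in> T" "awalk v p2 v" "finite S" "s \<in> S" "S \<subseteq> T"
  shows "(\<Sum>t\<in>S. (gst (fst s) (snd s @ p2) * pth (fst t) (snd t)) * gst (fst t) (snd t)) \<approx> gst (fst s) (snd s @ p2)"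
proof -
  have s: "awalk (fst s) (snd s) v" using assms(1) by (auto simp: T_def)
  have "(gst (fst s) (snd s @ p2) * pth (fst t) (snd t)) * gst (fst t) (snd t) \<approx>
    (if t = s then gst (fst s) (snd s @ p2) else 0)" if "t \<in> S" for t
  proof -
    have t: "t \<in> T" "awalk (fst t) (snd t) v" using that assms(5) by (auto simp: T_def)
    have "gst (fst s) (snd s @ p2) * pth (fst t) (snd t) \<approx> (gst v p2 * gst (fst s) (snd s)) * pth (fst t) (snd t)"
      by (intro cg_mult_r gst_append s)
    also have "\<dots> = gst v p2 * (gst (fst s) (snd s) * pth (fst t) (snd t))" by (simp add: mult.assoc)
    also have "\<dots> \<approx> gst v p2 * (if s = t then vtx v else 0)" by (rule cg_mult_l[OF matrix_unit_orth[OF assms(1) t(1)]])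
    also have "\<dots> \<approx> (if t = s then gst v p2 else 0)" using gst_vtx by auto
    finally have "(gst (fst s) (snd s @ p2) * pth (fst t) (snd t)) * gst (fst t) (snd t) \<approx>
      (if t = s then gst v p2 else 0) * gst (fst t) (snd t)" by (rule cg_mult_r)
    also have "\<dots> \<approx> (if t = s then gst (fst s) (snd s @ p2) else 0)"
      using cg_sym[OF gst_append[OF s]] by simp
    finally show ?thesis .
  qed
  then have "(\<Sum>t\<in>S. (gst (fst s) (snd s @ p2) * pth (fst t) (snd t)) * gst (fst t) (snd t)) \<approx>
    (\<Sum>t\<in>S. if t = s then gst (fst s) (snd s @ p2) else 0)" by (rule cg_sum)
  then show ?thesis using assms(3,4) by (simp add: sum.delta)
qed

text \<open>Finite sums of tt^* with t in \<open>T\<close> are local units from both sides. As with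
  vertices, it is the form for all sufficiently large sets that passes to sums.\<close>

lemma matrix_units_act:
  assumes "a \<in> path_span Y"
  shows "\<exists>S0. finite S0 \<and> S0 \<subseteq> T \<and> (\<forall>S. finite S \<longrightarrow> S0 \<subseteq> S \<longrightarrow> S \<subseteq> T \<longrightarrow>
    a \<approx> (\<Sum>t\<in>S. pth (fst t) (snd t) * (gst (fst t) (snd t) * a)) \<and>
    a \<approx> (\<Sum>t\<in>S. (a * pth (fst t) (snd t)) * gst (fst t) (snd t)))"
  using assms
proof (induct rule: path_span_induct)
  case (zero x)
  have "x \<approx> (\<Sum>t\<in>S. f t * x)" "x \<approx> (\<Sum>t\<in>S. x * f t)" for S and f :: "'v \<times> 'e list \<Rightarrow> ('v, 'e, 'k) falg"
    unfolding cg_def by (intro I_closed(6) zero ring_ideal_sum[OF ring_ideal] I_closed(3) I_closed(4))+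
  from this(1)[of "\<lambda>t. pth (fst t) (snd t) * gst (fst t) (snd t)"] this(2)[of "\<lambda>t. pth (fst t) (snd t) * gst (fst t) (snd t)"]
  show ?case by (intro exI[of _ "{}"]) (simp add: mult.assoc)
next
  case (base k u p u' q w x)
  obtain z where z: "awalk w z v" using connected Y_verts[OF base(3)] by blast
  obtain p1 p2 where p: "p @ z = p1 @ p2" "(u, p1) \<in> T" "awalk v p2 v"
    using first_visit_decomp[OF awalk_appendI[OF base(1) z]] by blast
  obtain q1 q2 where q: "q @ z = q1 @ q2" "(u', q1) \<in> T" "awalk v q2 v"
    using first_visit_decomp[OF awalk_appendI[OF base(2) z]] by blast
  let ?y = "scal k * (pth u (p1 @ p2) * gst u' (q1 @ q2))"
  have x: "x \<approx> ?y"
    using cg_trans[OF base(4) cg_mult_l[OF standard_to_v[OF base(1,2,3) z]]] by (simp add: p(1) q(1))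
  have "x \<approx> (\<Sum>t\<in>S. pth (fst t) (snd t) * (gst (fst t) (snd t) * x))"
    "x \<approx> (\<Sum>t\<in>S. (x * pth (fst t) (snd t)) * gst (fst t) (snd t))"
    if S: "finite S" "{(u, p1), (u', q1)} \<subseteq> S" "S \<subseteq> T" for S
  proof -
    have "(\<Sum>t\<in>S. pth (fst t) (snd t) * (gst (fst t) (snd t) * x)) \<approx>
      (\<Sum>t\<in>S. pth (fst t) (snd t) * (gst (fst t) (snd t) * ?y))" by (intro cg_sum cg_mult_l x)
    also have "\<dots> = scal k * ((\<Sum>t\<in>S. pth (fst t) (snd t) * (gst (fst t) (snd t) * pth u (p1 @ p2))) * gst u' (q1 @ q2))"
      by (simp add: sum_distrib_left sum_distrib_right scal_left_commute mult.assoc)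
    also have "\<dots> \<approx> ?y" using matrix_unit_left[OF p(2,3) S(1) _ S(3)] S(2) by (intro cg_mult_l cg_mult_r) simp
    finally show "x \<approx> (\<Sum>t\<in>S. pth (fst t) (snd t) * (gst (fst t) (snd t) * x))"
      using cg_trans[OF x cg_sym] by blast
    have "(\<Sum>t\<in>S. (x * pth (fst t) (snd t)) * gst (fst t) (snd t)) \<approx>
      (\<Sum>t\<in>S. (?y * pth (fst t) (snd t)) * gst (fst t) (snd t))" by (intro cg_sum cg_mult_r x)
    also have "\<dots> = scal k * (pth u (p1 @ p2) * (\<Sum>t\<in>S. (gst u' (q1 @ q2) * pth (fst t) (snd t)) * gst (fst t) (snd t)))"
      by (simp add: sum_distrib_left sum_distrib_right scal_left_commute mult.assoc)
    also have "\<dots> \<approx> ?y" using matrix_unit_right[OF q(2,3) S(1) _ S(3)] S(2) by (intro cg_mult_l) simp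
    finally show "x \<approx> (\<Sum>t\<in>S. (x * pth (fst t) (snd t)) * gst (fst t) (snd t))"
      using cg_trans[OF x cg_sym] by blast
  qed
  then show ?case using p(2) q(2) by (intro exI[of _ "{(u, p1), (u', q1)}"]) auto
next
  case (add x y z)
  obtain S1 where 1: "finite S1" "S1 \<subseteq> T" "\<And>S. finite S \<Longrightarrow> S1 \<subseteq> S \<Longrightarrow> S \<subseteq> T \<Longrightarrow>
    x \<approx> (\<Sum>t\<in>S. pth (fst t) (snd t) * (gst (fst t) (snd t) * x)) \<and>
    x \<approx> (\<Sum>t\<in>S. (x * pth (fst t) (snd t)) * gst (fst t) (snd t))" using add(1) by blast
  obtain S2 where 2: "finite S2" "S2 \<subseteq> T" "\<And>S. finite S \<Longrightarrow> S2 \<subseteq> S \<Longrightarrow> S \<subseteq> T \<Longrightarrow>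
    y \<approx> (\<Sum>t\<in>S. pth (fst t) (snd t) * (gst (fst t) (snd t) * y)) \<and>
    y \<approx> (\<Sum>t\<in>S. (y * pth (fst t) (snd t)) * gst (fst t) (snd t))" using add(2) by blast
  have "z \<approx> (\<Sum>t\<in>S. pth (fst t) (snd t) * (gst (fst t) (snd t) * z)) \<and>
    z \<approx> (\<Sum>t\<in>S. (z * pth (fst t) (snd t)) * gst (fst t) (snd t))" if S: "finite S" "S1 \<union> S2 \<subseteq> S" "S \<subseteq> T" for S
  proof
    have *: "z \<approx> (\<Sum>t\<in>S. pth (fst t) (snd t) * (gst (fst t) (snd t) * (x + y)))"
      unfolding distrib_left sum.distrib using 1(3)[of S] 2(3)[of S] S cg_trans[OF add(3) cg_add] by blast
    show "z \<approx> (\<Sum>t\<in>S. pth (fst t) (snd t) * (gst (fst t) (snd t) * z))"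
      by (rule cg_trans[OF * cg_sum[OF cg_mult_l[OF cg_mult_l[OF cg_sym[OF add(3)]]]]])
    have *: "z \<approx> (\<Sum>t\<in>S. ((x + y) * pth (fst t) (snd t)) * gst (fst t) (snd t))"
      unfolding distrib_right sum.distrib using 1(3)[of S] 2(3)[of S] S cg_trans[OF add(3) cg_add] by blast
    show "z \<approx> (\<Sum>t\<in>S. (z * pth (fst t) (snd t)) * gst (fst t) (snd t))"
      by (rule cg_trans[OF * cg_sum[OF cg_mult_r[OF cg_mult_r[OF cg_sym[OF add(3)]]]]])
  qed
  then show ?case using 1(1,2) 2(1,2) by (intro exI[of _ "S1 \<union> S2"]) auto
qed

text \<open>The element is recovered from its matrix entries s^* a t, so some entry is outside
  \<open>B\<close>. Entries lie in the corner at \<open>v\<close> and are therefore Laurent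
  polynomials in \<open>c\<close>.\<close>

lemma polynomial_in_ideal:
  assumes A: "ring_ideal A" "I \<subseteq> A" and B: "ring_ideal B" "I \<subseteq> B"
    and a: "a \<in> A" "a \<notin> B" "a \<in> path_span Y" "a \<in> augmentation_ideal"
  obtains f where "ev f \<in> A" "ev f \<notin> B"
proof -
  note B' = ring_idealD[OF B(1)]
  obtain S where S: "finite S" "S \<subseteq> T" "a \<approx> (\<Sum>t\<in>S. pth (fst t) (snd t) * (gst (fst t) (snd t) * a))"
    "a \<approx> (\<Sum>t\<in>S. (a * pth (fst t) (snd t)) * gst (fst t) (snd t))"
    using matrix_units_act[OF a(3)] by blast
  have "(\<Sum>t\<in>S. pth (fst t) (snd t) * (gst (fst t) (snd t) * a)) \<notin> B" using a(2) cg_cong_ideal[OF B S(3)] by blast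
  moreover have "(\<Sum>t\<in>S. pth (fst t) (snd t) * (gst (fst t) (snd t) * a)) \<in> B"
    if "\<And>s. s \<in> S \<Longrightarrow> gst (fst s) (snd s) * a \<in> B"
    by (rule ring_ideal_sum[OF B(1)]) (rule B'(3)[OF that])
  ultimately obtain s where s: "s \<in> S" "gst (fst s) (snd s) * a \<notin> B" by metis
  have "gst (fst s) (snd s) * a \<approx> gst (fst s) (snd s) * (\<Sum>t\<in>S. (a * pth (fst t) (snd t)) * gst (fst t) (snd t))"
    by (rule cg_mult_l[OF S(4)])
  from cg_cong_ideal[OF B this] s(2)
  have "(\<Sum>t\<in>S. gst (fst s) (snd s) * (a * pth (fst t) (snd t)) * gst (fst t) (snd t)) \<notin> B"
    by (simp add: sum_distrib_left mult.assoc)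
  moreover have "(\<Sum>t\<in>S. gst (fst s) (snd s) * (a * pth (fst t) (snd t)) * gst (fst t) (snd t)) \<in> B"
    if "\<And>t. t \<in> S \<Longrightarrow> gst (fst s) (snd s) * (a * pth (fst t) (snd t)) \<in> B"
    by (rule ring_ideal_sum[OF B(1)]) (rule B'(4)[OF that])
  ultimately obtain t where t: "t \<in> S" "gst (fst s) (snd s) * (a * pth (fst t) (snd t)) \<notin> B" by metis
  have st: "awalk (fst s) (snd s) v" "awalk (fst t) (snd t) v" using s t S(2) by (auto simp: T_def)
  let ?b = "gst (fst s) (snd s) * a * pth (fst t) (snd t)"
  have "vtx v * ?b * vtx v = (vtx v * gst (fst s) (snd s)) * a * (pth (fst t) (snd t) * vtx v)" by (simp add: mult.assoc)
  also have "\<dots> \<approx> ?b" by (intro cg_mult cg_refl vtx_gst pth_vtx st)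
  finally have b: "vtx v * ?b * vtx v \<approx> ?b" .
  obtain f where "vtx v * ?b * vtx v \<approx> ev f" using corner[of ?b] augmentation_closed(3,4) a(4) by blast
  then have f: "ev f \<approx> ?b" using cg_trans[OF cg_sym] b by blast
  have "?b \<in> A" using ring_idealD[OF A(1)] a(1) by blast
  moreover have "?b \<notin> B" using t(2) by (simp add: mult.assoc)
  ultimately show ?thesis using that cg_cong_ideal[OF A f] cg_cong_ideal[OF B f] by blast
qed

end

section \<open>The grading by length\<close>

fun gen_degree :: "('v, 'e) gen \<Rightarrow> int" where
  "gen_degree (Vert v) = 0"
| "gen_degree (Edge e) = 1"
| "gen_degree (Ghost e) = - 1"

definition word_degree :: "('v, 'e) gen list \<Rightarrow> int" where
  "word_degree w = sum_list (map gen_degree w)"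

definition homogeneous :: "int \<Rightarrow> ('v, 'e, 'k::field) falg \<Rightarrow> bool" where
  "homogeneous n x \<longleftrightarrow> (\<forall>w. Poly_Mapping.lookup x w \<noteq> 0 \<longrightarrow> word_degree w = n)"

definition component :: "int \<Rightarrow> ('v, 'e, 'k::field) falg \<Rightarrow> ('v, 'e, 'k) falg" where
  "component n = Poly_Mapping.mapp (\<lambda>w a. if word_degree w = n then a else 0)"

lemma word_degree_append: "word_degree (u @ w) = word_degree u + word_degree w"
  by (simp add: word_degree_def)

lemma lookup_component:
  "Poly_Mapping.lookup (component n x) w = (if word_degree w = n then Poly_Mapping.lookup x w else 0)"
  by (simp add: component_def lookup_mapp when_def in_keys_iff)

lemma component_zero [simp]: "component n 0 = 0"
  and component_add: "component n (x + y) = component n x + component n y"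
  by (rule poly_mapping_eqI; simp add: lookup_component lookup_add)+

lemma component_sum: "component n (sum f S) = (\<Sum>s\<in>S. component n (f s))"
  by (induct S rule: infinite_finite_induct) (simp_all add: component_add)

lemma component_monom: "component n (monom w a) = (if word_degree w = n then monom w a else 0)"
  by (rule poly_mapping_eqI) (auto simp: lookup_component lookup_single when_def)

lemma component_monom_mult: "component n (monom u a * x) = monom u a * component (n - word_degree u) x"
  and component_mult_monom: "component n (x * monom u a) = component (n - word_degree u) x * monom u a"
  by (induct x rule: poly_mapping_additive_induct)
    (auto simp: component_add component_monom monom_mult distrib_left distrib_right word_degree_append)

lemma component_homogeneous: "homogeneous m x \<Longrightarrow> component n x = (if n = m then x else 0)"
  by (rule poly_mapping_eqI) (auto simp: lookup_component homogeneous_def)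

lemma homogeneous_monom: "homogeneous (word_degree w) (monom w a)"
  by (auto simp: homogeneous_def lookup_single when_def)

lemma homogeneous_zero: "homogeneous n 0"
  and homogeneous_add: "homogeneous n x \<Longrightarrow> homogeneous n y \<Longrightarrow> homogeneous n (x + y)"
  and homogeneous_diff: "homogeneous n x \<Longrightarrow> homogeneous n y \<Longrightarrow> homogeneous n (x - y)"
  by (auto simp: homogeneous_def lookup_add lookup_minus) (metis add_0 diff_self)+

lemma homogeneous_sum: "(\<And>s. s \<in> S \<Longrightarrow> homogeneous n (f s)) \<Longrightarrow> homogeneous n (sum f S)"
  by (induct S rule: infinite_finite_induct) (auto intro: homogeneous_add homogeneous_zero)

lemma homogeneous_mult:
  assumes "homogeneous n x" "homogeneous m y"
  shows "homogeneous (n + m) (x * y)"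
  unfolding homogeneous_def
proof (intro allI impI)
  fix w assume "Poly_Mapping.lookup (x * y) w \<noteq> 0"
  then have "w \<in> Poly_Mapping.keys (x * y)" by (simp add: in_keys_iff)
  then obtain u t where "w = u + t" "u \<in> Poly_Mapping.keys x" "t \<in> Poly_Mapping.keys y"
    using keys_mult[of x y] by blast
  then show "word_degree w = n + m"
    using assms by (simp add: homogeneous_def in_keys_iff plus_list_def word_degree_append)
qed

lemma homogeneous_generators:
  "homogeneous 0 (vtx v)" "homogeneous 1 (edge e)" "homogeneous (- 1) (ghost e)"
  using homogeneous_monom[of "[Vert v]" 1] homogeneous_monom[of "[Edge e]" 1] homogeneous_monom[of "[Ghost e]" 1]
  by (simp_all add: vtx_def edge_def ghost_def word_degree_def)

lemma homogeneous_edge_ghost: "homogeneous 0 (edge e * ghost f)" "homogeneous 0 (ghost e * edge f)"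
  using homogeneous_mult[OF homogeneous_generators(2,3)] homogeneous_mult[OF homogeneous_generators(3,2)] by simp_all

lemma homogeneous_relations: "r \<in> leavitt_relations E \<Longrightarrow> \<exists>n. homogeneous n r"
proof (induct rule: leavitt_relations.induct)
  case (vertex_idem v)
  show ?case using homogeneous_mult[OF homogeneous_generators(1,1)] homogeneous_generators(1)
    by (intro exI[of _ 0] homogeneous_diff) simp_all
next
  case (vertex_orth v w)
  show ?case by (rule exI, rule homogeneous_mult[OF homogeneous_generators(1,1)])
next
  case (source_edge e)
  show ?case using homogeneous_mult[OF homogeneous_generators(1,2)] homogeneous_generators(2)
    by (intro exI[of _ 1] homogeneous_diff) simp_all
next
  case (edge_range e)
  show ?case using homogeneous_mult[OF homogeneous_generators(2,1)] homogeneous_generators(2)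
    by (intro exI[of _ 1] homogeneous_diff) simp_all
next
  case (range_ghost e)
  show ?case using homogeneous_mult[OF homogeneous_generators(1,3)] homogeneous_generators(3)
    by (intro exI[of _ "- 1"] homogeneous_diff) simp_all
next
  case (ghost_source e)
  show ?case using homogeneous_mult[OF homogeneous_generators(3,1)] homogeneous_generators(3)
    by (intro exI[of _ "- 1"] homogeneous_diff) simp_all
next
  case (CK1_eq e)
  show ?case by (intro exI[of _ 0] homogeneous_diff homogeneous_edge_ghost homogeneous_generators)
next
  case (CK1_neq e f)
  show ?case by (rule exI, rule homogeneous_edge_ghost(2))
next
  case (CK2 v)
  show ?case by (intro exI[of _ 0] homogeneous_diff homogeneous_sum homogeneous_edge_ghost homogeneous_generators)
qed

text \<open>The elements all of whose components lie in the ideal form a Leavitt ideal themselves.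
  It contains the homogeneous generators, hence everything.\<close>

lemma component_in_gen:
  assumes wf: "wf_digraph E" and T: "T \<subseteq> augmentation_ideal" "\<And>t. t \<in> T \<Longrightarrow> \<exists>n. homogeneous n t"
    and x: "x \<in> leavitt_gen E T"
  shows "component n x \<in> leavitt_gen E T"
proof -
  let ?J = "leavitt_gen E T"
  have J: "leavitt_ideal E ?J" by (rule leavitt_ideal_gen[OF wf T(1)])
  then have id: "ring_ideal ?J" by (simp add: leavitt_ideal_def)
  note J' = ring_idealD[OF id]
  define K where "K = {x \<in> ?J. \<forall>n. component n x \<in> ?J}"
  have hom: "y \<in> K" if "y \<in> ?J" "homogeneous m y" for y m
    using that component_homogeneous[OF that(2)] J'(1) by (simp add: K_def)
  have "ring_ideal K"
    unfolding ring_ideal_def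
  proof (intro conjI ballI allI)
    show "0 \<in> K" by (simp add: K_def J')
    fix x y assume "x \<in> K" "y \<in> K"
    then show "x + y \<in> K" by (simp add: K_def J' component_add)
  next
    fix x r assume x: "x \<in> K"
    have "component n (r * x) \<in> ?J \<and> component n (x * r) \<in> ?J" for n
      by (induct r rule: poly_mapping_additive_induct)
        (use x in \<open>auto simp: K_def J' component_monom_mult component_mult_monom distrib_left distrib_right component_add\<close>)
    then show "r * x \<in> K" "x * r \<in> K" using x by (simp_all add: K_def J')
  qed
  moreover have "leavitt_relations E \<subseteq> K"
    using homogeneous_relations hom J unfolding leavitt_ideal_def by blast
  moreover have "monom [g] 1 \<in> K" if "g \<notin> generators E" for g
    using hom[OF _ homogeneous_monom] that J unfolding leavitt_ideal_def by blast
  moreover have "K \<subseteq> augmentation_ideal" using J by (auto simp: K_def leavitt_ideal_def)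
  ultimately have "leavitt_ideal E K" by (simp add: leavitt_ideal_def)
  moreover have "T \<subseteq> K" using hom T(2) leavitt_gen_superset by blast
  ultimately show ?thesis using leavitt_gen_least x unfolding K_def by blast
qed

section \<open>Degrees of polynomials in the cycle\<close>

context single_cycle
begin

lemma homogeneous_power:
  assumes "homogeneous m x"
  shows "homogeneous (int (Suc n) * m) (x ^ Suc n)"
proof (induct n)
  case (Suc n)
  from homogeneous_mult[OF assms Suc] show ?case by (simp add: algebra_simps)
qed (use assms in simp)

lemma homogeneous_cp: "homogeneous (i * int (length c)) (cp i)"
proof -
  have "homogeneous (int (length p)) (prod_list (map edge p) :: ('v, 'e, 'k) falg)"
    "homogeneous (- int (length p)) (prod_list (map ghost p) :: ('v, 'e, 'k) falg)" for p :: "'e list"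
  proof (induct p)
    case Nil
    show "homogeneous (int (length [])) (prod_list (map edge []) :: ('v, 'e, 'k) falg)"
      "homogeneous (- int (length [])) (prod_list (map ghost []) :: ('v, 'e, 'k) falg)"
      using homogeneous_monom[of "[] :: ('v, 'e) gen list" "1 :: 'k"]
      by (simp_all add: one_monom word_degree_def)
  next
    case (Cons e p)
    show "homogeneous (int (length (e # p))) (prod_list (map edge (e # p)) :: ('v, 'e, 'k) falg)"
      using homogeneous_mult[OF homogeneous_generators(2) Cons(1)] by simp
    show "homogeneous (- int (length (e # p))) (prod_list (map ghost (e # p)) :: ('v, 'e, 'k) falg)"
      using homogeneous_mult[OF homogeneous_generators(3) Cons(2)] by simp
  qed
  from this(1)[of c] this(2)[of "rev c"]
  have CD: "homogeneous (int (length c)) C" "homogeneous (- int (length c)) D" by simp_all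
  show ?thesis
  proof (cases i rule: int_trichotomy)
    case 1
    then show ?thesis by (simp add: cp_simps(1) homogeneous_generators)
  next
    case (2 n)
    then show ?thesis using homogeneous_power[OF CD(1), of n] by (simp only: cp_simps)
  next
    case (3 n)
    then show ?thesis using homogeneous_power[OF CD(2), of n] by (simp only: cp_simps minus_mult_commute)
  qed
qed

text \<open>As \<open>c\<close> has positive length, the terms of f(c) have different degrees, so
  each of them lies in \<open>I\<close>. A nonzero coefficient would then give \<open>v\<close>
  after multiplication by the inverse power of \<open>c\<close>.\<close>

lemma ev_in_graded:
  assumes graded: "\<And>x n. x \<in> I \<Longrightarrow> component n x \<in> I" and f: "ev f \<in> I"
  shows "f = 0"
proof (rule poly_mapping_eqI)
  fix j
  have len: "int (length c) > 0" using c_props(2) by simp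
  have "component n (scal a * x) = scal a * component n x" for n a and x :: "('v, 'e, 'k) falg"
    unfolding scal_def component_monom_mult by (simp add: word_degree_def)
  then have "component (j * int (length c)) (scal a * cp i) = (if i = j then scal a * cp i else 0)" for a i
    using component_homogeneous[OF homogeneous_cp, of "j * int (length c)" i] len by simp
  then have "component (j * int (length c)) (ev f) =
    (\<Sum>i\<in>Poly_Mapping.keys f. if i = j then scal (Poly_Mapping.lookup f i) * cp i else 0)"
    unfolding ev_def component_sum by simp
  also have "\<dots> = scal (Poly_Mapping.lookup f j) * cp j"
    by (simp add: sum.delta in_keys_iff scal_simps(3))
  finally have "scal (Poly_Mapping.lookup f j) * cp j \<in> I" using graded[OF f] by metis
  then have "scal (Poly_Mapping.lookup f j) * cp j * cp (- j) \<in> I" by (rule I_closed(4))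
  moreover have "scal (Poly_Mapping.lookup f j) * cp j * cp (- j) \<approx> scal (Poly_Mapping.lookup f j) * vtx v"
    using cg_mult_l[OF cp_mult[of j "- j"]] by (simp add: mult.assoc cp_simps(1))
  ultimately have *: "scal (Poly_Mapping.lookup f j) * vtx v \<in> I" using cg_in by blast
  show "Poly_Mapping.lookup f j = Poly_Mapping.lookup 0 j"
  proof (rule ccontr)
    assume "\<not> ?thesis"
    then have "scal (1 / Poly_Mapping.lookup f j) * (scal (Poly_Mapping.lookup f j) * vtx v) = vtx v"
      by (simp add: mult.assoc[symmetric] scal_simps(1)[symmetric] scal_simps(2))
    then have "vtx v \<in> I" using I_closed(3)[OF *] by metis
    then show False using vtx_H c_props(4) v_notin_H by blast
  qed
qed

end

section \<open>Cycles without K\<close>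

context leavitt_quotient
begin

lemma M_awalk: "w \<in> M E v \<longleftrightarrow> (\<exists>p. awalk w p v)"
  by (auto simp: M_def connects_def awalk_hd_in_verts)

lemma MT3_awalk:
  "MT3 E X \<longleftrightarrow> (\<forall>u\<in>X. \<forall>v\<in>X. \<exists>w\<in>X. (\<exists>p. awalk u p w) \<and> (\<exists>p. awalk v p w))"
  by (simp add: MT3_def connects_def)

text \<open>A walk from \<open>y\<close> that avoids \<open>H\<close> follows the exitless closed
  walk through \<open>y\<close>, so it can be completed to a full turn.\<close>

lemma Y_back:
  assumes "awalk y p w" "y \<in> Y" "w \<notin> H"
  shows "\<exists>z. awalk w z y"
  using assms
proof (induct p arbitrary: y)
  case Nil
  then show ?case by (intro exI[of _ "[]"]) (auto simp: awalk_Nil_iff)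
next
  case (Cons f p)
  then have f: "f \<in> arcs E" "tail E f = y" "awalk (head E f) p w" by (auto simp: awalk_Cons_iff)
  then have fA: "f \<in> Av y" using awalk_H Cons(4) by (auto simp: Av_iff)
  obtain q where q: "q \<noteq> []" "awalk y q y" "\<forall>e\<in>set q. Av (tail E e) = {e} \<and> tame (tail E e)"
    using Cons(3) by (auto simp: Y_def)
  obtain e q' where qe: "q = e # q'" using q(1) by (cases q) auto
  then have e: "tail E e = y" "awalk (head E e) q' y" using q(2) by (auto simp: awalk_Cons_iff)
  then have "f = e" using fA q(3) qe by auto
  have "head E f \<in> Y" using Y_arc[OF Cons(3)] fA by (metis singletonD)
  then obtain z where "awalk w z (head E f)" using Cons(1)[OF f(3)] Cons(4) by blast
  then show ?case using awalk_appendI e(2) \<open>f = e\<close> by blast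
qed

text \<open>By \<open>forced_walk\<close> a cycle based at a vertex of \<open>c\<close> follows the
  rotation of \<open>c\<close> that starts there. Neither can properly extend the other, because it
  would repeat its base.\<close>

lemma cycle_without_K_of_forced:
  assumes cyc: "cycle_based_at E v c" and v: "v \<notin> H" and fc: "\<forall>e\<in>set c. Av (tail E e) = {e} \<and> tame (tail E e)"
  shows "cycle_without_K E v c"
  unfolding cycle_without_K_def
proof (intro conjI ballI allI impI cyc)
  fix u c' assume "u \<in> set (map (tail E) c)" and c': "cycle_based_at E u c'"
  then obtain e where e: "e \<in> set c" "tail E e = u" by auto
  then obtain p1 p2 where c: "c = p1 @ e # p2" using split_list by fastforce
  have "awalk v (p1 @ e # p2) v" using cyc c by (simp add: cycle_based_at_def)
  then obtain y where "awalk v p1 y" "awalk y (e # p2) v" by (metis awalk_append_iff)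
  moreover from this have "y = u" using e(2) by (simp add: awalk_Cons_iff)
  ultimately have p: "awalk v p1 u" "awalk u (e # p2) v" by simp_all
  let ?r = "(e # p2) @ p1"
  have r: "awalk u ?r u" by (rule awalk_appendI[OF p(2,1)])
  have uH: "u \<notin> H" using awalk_H[OF p(2)] v by blast
  have c'w: "awalk u c' u" "c' \<noteq> []" "distinct (map (tail E) c')" using c' by (simp_all add: cycle_based_at_def)
  have rd: "distinct (map (tail E) ?r)" using cyc c by (auto simp: cycle_based_at_def)
  have sr: "set ?r = set c" using c by auto
  have nil: "s = []" if a: "awalk u a u" "a \<noteq> []" "awalk u (a @ s) u" "distinct (map (tail E) (a @ s))" for a s
  proof (cases s)
    case (Cons f s')
    have "awalk u s u" using a(1,3) by auto
    then have "tail E f = u" using Cons by (simp add: awalk_Cons_iff)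
    moreover obtain g a' where "a = g # a'" using a(2) by (cases a) auto
    moreover from this have "tail E g = u" using a(1) by (simp add: awalk_Cons_iff)
    ultimately show ?thesis using a(4) Cons by auto
  qed
  have "\<forall>e\<in>set ?r. Av (tail E e) = {e}" using fc sr by blast
  from forced_walk[OF c'w(1) uH r this] have "c' = ?r"
  proof
    assume "\<exists>s. c' = ?r @ s"
    then obtain s where s: "c' = ?r @ s" ..
    then show ?thesis using nil[OF r _ _, of s] c'w by simp
  next
    assume "\<exists>s. ?r = c' @ s"
    then obtain s where s: "?r = c' @ s" ..
    have "s = []" using nil[OF c'w(1,2), of s] r rd unfolding s by blast
    then show ?thesis using s by simp
  qed
  then show "set c' = set c" using sr by simp
qed

text \<open>All vertices outside \<open>H\<close> reach \<open>v\<close>, so an exit could be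
  continued to a second cycle through a vertex of \<open>c\<close>. With a single arc left, CK2 can
  fail only at a breaking vertex, which \<open>bre\<close> excludes.\<close>

lemma forced_of_cycle_without_K:
  assumes K: "cycle_without_K E v c" and M: "verts E - H = M E v"
    and bre: "\<And>w. w \<in> breaking_vertices E H \<Longrightarrow> bre w \<in> I"
  shows "\<forall>e\<in>set c. Av (tail E e) = {e} \<and> tame (tail E e)"
proof
  fix e assume e: "e \<in> set c"
  have c: "awalk v c v" "distinct (map (tail E) c)" using K by (simp_all add: cycle_without_K_def cycle_based_at_def)
  have vH: "v \<notin> H" using c(1) M M_awalk by blast
  obtain p1 p2 where c12: "c = p1 @ e # p2" using e split_list by fastforce
  have "awalk v (p1 @ e # p2) v" using c c12 by simp
  then obtain y where y: "awalk v p1 y" "awalk y (e # p2) v" by (metis awalk_append_iff)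
  then have p: "awalk v p1 (tail E e)" "awalk (tail E e) (e # p2) v" "e \<in> arcs E" "awalk (head E e) p2 v"
    by (auto simp: awalk_Cons_iff)
  have "e \<in> Av (tail E e)" using p awalk_H vH by (auto simp: Av_iff)
  moreover have "f = e" if f: "f \<in> Av (tail E e)" for f
  proof -
    have f': "f \<in> arcs E" "tail E f = tail E e" "head E f \<in> verts E - H" using f by (auto simp: Av_iff)
    then obtain z where "awalk (head E f) z v" using M M_awalk by blast
    then have "awalk (head E f) (z @ p1) (tail E e)" using p(1) awalk_appendI by blast
    then have "awalk (tail E e) (f # z @ p1) (tail E e)" using f' by (simp add: awalk_Cons_iff)
    from shorten_closed_walk[OF this] obtain q where q: "awalk (tail E e) (f # q) (tail E e)" "distinct (map (tail E) (f # q))"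
      by blast
    then have "cycle_based_at E (tail E e) (f # q)" by (simp add: cycle_based_at_def)
    moreover have "tail E e \<in> set (map (tail E) c)" using e by simp
    ultimately have "set (f # q) = set c" using K unfolding cycle_without_K_def by blast
    then have "f \<in> set c" by auto
    then show ?thesis using c(2) e f'(2) by (auto simp: distinct_map inj_on_def)
  qed
  ultimately have A: "Av (tail E e) = {e}" by blast
  have "tail E e \<in> verts E - H" using p(2) awalk_H vH by (auto simp: awalk_hd_in_verts)
  then have "tame (tail E e)" using A bre not_tame_cases[of "tail E e"] by (metis finite.simps insert_not_empty)
  then show "Av (tail E e) = {e} \<and> tame (tail E e)" using A by simp
qed

lemma path_span_empty: "path_span {} \<subseteq> I"
proof
  fix x assume "x \<in> path_span {}"
  then show "x \<in> I"
    by (induct rule: path_span_induct) (auto intro: cg_in[THEN iffD2] I_closed(2))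
qed

lemma vtx_up:
  assumes "ring_ideal A" "I \<subseteq> A" "vtx u \<in> A" "awalk u p w"
  shows "vtx w \<in> A"
proof -
  have "gst u p * vtx u * pth u p \<in> A" by (intro ring_idealD(3)[OF assms(1)] ring_idealD(4)[OF assms(1)] assms)
  moreover have "gst u p * vtx u * pth u p \<approx> vtx w"
    using cg_trans[OF cg_mult_r[OF gst_vtx] gst_pth[OF assms(4)]] .
  ultimately show ?thesis using cg_cong_ideal[OF assms(1,2)] by blast
qed

text \<open>Used for each ideal above \<open>I\<close>: it gains a vertex or a \<open>v^H\<close>,
  or else the reduction to exitless cycles applies to it.\<close>

lemma ideal_cases:
  assumes A: "leavitt_ideal E A" "I \<subseteq> A"
  obtains (vertex) w where "w \<in> verts E - H" "vtx w \<in> A"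
  | (breaking) w where "w \<in> breaking_vertices E H" "bre w \<in> A" "bre w \<notin> I"
  | (span) "A \<subseteq> path_span Y"
proof -
  have id: "ring_ideal A" "A \<subseteq> augmentation_ideal" using A(1) by (simp_all add: leavitt_ideal_def)
  consider w where "w \<in> verts E - H" "vtx w \<in> A" | w where "w \<in> breaking_vertices E H" "bre w \<in> A" "bre w \<notin> I"
    | "\<And>w. w \<in> verts E \<Longrightarrow> vtx w \<in> A \<Longrightarrow> w \<in> H" "\<And>w. w \<in> breaking_vertices E H \<Longrightarrow> bre w \<in> A \<Longrightarrow> bre w \<in> I"
    by blast
  then show ?thesis
  proof cases
    case 3
    interpret no_new_vertices E I A
      by unfold_locales (use 3 id A(2) H_vtx in auto)
    show ?thesis using that(3) in_path_span id(2) by blast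
  qed (use that in blast)+
qed

end

section \<open>Prime ideals\<close>

lemma leavitt_ideal_sum:
  assumes A: "leavitt_ideal E A" and Q: "leavitt_ideal E Q"
  shows "leavitt_ideal E {a + q |a q. a \<in> A \<and> q \<in> Q}" (is "leavitt_ideal E ?S")
    and "A \<subseteq> {a + q |a q. a \<in> A \<and> q \<in> Q}" "Q \<subseteq> {a + q |a q. a \<in> A \<and> q \<in> Q}"
proof -
  have idA: "ring_ideal A" and idQ: "ring_ideal Q" using A Q by (simp_all add: leavitt_ideal_def)
  note A' = ring_idealD[OF idA] and Q' = ring_idealD[OF idQ]
  show sub: "A \<subseteq> ?S" using Q'(1) by force
  show "Q \<subseteq> ?S" using A'(1) by force
  have "ring_ideal ?S"
    unfolding ring_ideal_def
  proof (intro conjI ballI allI)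
    show "0 \<in> ?S" using sub A'(1) by blast
    fix x y assume "x \<in> ?S" "y \<in> ?S"
    then obtain a q b r where "x = a + q" "a \<in> A" "q \<in> Q" "y = b + r" "b \<in> A" "r \<in> Q" by blast
    then have "x + y = (a + b) + (q + r)" "a + b \<in> A" "q + r \<in> Q" using A'(2) Q'(2) by (simp_all add: add_ac)
    then show "x + y \<in> ?S" by blast
  next
    fix x r assume "x \<in> ?S"
    then obtain a q where x: "x = a + q" "a \<in> A" "q \<in> Q" by blast
    then have "r * x = r * a + r * q" "r * a \<in> A" "r * q \<in> Q" using A'(3) Q'(3) by (simp_all add: distrib_left)
    then show "r * x \<in> ?S" by blast
    have "x * r = a * r + q * r" "a * r \<in> A" "q * r \<in> Q" using x A'(4) Q'(4) by (simp_all add: distrib_right)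
    then show "x * r \<in> ?S" by blast
  qed
  moreover have "?S \<subseteq> augmentation_ideal"
  proof
    fix x assume "x \<in> ?S"
    then obtain a q where x: "x = a + q" "a \<in> A" "q \<in> Q" by blast
    then have "a \<in> augmentation_ideal" "q \<in> augmentation_ideal" using A Q unfolding leavitt_ideal_def by blast+
    then show "x \<in> augmentation_ideal" unfolding x(1) by (rule augmentation_closed(2))
  qed
  ultimately show "leavitt_ideal E ?S"
    using A sub unfolding leavitt_ideal_def by blast
qed

text \<open>Adding \<open>Q\<close> to both ideals keeps their products inside \<open>Q\<close>, so
  only ideals above \<open>Q\<close> have to be tested.\<close>

lemma leavitt_primeI:
  assumes Q: "leavitt_ideal E Q" "Q \<noteq> augmentation_ideal"
    and pr: "\<And>A B. leavitt_ideal E A \<Longrightarrow> leavitt_ideal E B \<Longrightarrow> Q \<subseteq> A \<Longrightarrow> Q \<subseteq> B \<Longrightarrow> \<not> A \<subseteq> Q \<Longrightarrow> \<not> B \<subseteq> Q \<Longrightarrow>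
      \<exists>a\<in>A. \<exists>b\<in>B. a * b \<notin> Q"
  shows "leavitt_prime E Q"
proof -
  have id: "ring_ideal Q" using Q(1) unfolding leavitt_ideal_def by (rule conjunct1)
  note Q' = ring_idealD[OF id]
  have "A \<subseteq> Q \<or> B \<subseteq> Q"
    if A: "leavitt_ideal E A" and B: "leavitt_ideal E B" and ab: "\<forall>a\<in>A. \<forall>b\<in>B. a * b \<in> Q" for A B
  proof (rule ccontr)
    assume n: "\<not> (A \<subseteq> Q \<or> B \<subseteq> Q)"
    note SA = leavitt_ideal_sum[OF A Q(1)] and SB = leavitt_ideal_sum[OF B Q(1)]
    have nA: "\<not> {a + q |a q. a \<in> A \<and> q \<in> Q} \<subseteq> Q"
    proof
      assume "{a + q |a q. a \<in> A \<and> q \<in> Q} \<subseteq> Q"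
      from subset_trans[OF SA(2) this] n show False by (simp only: simp_thms)
    qed
    have nB: "\<not> {b + q |b q. b \<in> B \<and> q \<in> Q} \<subseteq> Q"
    proof
      assume "{b + q |b q. b \<in> B \<and> q \<in> Q} \<subseteq> Q"
      from subset_trans[OF SB(2) this] n show False by (simp only: simp_thms)
    qed
    from pr[OF SA(1) SB(1) SA(3) SB(3) nA nB] obtain x y
      where xy: "x \<in> {a + q |a q. a \<in> A \<and> q \<in> Q}" "y \<in> {b + q |b q. b \<in> B \<and> q \<in> Q}" "x * y \<notin> Q"
      by (elim bexE)
    then obtain a q b r where e: "x = a + q" "a \<in> A" "q \<in> Q" "y = b + r" "b \<in> B" "r \<in> Q" by blast
    have "x * y = a * b + (a * r + q * y)" by (simp add: e(1,4) algebra_simps)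
    moreover have "a * b + (a * r + q * y) \<in> Q" using ab e by (intro Q'(2) Q'(3)[of r] Q'(4)[of q]) auto
    ultimately show False using xy(3) by simp
  qed
  then show ?thesis unfolding leavitt_prime_def using Q by (intro conjI allI impI) assumption+
qed

text \<open>The elementwise form of primeness. Instead of describing the ideals generated by
  \<open>a\<close> and \<open>b\<close>, the proof takes the largest candidates: everything that
  annihilates \<open>b\<close> modulo \<open>Q\<close> through all \<open>x\<close>, and everything
  annihilated in this way by those elements.\<close>

lemma leavitt_primeD:
  assumes "leavitt_prime E Q" "a \<in> augmentation_ideal" "b \<in> augmentation_ideal" "\<And>x. a * x * b \<in> Q"
  shows "a \<in> Q \<or> b \<in> Q"
proof -
  have Q: "leavitt_ideal E Q" and pr: "\<And>A B. leavitt_ideal E A \<Longrightarrow> leavitt_ideal E B \<Longrightarrow>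
      (\<forall>a\<in>A. \<forall>b\<in>B. a * b \<in> Q) \<Longrightarrow> A \<subseteq> Q \<or> B \<subseteq> Q"
    using assms(1) unfolding leavitt_prime_def by auto
  have id: "ring_ideal Q" "Q \<subseteq> augmentation_ideal" using Q by (simp_all add: leavitt_ideal_def)
  note Q' = ring_idealD[OF id(1)]
  define A where "A = {y \<in> augmentation_ideal. \<forall>x. y * x * b \<in> Q}"
  define B where "B = {z \<in> augmentation_ideal. \<forall>y\<in>A. \<forall>x. y * x * z \<in> Q}"
  have "ring_ideal A"
    unfolding ring_ideal_def
  proof (intro conjI ballI allI)
    show "0 \<in> A" by (simp add: A_def Q' augmentation_closed)
    fix x y assume "x \<in> A" "y \<in> A"
    then show "x + y \<in> A" by (simp add: A_def Q' augmentation_closed distrib_right)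
  next
    fix x r assume x: "x \<in> A"
    then have "r * (x * z * b) \<in> Q" "x * (r * z) * b \<in> Q" for z using Q'(3) by (simp_all add: A_def)
    then show "r * x \<in> A" "x * r \<in> A" using x by (simp_all add: A_def augmentation_closed mult.assoc)
  qed
  moreover have "Q \<subseteq> A" using id(2) Q' by (auto simp: A_def)
  ultimately have A: "leavitt_ideal E A" using Q unfolding leavitt_ideal_def A_def by blast
  have "ring_ideal B"
    unfolding ring_ideal_def
  proof (intro conjI ballI allI)
    show "0 \<in> B" by (simp add: B_def Q' augmentation_closed)
    fix x y assume "x \<in> B" "y \<in> B"
    then show "x + y \<in> B" by (simp add: B_def Q' augmentation_closed distrib_left)
  next
    fix z r assume z: "z \<in> B"
    have "y * (x * r) * z \<in> Q" "y * x * z * r \<in> Q" if "y \<in> A" for x y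
      using z that Q'(4) by (simp_all add: B_def)
    then show "r * z \<in> B" "z * r \<in> B" using z by (simp_all add: B_def augmentation_closed mult.assoc)
  qed
  moreover have "Q \<subseteq> B" using id(2) Q' by (auto simp: B_def)
  ultimately have B: "leavitt_ideal E B" using Q unfolding leavitt_ideal_def B_def by blast
  have "\<forall>y\<in>A. \<forall>z\<in>B. y * z \<in> Q"
  proof (intro ballI)
    fix y z assume "y \<in> A" "z \<in> B"
    \<comment> \<open>Here \<open>x\<close> ranges over the unital algebra, so 1 is allowed.\<close>
    then have "y * 1 * z \<in> Q" unfolding B_def by blast
    then show "y * z \<in> Q" by simp
  qed
  then have "A \<subseteq> Q \<or> B \<subseteq> Q" by (rule pr[OF A B])
  moreover have "a \<in> A" "b \<in> B" using assms(2-4) by (simp_all add: A_def B_def)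
  ultimately show ?thesis by blast
qed

context leavitt_quotient
begin

lemma vtx_in_augmentation: "(vtx v :: ('v, 'e, 'k) falg) \<in> augmentation_ideal"
  by (simp add: vtx_def monom_in_augmentation)

lemma edge_ghost_in_augmentation: "edge e * ghost f \<in> augmentation_ideal"
  by (simp add: edge_def ghost_def monom_mult monom_in_augmentation)

lemma bre_in_augmentation: "bre v \<in> augmentation_ideal"
  unfolding bre_def
  by (intro augmentation_closed(6) vtx_in_augmentation ring_ideal_sum ring_ideal_augmentation edge_ghost_in_augmentation)

lemma homogeneous_bre: "homogeneous 0 (bre v)"
  unfolding bre_def by (intro homogeneous_diff homogeneous_sum homogeneous_edge_ghost homogeneous_generators)

abbreviation gens :: "'v set \<Rightarrow> ('v, 'e, 'k) falg set" where
  "gens S \<equiv> vtx ` H \<union> bre ` S"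

lemma gens_in_augmentation: "gens S \<subseteq> augmentation_ideal"
  by (auto intro: vtx_in_augmentation bre_in_augmentation)

lemma I_leavitt: "ring_ideal I" "I \<subseteq> augmentation_ideal"
  using leavitt_ideal by (simp_all add: leavitt_ideal_def)

text \<open>Some monomial pq^* of \<open>y\<close> survives between \<open>x\<close> and
  \<open>z\<close>, and its two walks meet outside \<open>H\<close>. In this way nonzero products
  become walks in the graph.\<close>

lemma connecting_walks:
  assumes "y \<in> augmentation_ideal" "x * y * z \<notin> I"
  shows "\<exists>u p u' q w. awalk u p w \<and> awalk u' q w \<and> w \<notin> H \<and> x * pth u p \<notin> I \<and> gst u' q * z \<notin> I"
proof (rule ccontr)
  assume no: "\<not> ?thesis"
  obtain d t where t: "t \<in> add_span (std UNIV d)" "y \<approx> t" by (rule augmentation_std[OF assms(1)])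
  have "x * t * z \<in> I"
    using t(1)
  proof induct
    case zero
    then show ?case by (simp add: I_closed)
  next
    case (base s)
    then obtain k u p u' q w where s: "awalk u p w" "awalk u' q w" "s = scal k * (pth u p * gst u' q)"
      unfolding std_def by blast
    have eq: "x * s * z = scal k * ((x * pth u p) * (gst u' q * z))"
      unfolding s(3) by (simp add: mult.assoc scal_left_commute)
    consider "w \<in> H" | "x * pth u p \<in> I" | "gst u' q * z \<in> I" using no s by blast
    then show ?case
    proof cases
      case 1
      then have "x * pth u p \<in> I" using pth_H[OF s(1)] I_closed(3) by blast
      then show ?thesis unfolding eq by (rule I_closed(3)[OF I_closed(4)])
    next
      case 2
      then show ?thesis unfolding eq by (rule I_closed(3)[OF I_closed(4)])
    next
      case 3
      then show ?thesis unfolding eq by (rule I_closed(3)[OF I_closed(3)])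
    qed
  next
    case (add s t)
    then show ?case by (simp add: distrib_left distrib_right I_closed)
  qed
  moreover have "x * y * z \<approx> x * t * z" by (intro cg_mult_l cg_mult_r t)
  ultimately show False using assms(2) cg_in by blast
qed

text \<open>Since \<open>bre v\<close> annihilates every arc at \<open>v\<close>, only the empty
  walk at \<open>v\<close> can stand to its right.\<close>

lemma bre_pth_nonzero:
  assumes "finite (Av v)" "awalk u p w" "bre v * pth u p \<notin> I"
  shows "u = v \<and> p = []"
proof -
  have "u = v"
  proof (rule ccontr)
    assume "u \<noteq> v"
    have "bre v * pth u p \<approx> (bre v * vtx v) * pth u p" by (rule cg_mult_r[OF cg_sym[OF bre_vtx]])
    also have "\<dots> = bre v * (vtx v * pth u p)" by (simp add: mult.assoc)
    also have "\<dots> \<approx> 0" using \<open>u \<noteq> v\<close> by (intro cg_mult_0(2)[OF vtx_pth_0]) simp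
    finally show False using assms(3) by (simp add: cg_0)
  qed
  then show ?thesis using bre_pth[OF assms(1), of p w] assms(2,3) by blast
qed

lemma ghost_bre_nonzero:
  assumes "finite (Av v)" "awalk u q w" "gst u q * bre v \<notin> I"
  shows "u = v \<and> q = []"
proof -
  have u: "u = v"
  proof (rule ccontr)
    assume "u \<noteq> v"
    have "gst u q * bre v \<approx> gst u q * (vtx v * bre v)" by (rule cg_mult_l[OF cg_sym[OF vtx_bre]])
    also have "\<dots> = (gst u q * vtx v) * bre v" by (simp add: mult.assoc)
    also have "\<dots> \<approx> 0" using \<open>u \<noteq> v\<close> by (intro cg_mult_0(1)[OF gst_vtx_0]) simp
    finally show False using assms(3) by (simp add: cg_0)
  qed
  have "q = []"
  proof (cases q)
    case (Cons e q')
    then have e: "e \<in> arcs E" "tail E e = v" using assms(2) u by (auto simp: awalk_Cons_iff)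
    have "ghost e * bre v \<approx> 0"
    proof (cases "e \<in> Av v")
      case True
      then show ?thesis unfolding bre_cut using assms(1) e by (intro ghost_cut)
    next
      case False
      then have "vtx (head E e) * ghost e \<approx> 0" using e by (intro cg_mult_0(1)) (auto simp: Av_iff cg_0 H_vtx)
      then have "ghost e \<approx> 0" using cg_trans[OF cg_sym[OF vtx_ghost]] by blast
      then show ?thesis by (rule cg_mult_0(1))
    qed
    then have g0: "gst (head E e) q' * (ghost e * bre v) \<approx> 0" by (rule cg_mult_0(2))
    have "gst u q * bre v \<approx> (gst (head E e) q' * ghost e) * bre v"
      unfolding Cons u by (rule cg_mult_r[OF gst_Cons[OF e(2)]])
    also have "\<dots> = gst (head E e) q' * (ghost e * bre v)" by (simp only: mult.assoc)
    also have "\<dots> \<approx> 0" by (rule g0)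
    finally have "gst u q * bre v \<approx> 0" .
    then show ?thesis using assms(3) by (simp add: cg_0)
  qed
  with u show ?thesis by simp
qed

lemma breaking_finite: "v \<in> breaking_vertices E H \<Longrightarrow> finite (Av v)"
  by (simp add: breaking_vertices_def)

text \<open>MT-3 gives a vertex reached from both \<open>w\<close> and \<open>v\<close>; whatever an
  exitless cycle reaches outside \<open>H\<close> leads back to \<open>v\<close>.\<close>

lemma cycle_connected:
  assumes "MT3 E (verts E - H)" "v \<in> Y" "w \<in> verts E - H"
  shows "\<exists>z. awalk w z v"
proof -
  have "v \<in> verts E - H" using Y_verts assms(2) by blast
  then obtain x p p' where x: "x \<in> verts E - H" "awalk w p x" "awalk v p' x"
    using assms(1,3) unfolding MT3_awalk by blast
  then obtain z where "awalk x z v" using Y_back assms(2) by blast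
  then show ?thesis using awalk_appendI x(2) by blast
qed

lemma single_cycleI:
  assumes "v \<in> Y" "\<And>w. w \<in> verts E - H \<Longrightarrow> \<exists>z. awalk w z v"
  shows "\<exists>c. single_cycle E I v c"
proof -
  obtain c where c: "cycle_based_at E v c" "\<forall>e\<in>set c. Av (tail E e) = {e} \<and> tame (tail E e)"
    using Y_cycle[OF assms(1)] by blast
  have "single_cycle E I v c"
    by unfold_locales (use c assms Y_verts in auto)
  then show ?thesis ..
qed

section \<open>From the three conditions to primeness\<close>

lemma nonzero_polynomial:
  assumes sc: "single_cycle E I v c" and A: "leavitt_ideal E A" "I \<subseteq> A" "\<not> A \<subseteq> I"
    and bre: "\<forall>w\<in>breaking_vertices E H. bre w \<in> I"
  shows "\<exists>f. single_cycle.ev v c f \<in> A \<and> single_cycle.ev v c f \<notin> I"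
proof -
  interpret single_cycle E I v c by fact
  have idA: "ring_ideal A" using A(1) by (simp add: leavitt_ideal_def)
  from A(1,2) show ?thesis
  proof (cases rule: ideal_cases)
    case (vertex w)
    then obtain z where "awalk w z v" using connected by blast
    then have "ev 1 \<in> A" using vtx_up[OF idA A(2) vertex(2)] by (simp add: ev_one)
    moreover have "ev 1 \<notin> I" using v_notin_H c_props(4) vtx_H by (auto simp: ev_one)
    ultimately show ?thesis by blast
  next
    case (breaking w)
    then show ?thesis using bre by blast
  next
    case span
    obtain a where a: "a \<in> A" "a \<notin> I" using A(3) by blast
    have "a \<in> path_span Y" "a \<in> augmentation_ideal" using a(1) span A(1) by (auto simp: leavitt_ideal_def)
    from polynomial_in_ideal[OF idA A(2) I_leavitt(1) order_refl a this] show ?thesis by metis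
  qed
qed

text \<open>Without exitless cycles two larger ideals both contain new vertices, and by MT-3 a
  common one. With such a cycle they contain f(c) and g(c) outside \<open>I\<close>. The product is
  outside as well, because Laurent polynomials form a domain and the graded ideal \<open>I\<close>
  contains no nonzero polynomial in \<open>c\<close>.\<close>

lemma prime_of_graded:
  assumes ne: "I \<noteq> augmentation_ideal" and gen: "I = leavitt_gen E (gens (breaking_vertices E H))"
    and mt: "MT3 E (verts E - H)"
  shows "leavitt_prime E I"
proof (rule leavitt_primeI[OF leavitt_ideal ne])
  have bre: "bre w \<in> I" if "w \<in> breaking_vertices E H" for w
    using that leavitt_gen_superset[of "gens (breaking_vertices E H)" E, folded gen] by blast
  then have breB: "\<forall>w\<in>breaking_vertices E H. bre w \<in> I" ..
  fix A B assume A: "leavitt_ideal E A" "I \<subseteq> A" "\<not> A \<subseteq> I" and B: "leavitt_ideal E B" "I \<subseteq> B" "\<not> B \<subseteq> I"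
  show "\<exists>a\<in>A. \<exists>b\<in>B. a * b \<notin> I"
  proof (cases "Y = {}")
    case True
    have vert: "\<exists>w\<in>verts E - H. vtx w \<in> A" if "leavitt_ideal E A" "I \<subseteq> A" "\<not> A \<subseteq> I" for A
      using that(1,2)
    proof (cases rule: ideal_cases)
      case span
      then show ?thesis using True path_span_empty that(3) by auto
    qed (use bre in auto)
    from vert[OF A] obtain w1 where w1: "w1 \<in> verts E - H" "vtx w1 \<in> A" by (rule bexE)
    from vert[OF B] obtain w2 where w2: "w2 \<in> verts E - H" "vtx w2 \<in> B" by (rule bexE)
    from mt[unfolded MT3_awalk, rule_format, OF w1(1) w2(1)]
    obtain w p q where x: "w \<in> verts E - H" "awalk w1 p w" "awalk w2 q w" by blast
    have "ring_ideal A" "ring_ideal B" using A(1) B(1) by (simp_all add: leavitt_ideal_def)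
    then have "vtx w \<in> A" "vtx w \<in> B"
      using vtx_up[OF _ A(2) w1(2) x(2)] vtx_up[OF _ B(2) w2(2) x(3)] by blast+
    moreover have "vtx w * vtx w \<notin> I" using cg_in[OF vtx_idem[of w]] vtx_H x(1) by blast
    ultimately show ?thesis by blast
  next
    case False
    then obtain v where v: "v \<in> Y" by blast
    from single_cycleI[OF v cycle_connected[OF mt v]] obtain c where sc: "single_cycle E I v c" by (rule exE)
    interpret single_cycle E I v c by fact
    from nonzero_polynomial[OF sc A breB] obtain f where f: "ev f \<in> A" "ev f \<notin> I" by (elim exE conjE)
    from nonzero_polynomial[OF sc B breB] obtain g where g: "ev g \<in> B" "ev g \<notin> I" by (elim exE conjE)
    have homT: "\<exists>n. homogeneous n t" if "t \<in> gens (breaking_vertices E H)" for t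
    proof -
      have "homogeneous 0 t" using that by (auto intro: homogeneous_generators homogeneous_bre)
      then show ?thesis ..
    qed
    have graded: "component n x \<in> I" if "x \<in> I" for x n
      by (rule component_in_gen[OF wf_digraph_axioms gens_in_augmentation, of "breaking_vertices E H", folded gen]) (erule homT, rule that)
    have "ev f * ev g \<notin> I"
    proof
      assume "ev f * ev g \<in> I"
      then have "ev (f * g) \<in> I" using cg_in[OF ev_mult] by blast
      with graded have "f * g = 0" by (rule ev_in_graded)
      then have "f = 0 \<or> g = 0" by simp
      then show False using f g ev_zero I_closed(1) by metis
    qed
    then show ?thesis using f g by blast
  qed
qed

lemma M_iff:
  assumes "verts E - H = M E u"
  shows "w \<in> verts E - H \<longleftrightarrow> (\<exists>p. awalk w p u)"
  unfolding assms by (rule M_awalk)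

lemma MT3_of_M:
  assumes "verts E - H = M E u"
  shows "MT3 E (verts E - H)"
  unfolding MT3_awalk
proof (intro ballI)
  fix a b assume "a \<in> verts E - H" "b \<in> verts E - H"
  then obtain p q where pq: "awalk a p u" "awalk b q u" unfolding M_iff[OF assms] by blast
  then have "awalk u [] u" by (auto simp: awalk_Nil_iff)
  then have "u \<in> verts E - H" unfolding M_iff[OF assms] ..
  then show "\<exists>w\<in>verts E - H. (\<exists>p. awalk a p w) \<and> (\<exists>p. awalk b p w)" using pq by blast
qed

text \<open>Every strictly larger ideal contains the idempotent \<open>bre u\<close>: a new vertex
  reaches \<open>u\<close>, all other \<open>v^H\<close> are in \<open>I\<close> already, and an
  exitless cycle would reach \<open>u\<close> and make it tame. The case
  \<open>bre u \<in> I\<close> is not refuted but reduced to \<open>prime_of_graded\<close>.\<close>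

lemma prime_of_breaking:
  assumes ne: "I \<noteq> augmentation_ideal" and u: "u \<in> breaking_vertices E H"
    and gen: "I = leavitt_gen E (gens (breaking_vertices E H - {u}))"
    and M: "verts E - H = M E u"
  shows "leavitt_prime E I"
proof (cases "bre u \<in> I")
  case True
  have "gens (breaking_vertices E H) \<subseteq> I"
  proof -
    have "gens (breaking_vertices E H - {u}) \<subseteq> I"
      by (rule leavitt_gen_superset[of "gens (breaking_vertices E H - {u})" E, folded gen])
    then show ?thesis using True by blast
  qed
  then have "leavitt_gen E (gens (breaking_vertices E H)) \<subseteq> I" by (rule leavitt_gen_least[OF leavitt_ideal])
  moreover have "I \<subseteq> leavitt_gen E (gens (breaking_vertices E H))"
  proof (rule leavitt_gen_least[OF leavitt_ideal_gen[OF wf_digraph_axioms], of _ "gens (breaking_vertices E H - {u})", folded gen])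
    show "gens (breaking_vertices E H) \<subseteq> augmentation_ideal" by (rule gens_in_augmentation)
    show "gens (breaking_vertices E H - {u}) \<subseteq> leavitt_gen E (gens (breaking_vertices E H))"
      using leavitt_gen_superset[of "gens (breaking_vertices E H)" E] by blast
  qed
  ultimately have "I = leavitt_gen E (gens (breaking_vertices E H))" by (rule equalityI[rotated])
  then show ?thesis by (rule prime_of_graded[OF ne _ MT3_of_M[OF M]])
next
  case False
  have bre: "w = u" if "w \<in> breaking_vertices E H" "bre w \<notin> I" for w
    using that leavitt_gen_superset[of "gens (breaking_vertices E H - {u})" E, folded gen] by blast
  have uin: "bre u \<in> A" if A: "leavitt_ideal E A" "I \<subseteq> A" "\<not> A \<subseteq> I" for A
    using A(1,2)
  proof (cases rule: ideal_cases)
    case (vertex w)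
    have idA: "ring_ideal A" using A(1) by (simp add: leavitt_ideal_def)
    obtain z where "awalk w z u" using vertex(1) M_iff[OF M] by blast
    then have "vtx u \<in> A" using vtx_up[OF idA A(2) vertex(2)] by blast
    then have "bre u * vtx u \<in> A" by (rule ring_idealD(3)[OF idA])
    then show ?thesis using cg_cong_ideal[OF idA A(2) bre_vtx] by blast
  next
    case (breaking w)
    then show ?thesis using bre by blast
  next
    case span
    have "Y = {}"
    proof (rule ccontr)
      assume "Y \<noteq> {}"
      then obtain y where y: "y \<in> Y" by blast
      then obtain z where "awalk y z u" using Y_verts[OF y] M_iff[OF M, of y] by blast
      moreover have "u \<notin> H" using u by (simp add: breaking_vertices_def)
      ultimately have "u \<in> Y" using Y_awalk y by blast
      then have "tame u" by (rule Y_arc)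
      then show False using False by (simp add: tame_def)
    qed
    then show ?thesis using span path_span_empty A(3) by auto
  qed
  have "bre u * bre u \<notin> I" using cg_in[OF bre_idem[OF breaking_finite[OF u]]] False by blast
  then show ?thesis using uin by (intro leavitt_primeI[OF leavitt_ideal ne]) blast
qed

text \<open>A larger ideal contains some g(c) outside \<open>I\<close>, so \<open>f\<close> does not
  divide \<open>g\<close>, and a Bezout identity puts \<open>v\<close> into that ideal. Two larger
  ideals thus share the idempotent \<open>v\<close>.\<close>

lemma prime_of_cycle:
  assumes ne: "I \<noteq> augmentation_ideal" and K: "cycle_without_K E v c" and M: "verts E - H = M E v"
    and f: "irreducible f"
    and gen: "I = leavitt_gen E (gens (breaking_vertices E H) \<union>
      {\<Sum>i\<in>Poly_Mapping.keys f. scal (Poly_Mapping.lookup f i) * cycle_power v c i})"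
  shows "leavitt_prime E I"
proof (rule leavitt_primeI[OF leavitt_ideal ne])
  have sub: "gens (breaking_vertices E H) \<union>
      {\<Sum>i\<in>Poly_Mapping.keys f. scal (Poly_Mapping.lookup f i) * cycle_power v c i} \<subseteq> I"
    by (rule leavitt_gen_superset[of "gens (breaking_vertices E H) \<union>
      {\<Sum>i\<in>Poly_Mapping.keys f. scal (Poly_Mapping.lookup f i) * cycle_power v c i}" E, folded gen])
  have bre: "bre w \<in> I" if "w \<in> breaking_vertices E H" for w
    using that sub by blast
  then have breB: "\<forall>w\<in>breaking_vertices E H. bre w \<in> I" ..
  have v: "v \<in> verts E" using K by (auto simp: cycle_without_K_def cycle_based_at_def awalk_hd_in_verts)
  then have "awalk v [] v" by (simp add: awalk_Nil_iff)
  then have vH: "v \<notin> H" using M_iff[OF M, of v] by blast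
  have conn: "\<exists>z. awalk w z v" if "w \<in> verts E - H" for w using that M_iff[OF M] by blast
  have sc: "single_cycle E I v c"
    by unfold_locales
      (use K vH forced_of_cycle_without_K[OF K M bre] conn in \<open>simp_all add: cycle_without_K_def\<close>)
  interpret single_cycle E I v c by fact
  have fI: "ev f \<in> I" unfolding ev_def using sub by blast
  have vin: "vtx v \<in> A" if A: "leavitt_ideal E A" "I \<subseteq> A" "\<not> A \<subseteq> I" for A
  proof -
    have idA: "ring_ideal A" using A(1) by (simp add: leavitt_ideal_def)
    note lA = ev_ideal[OF idA A(2)]
    from nonzero_polynomial[OF sc A breB] obtain g where g: "ev g \<in> A" "ev g \<notin> I" by (elim exE conjE)
    have "\<not> f dvd g"
    proof
      assume "f dvd g"
      then obtain h where "g = h * f" by (metis dvdE mult.commute)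
      then have "ev g \<approx> ev h * ev f" using ev_mult by blast
      then show False using g(2) cg_in I_closed(3)[OF fI] by blast
    qed
    then obtain a b where ab: "a * f + b * g = 1" using irreducible_laurent_coprime[OF f] by metis
    have "a * f \<in> {f. ev f \<in> A}" "b * g \<in> {f. ev f \<in> A}"
      using lA g(1) fI A(2) unfolding laurent_ideal_def by blast+
    then have "1 \<in> {f. ev f \<in> A}" using lA unfolding ab[symmetric] laurent_ideal_def by blast
    then show ?thesis by (simp add: ev_one)
  qed
  have "vtx v * vtx v \<notin> I" using cg_in[OF vtx_idem[of v]] vtx_H v vH by blast
  then show "\<exists>a\<in>A. \<exists>b\<in>B. a * b \<notin> I"
    if "leavitt_ideal E A" "leavitt_ideal E B" "I \<subseteq> A" "I \<subseteq> B" "\<not> A \<subseteq> I" "\<not> B \<subseteq> I" for A B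
    using vin that by blast
qed

end

lemma prod_list_letters:
  "prod_list (map edge p) = (monom (map Edge p) 1 :: ('v, 'e, 'k::field) falg)"
  "prod_list (map ghost p) = (monom (map Ghost p) 1 :: ('v, 'e, 'k::field) falg)"
  by (induct p) (simp_all add: one_monom edge_def ghost_def monom_mult)

lemma monom_power: "monom w 1 ^ n = (monom (concat (replicate n w)) 1 :: ('v, 'e, 'k::field) falg)"
  by (induct n) (simp_all add: one_monom monom_mult)

lemma cycle_power_carrier:
  assumes "v \<in> verts E" "set c \<subseteq> arcs E" "c \<noteq> []"
  shows "(cycle_power v c i :: ('v, 'e, 'k::field) falg) \<in> carrier (free_algebra E)"
proof -
  have *: "(monom w 1 :: ('v, 'e, 'k) falg) \<in> carrier (free_algebra E)" if "w \<noteq> []" "set w \<subseteq> generators E" for w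
    using that by (simp add: carrier_free_algebra monom_in_augmentation restr_monom)
  have pow: "(monom w 1 :: ('v, 'e, 'k) falg) ^ n \<in> carrier (free_algebra E)"
    if "w \<noteq> []" "set w \<subseteq> generators E" "n > 0" for w n
    unfolding monom_power using that by (intro *) auto
  have "set (map Edge c) \<subseteq> generators E" "set (map Ghost (rev c)) \<subseteq> generators E" "set [Vert v] \<subseteq> generators E"
    using assms by (auto simp: generators_def)
  then show ?thesis
    using assms(3) unfolding cycle_power_def prod_list_letters vtx_def by (auto intro!: * pow)
qed

section \<open>From primeness to the three conditions\<close>

context leavitt_quotient
begin

text \<open>Primeness makes some product axb nonzero modulo \<open>I\<close>. Inserting the left
  unit of \<open>b\<close> gives a middle factor without constant term, as
  \<open>connecting_walks\<close> requires.\<close>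

lemma prime_connecting_walks:
  assumes "leavitt_prime E I" "a \<in> augmentation_ideal" "b \<in> augmentation_ideal" "a \<notin> I" "b \<notin> I"
    and "vtx v * b \<approx> b"
  shows "\<exists>u p u' q w. awalk u p w \<and> awalk u' q w \<and> w \<notin> H \<and> a * pth u p \<notin> I \<and> gst u' q * b \<notin> I"
proof -
  obtain x where x: "a * x * b \<notin> I" using leavitt_primeD[OF assms(1-3)] assms(4,5) by blast
  have "a * (x * vtx v) * b = a * x * (vtx v * b)" by (simp add: mult.assoc)
  also have "\<dots> \<approx> a * x * b" by (rule cg_mult_l[OF assms(6)])
  finally have "a * (x * vtx v) * b \<notin> I" using x cg_in by blast
  then show ?thesis
    using connecting_walks augmentation_closed(3)[OF vtx_in_augmentation] by blast
qed

text \<open>The walks obtained for two vertices start at these vertices and meet outside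
  \<open>H\<close>.\<close>

lemma prime_MT3:
  assumes "leavitt_prime E I"
  shows "MT3 E (verts E - H)"
  unfolding MT3_awalk
proof (intro ballI)
  fix u v assume uv: "u \<in> verts E - H" "v \<in> verts E - H"
  then have "vtx u \<notin> I" "vtx v \<notin> I" using vtx_H by auto
  then obtain a p b q w where w: "awalk a p w" "awalk b q w" "w \<notin> H" "vtx u * pth a p \<notin> I" "gst b q * vtx v \<notin> I"
    using prime_connecting_walks[OF assms vtx_in_augmentation vtx_in_augmentation _ _ vtx_idem] by blast
  have "a = u" using w(4) vtx_pth_0[of u a p] by (auto simp: cg_0)
  moreover have "b = v" using w(5) gst_vtx_0[of v b q] by (auto simp: cg_0)
  ultimately show "\<exists>w\<in>verts E - H. (\<exists>p. awalk u p w) \<and> (\<exists>p. awalk v p w)"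
    using w(1-3) awalk_last_in_verts by blast
qed

text \<open>To the left of \<open>bre u\<close> only the empty walk at \<open>u\<close> survives, so
  the walk starting at \<open>w\<close> has to end in \<open>u\<close>.\<close>

lemma prime_breaking_M:
  assumes "leavitt_prime E I" "u \<in> breaking_vertices E H" "bre u \<notin> I"
  shows "verts E - H = M E u"
proof -
  have u: "u \<notin> H" using assms(2) by (simp add: breaking_vertices_def)
  have "w \<in> M E u" if wv: "w \<in> verts E - H" for w
  proof -
    have "vtx w \<notin> I" using wv vtx_H by blast
    then obtain a p b q x where x: "awalk a p x" "awalk b q x" "vtx w * pth a p \<notin> I" "gst b q * bre u \<notin> I"
      using prime_connecting_walks[OF assms(1) vtx_in_augmentation bre_in_augmentation _ assms(3) vtx_bre] by blast
    have "a = w" using x(3) vtx_pth_0[of w a p] by (auto simp: cg_0)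
    moreover have "b = u" "q = []" using ghost_bre_nonzero[OF breaking_finite[OF assms(2)] x(2,4)] by auto
    ultimately show ?thesis using x(1,2) M_awalk by (auto simp: awalk_Nil_iff)
  qed
  moreover have "w \<in> verts E - H" if "w \<in> M E u" for w
    using that awalk_H u M_awalk by (meson DiffI awalk_hd_in_verts)
  ultimately show ?thesis by blast
qed

text \<open>With \<open>bre\<close> on both sides both walks are empty, and they have the same
  end.\<close>

lemma prime_breaking_unique:
  assumes "leavitt_prime E I" "u \<in> breaking_vertices E H" "bre u \<notin> I" "v \<in> breaking_vertices E H" "bre v \<notin> I"
  shows "u = v"
proof -
  obtain a p b q x where x: "awalk a p x" "awalk b q x" "bre u * pth a p \<notin> I" "gst b q * bre v \<notin> I"
    using prime_connecting_walks[OF assms(1) bre_in_augmentation bre_in_augmentation assms(3,5) vtx_bre] by blast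
  have "a = u" "p = []" using bre_pth_nonzero[OF breaking_finite[OF assms(2)] x(1,3)] by auto
  moreover have "b = v" "q = []" using ghost_bre_nonzero[OF breaking_finite[OF assms(4)] x(2,4)] by auto
  ultimately show ?thesis using x(1,2) by (simp add: awalk_Nil_iff)
qed

text \<open>\<open>J\<close> is generated by the vertices and the \<open>v^H\<close> in
  \<open>I\<close>. Without exitless cycles modulo \<open>J\<close> the two ideals agree, and at
  most one \<open>v^H\<close> is missing. Otherwise the polynomials with f(c) in \<open>I\<close>
  form an ideal: if it is zero then \<open>I\<close> = \<open>J\<close>; if not, it is prime and an
  irreducible generator of it gives the third condition.\<close>

lemma prime_cases:
  assumes prime: "leavitt_prime E I"
  shows "I = leavitt_gen E (gens (breaking_vertices E H)) \<and> MT3 E (verts E - H)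
    \<or> (\<exists>u\<in>breaking_vertices E H. I = leavitt_gen E (gens (breaking_vertices E H - {u})) \<and> verts E - H = M E u)
    \<or> (\<exists>v c f. cycle_without_K E v c \<and> verts E - H = M E v \<and> irreducible f \<and>
        I = leavitt_gen E (gens (breaking_vertices E H) \<union>
          {\<Sum>i\<in>Poly_Mapping.keys f. scal (Poly_Mapping.lookup f i) * cycle_power v c i}))"
    (is "?graded \<or> ?breaking \<or> ?cycle")
proof -
  let ?B = "breaking_vertices E H"
  define S where "S = {w \<in> ?B. bre w \<in> I}"
  define J where "J = leavitt_gen E (gens S)"
  have J: "leavitt_ideal E J" unfolding J_def by (rule leavitt_ideal_gen[OF wf_digraph_axioms gens_in_augmentation])
  have JI: "J \<subseteq> I" unfolding J_def by (rule leavitt_gen_least[OF leavitt_ideal]) (auto simp: S_def H_vtx)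
  have gJ: "gens S \<subseteq> J" unfolding J_def by (rule leavitt_gen_superset)
  have idJ: "ring_ideal J" using J by (simp add: leavitt_ideal_def)
  interpret R: leavitt_quotient E J by unfold_locales (rule J)
  \<comment> \<open>\<open>J\<close> contains the same vertices as \<open>I\<close>, so the notions
    formed from \<open>H\<close> alone agree for both ideals.\<close>
  have HJ: "R.H = H" using JI gJ by (auto simp: R.H_def H_def)
  have bJ: "R.bre = bre" by (rule ext) (simp add: R.bre_def bre_def HJ)
  interpret N: no_new_vertices E J I
  proof unfold_locales
    show "vtx v \<in> J" if "v \<in> verts E" "vtx v \<in> I" for v using that gJ vtx_H by blast
    show "R.bre v \<in> J" if "v \<in> breaking_vertices E R.H" "R.bre v \<in> I" for v
      using that gJ unfolding HJ bJ S_def by blast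
  qed (use I_leavitt JI in auto)
  have span: "I \<subseteq> R.path_span R.Y" using N.in_path_span I_leavitt(2) by blast
  have mt: "MT3 E (verts E - H)" by (rule prime_MT3[OF prime])
  show ?thesis
  proof (cases "R.Y = {}")
    case True
    have "I \<subseteq> J" using span R.path_span_empty unfolding True by (rule subset_trans)
    then have IJ: "I = J" using JI by (rule equalityI)
    show ?thesis
    proof (cases "S = ?B")
      case True
      from IJ mt have ?graded unfolding J_def True by (rule conjI)
      then show ?thesis by (rule disjI1)
    next
      case False
      then obtain u where u: "u \<in> ?B" "bre u \<notin> I" unfolding S_def by blast
      have SB: "S = ?B - {u}" using prime_breaking_unique[OF prime u] u(2) by (auto simp: S_def)
      from IJ prime_breaking_M[OF prime u]
      have "I = leavitt_gen E (gens (?B - {u})) \<and> verts E - H = M E u" unfolding J_def SB by (rule conjI)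
      then have ?breaking using u(1) by (rule bexI)
      then show ?thesis by (rule disjI1[THEN disjI2])
    qed
  next
    case False
    then obtain v where v: "v \<in> R.Y" by blast
    have conn: "\<exists>z. awalk w z v" if "w \<in> verts E - R.H" for w
      using R.cycle_connected[OF _ v that] mt HJ by simp
    obtain c where sc: "single_cycle E J v c" using R.single_cycleI[OF v conn] by blast
    interpret C: single_cycle E J v c by fact
    have vH: "v \<notin> H" using C.v_notin_H HJ by simp
    have Mv: "verts E - H = M E v"
    proof -
      have "w \<in> M E v" if "w \<in> verts E - H" for w using conn[of w] that M_awalk HJ by simp
      moreover have "w \<in> verts E - H" if "w \<in> M E v" for w
        using that awalk_H vH M_awalk by (meson DiffI awalk_hd_in_verts)
      ultimately show ?thesis by blast
    qed
    have K: "cycle_without_K E v c" by (rule R.cycle_without_K_of_forced[OF C.cycle C.v_notin_H C.no_exit])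
    \<comment> \<open>A missing \<open>v^H\<close> would belong to a vertex \<open>u\<close> reached
      from the cycle; then \<open>u\<close> lies in \<open>R.Y\<close> and is tame, so its element
      is in \<open>J\<close> after all.\<close>
    have SB: "S = ?B"
    proof (rule ccontr)
      assume "S \<noteq> ?B"
      then obtain u where u: "u \<in> ?B" "bre u \<notin> I" unfolding S_def by blast
      have "v \<in> M E u" using prime_breaking_M[OF prime u] vH C.c_props(4) by blast
      then obtain p where "awalk v p u" using M_awalk by blast
      moreover have "u \<notin> H" using u(1) by (simp add: breaking_vertices_def)
      ultimately have "u \<in> R.Y" using R.Y_awalk v HJ by simp
      then have "R.tame u" by (rule R.Y_arc)
      then show False using u(2) JI unfolding R.tame_def bJ by blast
    qed
    have la: "laurent_ideal {f. C.ev f \<in> I}" by (rule C.ev_ideal[OF I_leavitt(1) JI])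
    have poly: "\<exists>f. C.ev f \<in> I \<and> C.ev f \<notin> K" if K: "leavitt_ideal E K" "J \<subseteq> K" "\<not> I \<subseteq> K" for K
    proof -
      obtain a where a: "a \<in> I" "a \<notin> K" using K(3) by blast
      have "ring_ideal K" "a \<in> R.path_span R.Y" "a \<in> augmentation_ideal"
        using K(1) span a(1) I_leavitt(2) by (auto simp: leavitt_ideal_def)
      from C.polynomial_in_ideal[OF I_leavitt(1) JI this(1) K(2) a this(2,3)] show ?thesis by metis
    qed
    show ?thesis
    proof (cases "\<exists>f\<in>{f. C.ev f \<in> I}. f \<noteq> 0")
      case False
      have "I \<subseteq> J"
      proof (rule ccontr)
        assume "\<not> I \<subseteq> J"
        then obtain f where f: "C.ev f \<in> I" "C.ev f \<notin> J" using poly[OF J order_refl] by blast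
        then have "f = 0" using False by blast
        then show False using f(2) C.ev_zero ring_idealD(1)[OF idJ] by simp
      qed
      from equalityI[OF this JI] mt have ?graded unfolding J_def SB by (rule conjI)
      then show ?thesis by (rule disjI1)
    next
      case True
      have vI: "vtx v \<notin> I" using vtx_H vH C.c_props(4) by blast
      have one: "1 \<notin> {f. C.ev f \<in> I}" using vI by (simp add: C.ev_one)
      \<comment> \<open>Primeness passes to polynomials: whatever stands between f(c) and g(c) is
        compressed to the corner at \<open>v\<close> and becomes some h(c), and fhg lies in the
        ideal together with fg.\<close>
      have pr: "f \<in> {f. C.ev f \<in> I} \<or> g \<in> {f. C.ev f \<in> I}" if fg: "f * g \<in> {f. C.ev f \<in> I}" for f g
      proof -
        have "set c \<subseteq> arcs E" using C.c_props(1) by auto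
        then have cpaug: "cycle_power v c i \<in> (augmentation_ideal :: ('v, 'e, 'k) falg set)" for i
        proof -
          have "(cycle_power v c i :: ('v, 'e, 'k) falg) \<in> carrier (free_algebra E)"
            using C.c_props(2,4) \<open>set c \<subseteq> arcs E\<close> by (intro cycle_power_carrier)
          then show ?thesis by (simp add: carrier_free_algebra)
        qed
        have evaug: "C.ev f \<in> augmentation_ideal" for f
          unfolding C.ev_def by (intro ring_ideal_sum ring_ideal_augmentation augmentation_closed(3) cpaug)
        have "C.ev f * x * C.ev g \<in> I" for x
        proof -
          have "vtx v * x \<in> augmentation_ideal" by (rule augmentation_closed(4)[OF vtx_in_augmentation])
          then obtain h where h: "R.cg (vtx v * (vtx v * x) * vtx v) (C.ev h)" using C.corner by blast
          have f: "R.cg (C.ev f) (C.ev f * (vtx v * vtx v))"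
            using R.cg_trans[OF _ R.cg_mult_l[OF R.cg_sym[OF R.vtx_idem]]] C.ev_mult[of f 1] by (simp add: C.ev_one)
          have g: "R.cg (C.ev g) (vtx v * C.ev g)"
            using C.ev_mult[of 1 g] by (simp add: C.ev_one)
          have "R.cg (C.ev f * x * C.ev g) ((C.ev f * (vtx v * vtx v)) * x * (vtx v * C.ev g))"
            by (rule R.cg_mult[OF R.cg_mult_r[OF f] g])
          also have "\<dots> = C.ev f * (vtx v * (vtx v * x) * vtx v) * C.ev g" by (simp add: mult.assoc)
          also have "R.cg \<dots> (C.ev f * C.ev h * C.ev g)" by (rule R.cg_mult_r[OF R.cg_mult_l[OF h]])
          also have "R.cg \<dots> (C.ev (f * h) * C.ev g)" by (rule R.cg_mult_r[OF R.cg_sym[OF C.ev_mult]])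
          also have "R.cg \<dots> (C.ev (f * h * g))" by (rule R.cg_sym[OF C.ev_mult])
          also have "f * h * g = h * (f * g)" by (simp add: ac_simps)
          finally show ?thesis
            using R.cg_cong_ideal[OF I_leavitt(1) JI] la fg unfolding laurent_ideal_def by blast
        qed
        then show ?thesis using leavitt_primeD[OF prime evaug evaug] by simp
      qed
      obtain d where d: "irreducible d" "d \<in> {f. C.ev f \<in> I}" "\<forall>g\<in>{f. C.ev f \<in> I}. d dvd g"
        using prime_laurent_ideal_irreducible[OF la True one pr] by metis
      define T where "T = gens ?B \<union> {\<Sum>i\<in>Poly_Mapping.keys d. scal (Poly_Mapping.lookup d i) * cycle_power v c i}"
      have T: "T = gens ?B \<union> {C.ev d}" by (simp add: T_def C.ev_def)
      have TI: "T \<subseteq> I" using gJ JI d(2) SB unfolding T by blast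
      have "leavitt_ideal E (leavitt_gen E T)"
        by (rule leavitt_ideal_gen[OF wf_digraph_axioms]) (use TI I_leavitt(2) in blast)
      note LT = this
      have idT: "ring_ideal (leavitt_gen E T)" using LT by (simp add: leavitt_ideal_def)
      have JT: "J \<subseteq> leavitt_gen E T" unfolding J_def
        by (rule leavitt_gen_least[OF LT]) (use leavitt_gen_superset[of T E] in \<open>auto simp: T SB\<close>)
      \<comment> \<open>An element of \<open>I\<close> outside the generated ideal would yield a
        polynomial of the same kind, but the polynomials belonging to \<open>I\<close> are multiples
        of \<open>d\<close>.\<close>
      have "I \<subseteq> leavitt_gen E T"
      proof (rule ccontr)
        assume "\<not> I \<subseteq> leavitt_gen E T"
        then obtain f where f: "C.ev f \<in> I" "C.ev f \<notin> leavitt_gen E T" using poly[OF LT JT] by blast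
        then obtain h where h: "f = h * d" using d(3) by (metis dvdE mem_Collect_eq mult.commute)
        have "C.ev d \<in> leavitt_gen E T" using leavitt_gen_superset[of T E] T by blast
        then have "C.ev h * C.ev d \<in> leavitt_gen E T" by (rule ring_idealD(3)[OF idT])
        then show False using f(2) R.cg_cong_ideal[OF idT JT C.ev_mult[of h d]] h by blast
      qed
      then have "I = leavitt_gen E T" using leavitt_gen_least[OF leavitt_ideal TI] by (rule equalityI)
      with K Mv d(1) have "cycle_without_K E v c \<and> verts E - H = M E v \<and> irreducible d \<and> I = leavitt_gen E T"
        by (intro conjI)
      then have ?cycle unfolding T_def by (intro exI)
      then show ?thesis by (rule disjI2[THEN disjI2])
    qed
  qed
qed

end

section \<open>Transfer to the ideals of the Leavitt path algebra\<close>

theorem theorem3p10: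
  fixes E :: "('v, 'e) pre_digraph"
    and P :: "('v, 'e, 'k::field) falg set set"
    and H :: "'v set"
  assumes "wf_digraph E"
    and "two_sided_ideal P (leavitt_path_algebra E)"
    and "P \<noteq> carrier (leavitt_path_algebra E)"
    and "H = {v \<in> verts E. lvertex E v \<in> P}"
  shows "prime_two_sided_ideal P (leavitt_path_algebra E) \<longleftrightarrow>
    (P = ideal_generated (leavitt_path_algebra E)
           (lvertex E ` H \<union> breaking_elt E H ` breaking_vertices E H) \<and>
       MT3 E (verts E - H))
    \<or> (\<exists>u \<in> breaking_vertices E H.
         P = ideal_generated (leavitt_path_algebra E)
           (lvertex E ` H \<union> breaking_elt E H ` (breaking_vertices E H - {u})) \<and>
         verts E - H = M E u)
    \<or> (\<exists>v c (f :: int \<Rightarrow>\<^sub>0 'k).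
         cycle_without_K E v c \<and> verts E - H = M E v \<and> irreducible f \<and>
         P = ideal_generated (leavitt_path_algebra E)
           (lvertex E ` H \<union> breaking_elt E H ` breaking_vertices E H \<union>
            {laurent_at_cycle E v c f}))"
proof -
  note wf = assms(1) and P = assms(2)
  define Q where "Q = pull E P"
  have LQ: "leavitt_ideal E Q" unfolding Q_def by (rule pull_leavitt_ideal[OF wf P])
  interpret wf_digraph E by (rule wf)
  interpret leavitt_quotient E Q by unfold_locales (rule LQ)
  have ne: "Q \<noteq> augmentation_ideal"
  proof
    assume Q: "Q = augmentation_ideal"
    have "x \<in> P" if x: "x \<in> carrier (leavitt_path_algebra E)" for x
    proof -
      obtain y where y: "y \<in> carrier (free_algebra E)" "x = lclass E y" using x unfolding carrier_L[OF wf] by blast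
      then have "y \<in> pull E P" using Q unfolding Q_def by (simp add: carrier_free_algebra)
      then show ?thesis using y by (simp add: pull_def carrier_free_algebra)
    qed
    moreover have "P \<subseteq> carrier (leavitt_path_algebra E)"
      using P unfolding two_sided_ideal_L[OF wf] by (rule conjunct1)
    ultimately have "P = carrier (leavitt_path_algebra E)" by (intro equalityI subsetI) auto
    with assms(3) show False by (rule notE)
  qed
  have carr_monom: "monom w a \<in> carrier (free_algebra E)" if "w \<noteq> []" "set w \<subseteq> generators E" for w and a :: 'k
    using that by (simp add: carrier_free_algebra monom_in_augmentation restr_monom)
  have carr_vtx: "(vtx v :: ('v, 'e, 'k) falg) \<in> carrier (free_algebra E)" if "v \<in> verts E" for v
    unfolding vtx_def using that by (intro carr_monom) (auto simp: generators_def)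
  have carr_sum: "sum f S \<in> carrier (free_algebra E)" if "\<And>s. s \<in> S \<Longrightarrow> f s \<in> carrier (free_algebra E)"
    for f :: "'z \<Rightarrow> ('v, 'e, 'k) falg" and S
    using that by (induct S rule: infinite_finite_induct)
      (auto simp: carrier_free_algebra augmentation_closed restr_add)
  have carr_bre: "bre v \<in> carrier (free_algebra E)" if "v \<in> verts E" for v
    unfolding bre_def
    using carr_vtx[OF that] by (intro free_algebra_closed carr_sum)
      (auto simp: edge_def ghost_def monom_mult generators_def arcs_avoiding_def intro!: carr_monom)
  have lv: "lvertex E v \<in> P \<longleftrightarrow> vtx v \<in> Q" if "v \<in> verts E" for v
    using carr_vtx[OF that] unfolding lvertex_def Q_def by (simp add: carrier_free_algebra pull_def)
  have HH: "H = leavitt_quotient.H E Q" using lv by (auto simp: assms(4) local.H_def)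
  have br: "breaking_elt E H v = lclass E (bre v)" for v
    by (simp add: breaking_elt_def bre_def HH)
  have img: "lvertex E ` H \<union> breaking_elt E H ` S = lclass E ` gens S" for S
    by (simp add: image_Un image_image lvertex_def br HH[symmetric])
  have carr_gens: "gens S \<subseteq> carrier (free_algebra E)" if "S \<subseteq> breaking_vertices E H" for S
    using that carr_vtx carr_bre by (auto simp: breaking_vertices_def local.H_def)
  have gen: "P = ideal_generated (leavitt_path_algebra E) (lvertex E ` H \<union> breaking_elt E H ` S) \<longleftrightarrow>
      Q = leavitt_gen E (gens S)" if "S \<subseteq> breaking_vertices E H" for S
    unfolding img by (rule pull_eq_gen_iff[OF wf P carr_gens[OF that], folded Q_def])
  have gen_cycle: "P = ideal_generated (leavitt_path_algebra E)
        (lvertex E ` H \<union> breaking_elt E H ` breaking_vertices E H \<union> {laurent_at_cycle E v c f}) \<longleftrightarrow>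
      Q = leavitt_gen E (gens (breaking_vertices E H) \<union>
        {\<Sum>i\<in>Poly_Mapping.keys f. scal (Poly_Mapping.lookup f i) * cycle_power v c i})"
    if c: "cycle_without_K E v c" for v c and f :: "int \<Rightarrow>\<^sub>0 'k"
  proof -
    have "awalk v c v" "c \<noteq> []" using c by (simp_all add: cycle_without_K_def cycle_based_at_def)
    then have "(cycle_power v c i :: ('v, 'e, 'k) falg) \<in> carrier (free_algebra E)" for i
      by (intro cycle_power_carrier) auto
    then have "(\<Sum>i\<in>Poly_Mapping.keys f. scal (Poly_Mapping.lookup f i) * cycle_power v c i) \<in> carrier (free_algebra E)"
      by (intro carr_sum scal_carrier[OF wf])
    then have T: "gens (breaking_vertices E H) \<union>
        {\<Sum>i\<in>Poly_Mapping.keys f. scal (Poly_Mapping.lookup f i) * cycle_power v c i} \<subseteq> carrier (free_algebra E)"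
      using carr_gens[OF order_refl] by simp
    have "lvertex E ` H \<union> breaking_elt E H ` breaking_vertices E H \<union> {laurent_at_cycle E v c f} =
      lclass E ` (gens (breaking_vertices E H) \<union>
        {\<Sum>i\<in>Poly_Mapping.keys f. scal (Poly_Mapping.lookup f i) * cycle_power v c i})"
      unfolding img laurent_at_cycle_def by (simp add: image_Un)
    then show ?thesis by (simp only: pull_eq_gen_iff[OF wf P T, folded Q_def])
  qed
  have "prime_two_sided_ideal P (leavitt_path_algebra E) \<longleftrightarrow> leavitt_prime E Q"
    unfolding Q_def by (rule prime_pull_iff[OF wf P])
  also have "\<dots> \<longleftrightarrow> (Q = leavitt_gen E (gens (breaking_vertices E H)) \<and> MT3 E (verts E - H))
    \<or> (\<exists>u\<in>breaking_vertices E H. Q = leavitt_gen E (gens (breaking_vertices E H - {u})) \<and> verts E - H = M E u)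
    \<or> (\<exists>v c f. cycle_without_K E v c \<and> verts E - H = M E v \<and> irreducible f \<and>
        Q = leavitt_gen E (gens (breaking_vertices E H) \<union>
          {\<Sum>i\<in>Poly_Mapping.keys f. scal (Poly_Mapping.lookup f i) * cycle_power v c i}))"
    (is "_ \<longleftrightarrow> ?r")
  proof
    assume "leavitt_prime E Q"
    then show ?r unfolding HH by (rule prime_cases)
  next
    assume ?r
    then show "leavitt_prime E Q"
      unfolding HH
    proof (elim disjE conjE bexE exE)
      fix u assume "u \<in> breaking_vertices E local.H" "Q = leavitt_gen E (gens (breaking_vertices E local.H - {u}))"
        "verts E - local.H = M E u"
      then show ?thesis by (rule prime_of_breaking[OF ne])
    next
      fix v c f
      assume "cycle_without_K E v c" "verts E - local.H = M E v" "irreducible f"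
        "Q = leavitt_gen E (gens (breaking_vertices E local.H) \<union>
          {\<Sum>i\<in>Poly_Mapping.keys f. scal (Poly_Mapping.lookup f i) * cycle_power v c i})"
      then show ?thesis by (rule prime_of_cycle[OF ne])
    qed (rule prime_of_graded[OF ne])
  qed
  finally show ?thesis
    by (simp only: gen[OF order_refl] gen[OF Diff_subset] gen_cycle cong: conj_cong)
qed

end
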